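(* Let $1\le d\le n-1$ and let $X_w$, $w\in W^P$, be a toric Schubert variety in $\mathrm{Gr}(d,n)$. The following statements are equivalent. (1) $X_w$ is smooth. (2) $w$ is the identity $e$, or $w$ has a reduced decomposition of one of the following two forms: (a) $w=s_{d+x-1}s_{d+x-2}\cdots s_d$ for some $1<x\le n-d$; (b) $w=s_{d-y}s_{d-y+1}\cdots s_d$ for some $0\le y\le d-1$. (3) The partition $\lambda_w$ is a column partition or a row partition (the empty partition being allowed).
   Context: $G=\mathrm{SL}_n(\mathbb{C})$, $B$ is the Borel subgroup of upper triangular matrices, $T\subset B$ is the maximal torus of diagonal matrices, $P=P_d\supset B$ is the maximal parabolic subgroup with $G/P\cong \mathrm{Gr}(d,n)$. The Weyl group is $\mathfrak{S}_n$ with simple reflections $s_i=(i\ i+1)$, and $W^P=\{w\in\mathfrak{S}_n \mid w(1)<\cdots<w(d),\ w(d+1)<\cdots<w(n)\}$. For $w\in W^P$, $X_w=\overline{BwP/P}\subset G/P$; it is toric if it is a toric variety with respect to the left $T$-action (normal with a dense $T$-orbit; the action need not be effective). The partition of $w$ is $\lambda_w=(\lambda_1,\dots,\lambda_d)$ with $\lambda_i=w(d-i+1)-(d-i+1)$ (trailing zeros omitted). A row partition is a partition $(x)$ with one part; a column partition is a partition $(1^y)=(1,\dots,1)$. *)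

theory Defs
  imports
    "HOL-Analysis.Abstract_Limits"
    "HOL-Algebra.Coset"
    "HOL-Algebra.Ideal"
    "HOL-Algebra.Divisibility"
    "HOL-Combinatorics.Permutations"
    "HOL-Library.Extended_Nat"
    "HOL-Library.More_List"
    "Jordan_Normal_Form.Determinant"
begin

no_notation eq_closure_of (\<open>closure'_of\<index>\<close>)

section \<open>Spaces with functions\<close>

text \<open>Varieties over the complex numbers are treated as spaces with functions: a topological space
  together with, for each open set \<open>U\<close>, the set of regular functions on \<open>U\<close>.  Functions are total,
  and their values outside \<open>U\<close> are irrelevant.\<close>

record 'a fspace =
  fs_top :: "'a topology"
  fs_reg :: "'a set \<Rightarrow> ('a \<Rightarrow> complex) set"

definition sub_fspace :: "'a fspace \<Rightarrow> 'a set \<Rightarrow> 'a fspace" where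
  "sub_fspace X Z = \<lparr>
     fs_top = subtopology (fs_top X) Z,
     fs_reg = (\<lambda>U. {f. \<forall>x\<in>U. \<exists>V g. openin (fs_top X) V \<and> x \<in> V \<and> g \<in> fs_reg X V \<and>
                          (\<forall>y\<in>V \<inter> U. f y = g y)}) \<rparr>"

definition quotient_fspace :: "'a fspace \<Rightarrow> ('a \<Rightarrow> 'b) \<Rightarrow> 'b fspace" where
  "quotient_fspace X \<pi> = \<lparr>
     fs_top = topology (\<lambda>V. V \<subseteq> \<pi> ` topspace (fs_top X) \<and>
                            openin (fs_top X) {x \<in> topspace (fs_top X). \<pi> x \<in> V}),
     fs_reg = (\<lambda>V. {f. f \<circ> \<pi> \<in> fs_reg X {x \<in> topspace (fs_top X). \<pi> x \<in> V}}) \<rparr>"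

lemma istopology_quotient:
  "istopology (\<lambda>V. V \<subseteq> \<pi> ` topspace X \<and> openin X {x \<in> topspace X. \<pi> x \<in> V})"
  unfolding istopology_def
proof (intro conjI allI impI)
  fix S T
  assume "S \<subseteq> \<pi> ` topspace X \<and> openin X {x \<in> topspace X. \<pi> x \<in> S}"
    and "T \<subseteq> \<pi> ` topspace X \<and> openin X {x \<in> topspace X. \<pi> x \<in> T}"
  moreover have "{x \<in> topspace X. \<pi> x \<in> S \<inter> T} =
      {x \<in> topspace X. \<pi> x \<in> S} \<inter> {x \<in> topspace X. \<pi> x \<in> T}" by auto
  ultimately show "S \<inter> T \<subseteq> \<pi> ` topspace X" "openin X {x \<in> topspace X. \<pi> x \<in> S \<inter> T}"
    by auto
next
  fix K
  assume K: "\<forall>V\<in>K. V \<subseteq> \<pi> ` topspace X \<and> openin X {x \<in> topspace X. \<pi> x \<in> V}"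
  then show "\<Union> K \<subseteq> \<pi> ` topspace X" by blast
  have "{x \<in> topspace X. \<pi> x \<in> \<Union> K} = (\<Union>V\<in>K. {x \<in> topspace X. \<pi> x \<in> V})" by auto
  then show "openin X {x \<in> topspace X. \<pi> x \<in> \<Union> K}" using K by auto
qed

lemma openin_quotient_fspace:
  "openin (fs_top (quotient_fspace X \<pi>)) V \<longleftrightarrow>
     V \<subseteq> \<pi> ` topspace (fs_top X) \<and> openin (fs_top X) {x \<in> topspace (fs_top X). \<pi> x \<in> V}"
  unfolding quotient_fspace_def by (simp add: topology_inverse'[OF istopology_quotient])


section \<open>Local rings, normality and smoothness\<close>

definition germ :: "'a fspace \<Rightarrow> 'a \<Rightarrow> ('a \<Rightarrow> complex) \<Rightarrow> ('a \<Rightarrow> complex) set" where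
  "germ X x f = {g. eventually (\<lambda>y. g y = f y) (nhdsin (fs_top X) x)}"

definition local_ring :: "'a fspace \<Rightarrow> 'a \<Rightarrow> ('a \<Rightarrow> complex) set ring" where
  "local_ring X x = \<lparr>
     carrier = {germ X x f | f U. openin (fs_top X) U \<and> x \<in> U \<and> f \<in> fs_reg X U},
     monoid.mult = (\<lambda>A B. \<Union>f\<in>A. \<Union>g\<in>B. germ X x (\<lambda>y. f y * g y)),
     one = germ X x (\<lambda>_. 1),
     zero = germ X x (\<lambda>_. 0),
     add = (\<lambda>A B. \<Union>f\<in>A. \<Union>g\<in>B. germ X x (\<lambda>y. f y + g y)) \<rparr>"

definition local_max_ideal :: "'a fspace \<Rightarrow> 'a \<Rightarrow> ('a \<Rightarrow> complex) set set" where
  "local_max_ideal X x = {A \<in> carrier (local_ring X x). \<forall>f\<in>A. f x = 0}"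

text \<open>The equation below says that the fraction \<open>a / b\<close> is a root of the monic polynomial with lower
  coefficients \<open>c 0, \<dots>, c (k - 1)\<close>, and \<open>b divides a\<close> says that \<open>a / b\<close> lies in \<open>R\<close>.\<close>

definition integrally_closed_domain :: "('a, 'b) ring_scheme \<Rightarrow> bool" where
  "integrally_closed_domain R \<longleftrightarrow> domain R \<and>
     (\<forall>a \<in> carrier R. \<forall>b \<in> carrier R - {\<zero>\<^bsub>R\<^esub>}.
        (\<exists>(k::nat) c. c \<in> {..<k} \<rightarrow> carrier R \<and>
           a [^]\<^bsub>R\<^esub> k \<oplus>\<^bsub>R\<^esub>
             (\<Oplus>\<^bsub>R\<^esub>i\<in>{..<k}. c i \<otimes>\<^bsub>R\<^esub> a [^]\<^bsub>R\<^esub> i \<otimes>\<^bsub>R\<^esub> b [^]\<^bsub>R\<^esub> (k - i)) = \<zero>\<^bsub>R\<^esub>)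
        \<longrightarrow> b divides\<^bsub>R\<^esub> a)"

definition normal_variety :: "'a fspace \<Rightarrow> bool" where
  "normal_variety X \<longleftrightarrow> (\<forall>x\<in>topspace (fs_top X). integrally_closed_domain (local_ring X x))"

definition krull_dim :: "('a, 'b) ring_scheme \<Rightarrow> enat" where
  "krull_dim R = Sup {enat k | k. \<exists>P. (\<forall>i\<le>k. primeideal (P i) R) \<and> (\<forall>i<k. P i \<subset> P (Suc i))}"

text \<open>Smoothness at \<open>x\<close> means that the local ring is regular: its maximal ideal is generated by as
  many elements as the Krull dimension.  Local rings of varieties are Noetherian, so this is not
  listed as a separate condition.\<close>

definition smooth_at :: "'a fspace \<Rightarrow> 'a \<Rightarrow> bool" where
  "smooth_at X x \<longleftrightarrow>
     (\<exists>S. finite S \<and> S \<subseteq> carrier (local_ring X x) \<and>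
          Idl\<^bsub>local_ring X x\<^esub> S = local_max_ideal X x \<and>
          enat (card S) = krull_dim (local_ring X x))"

definition smooth_variety :: "'a fspace \<Rightarrow> bool" where
  "smooth_variety X \<longleftrightarrow> (\<forall>x\<in>topspace (fs_top X). smooth_at X x)"


section \<open>The special linear group as a variety\<close>

definition SL :: "nat \<Rightarrow> complex mat monoid" where
  "SL n = \<lparr> carrier = {A \<in> carrier_mat n n. det A = 1}, monoid.mult = (*), one = 1\<^sub>m n \<rparr>"

inductive_set poly_fun :: "nat \<Rightarrow> (complex mat \<Rightarrow> complex) set" for n where
  const: "(\<lambda>_. c) \<in> poly_fun n"
| entry: "i < n \<Longrightarrow> j < n \<Longrightarrow> (\<lambda>A. A $$ (i, j)) \<in> poly_fun n"
| add: "f \<in> poly_fun n \<Longrightarrow> g \<in> poly_fun n \<Longrightarrow> (\<lambda>A. f A + g A) \<in> poly_fun n"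
| mult: "f \<in> poly_fun n \<Longrightarrow> g \<in> poly_fun n \<Longrightarrow> (\<lambda>A. f A * g A) \<in> poly_fun n"

definition zariski_SL :: "nat \<Rightarrow> complex mat topology" where
  "zariski_SL n =
     topology (\<lambda>U. \<exists>F\<subseteq>poly_fun n. U = {A \<in> carrier (SL n). \<exists>f\<in>F. f A \<noteq> 0})"

definition SL_variety :: "nat \<Rightarrow> complex mat fspace" where
  "SL_variety n = \<lparr>
     fs_top = zariski_SL n,
     fs_reg = (\<lambda>U. {h. \<forall>x\<in>U. \<exists>V. openin (zariski_SL n) V \<and> x \<in> V \<and> V \<subseteq> U \<and>
                 (\<exists>p\<in>poly_fun n. \<exists>q\<in>poly_fun n. \<forall>y\<in>V. q y \<noteq> 0 \<and> h y = p y / q y)}) \<rparr>"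

lemma istopology_zariski_SL:
  "istopology (\<lambda>U. \<exists>F\<subseteq>poly_fun n. U = {A \<in> carrier (SL n). \<exists>f\<in>F. f A \<noteq> 0})"
  unfolding istopology_def
proof (intro conjI allI impI)
  fix S T
  assume "\<exists>F\<subseteq>poly_fun n. S = {A \<in> carrier (SL n). \<exists>f\<in>F. f A \<noteq> 0}"
    and "\<exists>F\<subseteq>poly_fun n. T = {A \<in> carrier (SL n). \<exists>f\<in>F. f A \<noteq> 0}"
  then obtain F H where F: "F \<subseteq> poly_fun n" "S = {A \<in> carrier (SL n). \<exists>f\<in>F. f A \<noteq> 0}"
    and H: "H \<subseteq> poly_fun n" "T = {A \<in> carrier (SL n). \<exists>f\<in>H. f A \<noteq> 0}" by blast
  let ?K = "(\<lambda>(f, h). (\<lambda>A. f A * h A)) ` (F \<times> H)"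
  have "?K \<subseteq> poly_fun n" using F(1) H(1) by (auto intro: poly_fun.mult)
  moreover have "(\<exists>k\<in>?K. k A \<noteq> 0) \<longleftrightarrow> (\<exists>f\<in>F. f A \<noteq> 0) \<and> (\<exists>h\<in>H. h A \<noteq> 0)" for A
    by force
  then have "S \<inter> T = {A \<in> carrier (SL n). \<exists>f\<in>?K. f A \<noteq> 0}"
    unfolding F(2) H(2) by blast
  ultimately show "\<exists>F\<subseteq>poly_fun n. S \<inter> T = {A \<in> carrier (SL n). \<exists>f\<in>F. f A \<noteq> 0}" by blast
next
  fix K
  assume "\<forall>V\<in>K. \<exists>F\<subseteq>poly_fun n. V = {A \<in> carrier (SL n). \<exists>f\<in>F. f A \<noteq> 0}"
  from bchoice[OF this] obtain F where
    F: "\<forall>V\<in>K. F V \<subseteq> poly_fun n \<and> V = {A \<in> carrier (SL n). \<exists>f\<in>F V. f A \<noteq> 0}"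
    by (elim exE)
  have "\<Union> K = {A \<in> carrier (SL n). \<exists>f\<in>(\<Union>V\<in>K. F V). f A \<noteq> 0}"
    (is "_ = ?R")
  proof (intro Set.set_eqI)
    fix A
    have "A \<in> V \<longleftrightarrow> A \<in> {A \<in> carrier (SL n). \<exists>f\<in>F V. f A \<noteq> 0}" if "V \<in> K" for V
      by (rule arg_cong[OF conjunct2[OF bspec[OF F that]], of "\<lambda>S. A \<in> S"])
    then have "(\<exists>V\<in>K. A \<in> V) \<longleftrightarrow> (\<exists>V\<in>K. A \<in> {A \<in> carrier (SL n). \<exists>f\<in>F V. f A \<noteq> 0})"
      by (rule bex_cong[OF refl])
    then show "A \<in> \<Union> K \<longleftrightarrow> A \<in> ?R" by (simp only: Union_iff mem_Collect_eq UN_iff) blast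
  qed
  moreover have "(\<Union>V\<in>K. F V) \<subseteq> poly_fun n" using F by (intro UN_least) simp
  ultimately show "\<exists>F\<subseteq>poly_fun n. \<Union> K = {A \<in> carrier (SL n). \<exists>f\<in>F. f A \<noteq> 0}" by (intro exI conjI)
qed

lemma openin_zariski_SL:
  "openin (zariski_SL n) U \<longleftrightarrow>
     (\<exists>F\<subseteq>poly_fun n. U = {A \<in> carrier (SL n). \<exists>f\<in>F. f A \<noteq> 0})"
  unfolding zariski_SL_def by (simp add: topology_inverse'[OF istopology_zariski_SL])

lemma topspace_zariski_SL: "topspace (zariski_SL n) = carrier (SL n)"
proof
  show "topspace (zariski_SL n) \<subseteq> carrier (SL n)"
    unfolding topspace_def openin_zariski_SL by blast
  have "openin (zariski_SL n) (carrier (SL n))"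
    unfolding openin_zariski_SL
    by (rule exI[of _ "{\<lambda>_. 1}"]) (auto intro: poly_fun.const)
  then show "carrier (SL n) \<subseteq> topspace (zariski_SL n)" by (rule openin_subset)
qed


section \<open>Schubert varieties in the Grassmannian\<close>

definition Borel :: "nat \<Rightarrow> complex mat set" where
  "Borel n = {A \<in> carrier (SL n). upper_triangular A}"

definition Torus :: "nat \<Rightarrow> complex mat set" where
  "Torus n = {A \<in> carrier (SL n). diagonal_mat A}"

text \<open>The stabiliser of the span of the first \<open>d\<close> standard basis vectors.\<close>

definition Parabolic :: "nat \<Rightarrow> nat \<Rightarrow> complex mat set" where
  "Parabolic n d = {A \<in> carrier (SL n). \<forall>i j. d \<le> i \<and> i < n \<and> j < d \<longrightarrow> A $$ (i, j) = 0}"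

text \<open>The quotient variety \<open>G/P\<close>; its points are the left cosets \<open>gP\<close>.\<close>

definition Grassmannian :: "nat \<Rightarrow> nat \<Rightarrow> complex mat set fspace" where
  "Grassmannian n d = quotient_fspace (SL_variety n) (\<lambda>g. g <#\<^bsub>SL n\<^esub> Parabolic n d)"

definition min_coset_reps :: "nat \<Rightarrow> nat \<Rightarrow> (nat \<Rightarrow> nat) set" where
  "min_coset_reps n d =
     {w. w permutes {1..n} \<and> strict_mono_on {1..d} w \<and> strict_mono_on {d+1..n} w}"

text \<open>The representatives in the normaliser of the torus of a permutation \<open>w\<close> of \<open>{1..n}\<close>: the
  monomial matrices of determinant 1 sending the \<open>j\<close>-th coordinate line to the \<open>w j\<close>-th one.
  Matrix indices start at 0.  A permutation matrix itself may have determinant -1; all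
  representatives give the same set \<open>BwP\<close>, since they differ by factors in the torus.\<close>

definition monomial_reps :: "nat \<Rightarrow> (nat \<Rightarrow> nat) \<Rightarrow> complex mat set" where
  "monomial_reps n w =
     {M \<in> carrier (SL n). \<forall>i<n. \<forall>j<n. M $$ (i, j) \<noteq> 0 \<longleftrightarrow> Suc i = w (Suc j)}"

definition Schubert_cell :: "nat \<Rightarrow> nat \<Rightarrow> (nat \<Rightarrow> nat) \<Rightarrow> complex mat set set" where
  "Schubert_cell n d w =
     {(b \<otimes>\<^bsub>SL n\<^esub> m) <#\<^bsub>SL n\<^esub> Parabolic n d | b m. b \<in> Borel n \<and> m \<in> monomial_reps n w}"

definition Schubert_variety :: "nat \<Rightarrow> nat \<Rightarrow> (nat \<Rightarrow> nat) \<Rightarrow> complex mat set fspace" where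
  "Schubert_variety n d w =
     sub_fspace (Grassmannian n d) (fs_top (Grassmannian n d) closure_of Schubert_cell n d w)"

definition torus_orbit :: "nat \<Rightarrow> complex mat set \<Rightarrow> complex mat set set" where
  "torus_orbit n C = {t <#\<^bsub>SL n\<^esub> C | t. t \<in> Torus n}"

definition toric_Schubert :: "nat \<Rightarrow> nat \<Rightarrow> (nat \<Rightarrow> nat) \<Rightarrow> bool" where
  "toric_Schubert n d w \<longleftrightarrow>
     normal_variety (Schubert_variety n d w) \<and>
     (\<exists>C \<in> topspace (fs_top (Schubert_variety n d w)).
        fs_top (Schubert_variety n d w) closure_of torus_orbit n C =
        topspace (fs_top (Schubert_variety n d w)))"


section \<open>Words and partitions\<close>

text \<open>A word \<open>[i\<^sub>1, \<dots>, i\<^sub>k]\<close> stands for the product of the simple reflections \<open>(i\<^sub>j  i\<^sub>j + 1)\<close> in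
  this order, so the last one acts first.  A word is reduced if it is a shortest one for its
  product.\<close>

definition word_prod :: "nat list \<Rightarrow> nat \<Rightarrow> nat" where
  "word_prod is = foldr (\<lambda>i u. Transposition.transpose i (i + 1) \<circ> u) is id"

definition reduced_decomposition :: "nat \<Rightarrow> (nat \<Rightarrow> nat) \<Rightarrow> nat list \<Rightarrow> bool" where
  "reduced_decomposition n w is \<longleftrightarrow>
     set is \<subseteq> {1..n - 1} \<and> word_prod is = w \<and>
     (\<forall>js. set js \<subseteq> {1..n - 1} \<and> word_prod js = w \<longrightarrow> length is \<le> length js)"

definition partition_of_perm :: "nat \<Rightarrow> (nat \<Rightarrow> nat) \<Rightarrow> nat list" where
  "partition_of_perm d w =
     strip_while (\<lambda>k. k = 0) (map (\<lambda>i. w (d - i + 1) - (d - i + 1)) [1..<d+1])"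

definition row_partition :: "nat list \<Rightarrow> bool" where
  "row_partition p \<longleftrightarrow> (\<exists>x\<ge>1. p = [x])"

definition column_partition :: "nat list \<Rightarrow> bool" where
  "column_partition p \<longleftrightarrow> (\<exists>y\<ge>1. p = replicate y 1)"

end

(*
  Write X for the Schubert variety, k for the number of nonzero parts of the partition and l for its
  largest part.  On the big cell around the base point eP the Grassmannian is the affine space of
  (n - d) x d matrices; X is contained there in the matrices supported on an l x k block and contains
  all the coordinate axes of that block.  The l * k derivatives along these axes show that the maximal
  ideal at eP needs at least l * k generators.  If a torus orbit is dense, the entries of its points
  are monomials in l + k - 1 parameters, so any l + k germs are algebraically dependent, and by the
  argument of Coquand and Lombardi the Krull dimension is at most l + k - 1.  Smoothness at eP thus
  forces l * k <= l + k - 1, that is, l <= 1 or k <= 1.  Conversely, for a row or a column X contains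
  the whole block, hence is an affine space near eP, and the Borel subgroup moves every point of X
  into the big cell.
*)

theory Submission
  imports Defs
begin

section \<open>Polynomial functions and linear systems\<close>

text \<open>All three statements are compared through the single condition
  \<open>d - 1 \<le> m \<or> t \<le> d\<close>, which says k <= 1 or l <= 1 because k = d - m and l
  = t + 1 - d. No dimension theory is presupposed: the Krull dimension is bounded above by counting
  monomials and below by an explicit chain of primes, and the number of generators by a derivation.
  Normality supplies the ring axioms of the local rings. X is a Zariski closure, yet membership in
  it is shown by curves that converge in the classical topology; this suffices because polynomials
  are continuous. Vanishing outside the block, in turn, is a closed condition and is checked on the
  cell alone. Regular functions on G/P are given as fractions on open sets of SL, which need not be
  unions of cosets; the unipotent representatives \<open>\<sigma> a\<close> turn them into fractions
  in chart coordinates. The number l + k - 1 arises because a common factor of all torus entries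
  acts trivially on the coordinates.\<close>

lemma homogeneous_system_nontrivial:
  fixes e :: "'k \<Rightarrow> 'a \<Rightarrow> 'f :: field"
  assumes "finite K" "finite A" "card K < card A"
  shows "\<exists>x. (\<exists>a\<in>A. x a \<noteq> 0) \<and> (\<forall>k\<in>K. (\<Sum>a\<in>A. e k a * x a) = 0)"
  using assms
proof (induction K arbitrary: A e rule: finite_induct)
  case empty
  then obtain a where "a \<in> A" by (metis card_gt_0_iff card.empty ex_in_conv)
  then show ?case by (intro exI[of _ "\<lambda>_. 1"]) auto
next
  case (insert k K)
  show ?case
  proof (cases "\<forall>a\<in>A. e k a = 0")
    case True
    from insert have "card K < card A" by simp
    from insert.IH[OF insert.prems(1) this, of e] obtain x where
      x: "\<exists>a\<in>A. x a \<noteq> 0" "\<forall>j\<in>K. (\<Sum>a\<in>A. e j a * x a) = 0" by blast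
    have "(\<Sum>a\<in>A. e k a * x a) = 0" using True by (intro sum.neutral) simp
    with x show ?thesis by blast
  next
    case False
    then obtain b where b: "b \<in> A" "e k b \<noteq> 0" by blast
    define A' where "A' = A - {b}"
    have A: "A = insert b A'" "b \<notin> A'" "finite A'" using b insert.prems by (auto simp: A'_def)
    have "card K < card A'" using insert A by simp
    \<comment> \<open>Gaussian elimination: equation \<open>k\<close>, solved for the unknown
      \<open>b\<close>, is substituted into the other equations; \<open>y\<close> puts the solved
      value back at \<open>b\<close>.\<close>
    from insert.IH[OF A(3) this, of "\<lambda>j a. e j a - e j b * e k a / e k b"]
    obtain x where x: "\<exists>a\<in>A'. x a \<noteq> 0"
      "\<forall>j\<in>K. (\<Sum>a\<in>A'. (e j a - e j b * e k a / e k b) * x a) = 0" by blast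
    define s where "s = (\<Sum>a\<in>A'. e k a * x a)"
    define y where "y = x(b := - s / e k b)"
    have sum_y: "(\<Sum>a\<in>A. e j a * y a) = e j b * (- s / e k b) + (\<Sum>a\<in>A'. e j a * x a)" for j
      unfolding A(1) using A(2,3) by (subst sum.insert) (auto simp: y_def intro!: sum.cong)
    have "(\<Sum>a\<in>A. e j a * y a) = 0" if "j \<in> K" for j
    proof -
      have "(\<Sum>a\<in>A'. (e j a - e j b * e k a / e k b) * x a)
          = (\<Sum>a\<in>A'. e j a * x a) - e j b / e k b * s"
        by (simp add: s_def sum_distrib_left algebra_simps sum_subtractf)
      then show ?thesis using x(2) that by (simp add: sum_y)
    qed
    moreover have "(\<Sum>a\<in>A. e k a * y a) = 0" using b by (simp add: sum_y s_def)
    moreover have "\<exists>a\<in>A. y a \<noteq> 0" using x(1) A by (auto simp: y_def)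
    ultimately show ?thesis by blast
  qed
qed

section \<open>Polynomial functions in several variables\<close>

text \<open>Polynomials are functions on total assignments, not formal objects, so that substituting
  a parametrization is plain composition. \<open>I\<close> restricts the variables that may occur;
  values outside \<open>I\<close> have no influence (\<open>mpoly_fun_cong\<close>).\<close>

inductive_set mpoly_fun :: "'v set \<Rightarrow> (('v \<Rightarrow> complex) \<Rightarrow> complex) set" for I where
  const: "(\<lambda>_. c) \<in> mpoly_fun I"
| var: "i \<in> I \<Longrightarrow> (\<lambda>z. z i) \<in> mpoly_fun I"
| add: "p \<in> mpoly_fun I \<Longrightarrow> q \<in> mpoly_fun I \<Longrightarrow> (\<lambda>z. p z + q z) \<in> mpoly_fun I"
| mult: "p \<in> mpoly_fun I \<Longrightarrow> q \<in> mpoly_fun I \<Longrightarrow> (\<lambda>z. p z * q z) \<in> mpoly_fun I"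

lemma mpoly_fun_sum:
  assumes "\<And>k. k \<in> K \<Longrightarrow> f k \<in> mpoly_fun I"
  shows "(\<lambda>z. \<Sum>k\<in>K. f k z) \<in> mpoly_fun I"
  using assms
  by (induction K rule: infinite_finite_induct) (auto intro: mpoly_fun.intros)

lemma mpoly_fun_compose:
  assumes "p \<in> mpoly_fun I" "\<And>i. i \<in> I \<Longrightarrow> (\<lambda>z. g z i) \<in> mpoly_fun J"
  shows "(\<lambda>z. p (g z)) \<in> mpoly_fun J"
  using assms by (induction rule: mpoly_fun.induct) (auto intro: mpoly_fun.intros)

lemma mpoly_fun_cong:
  assumes "p \<in> mpoly_fun I" "\<And>i. i \<in> I \<Longrightarrow> y i = z i"
  shows "p y = p z"
  using assms by (induction rule: mpoly_fun.induct) auto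

text \<open>Restriction to a line reduces questions about several variables to \<open>poly\<close>,
  where a nonzero polynomial is not the zero function. It also yields the rational functions that
  are differentiated along the coordinate axes.\<close>

lemma mpoly_fun_line:
  assumes "p \<in> mpoly_fun I"
  shows "\<exists>P. \<forall>t. p (\<lambda>i. u i + t * v i) = poly P t"
  using assms
proof (induction rule: mpoly_fun.induct)
  case (const c) then show ?case by (intro exI[of _ "[:c:]"]) simp
next
  case (var i) then show ?case by (intro exI[of _ "[:u i, v i:]"]) simp
next
  case (add p q) then show ?case by (metis poly_add)
next
  case (mult p q) then show ?case by (metis poly_mult)
qed

text \<open>On the line that joins a point with \<open>p\<close> nonzero to one with
  \<open>q\<close> nonzero, both restrictions are nonzero polynomials in one variable, so their
  product is nonzero too.\<close>

lemma mpoly_fun_mult_eq_0: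
  assumes "p \<in> mpoly_fun I" "q \<in> mpoly_fun I" "\<And>z. p z * q z = 0"
  shows "(\<forall>z. p z = 0) \<or> (\<forall>z. q z = 0)"
proof (rule ccontr)
  assume "\<not> ?thesis"
  then obtain u v where uv: "p u \<noteq> 0" "q v \<noteq> 0" by blast
  let ?l = "\<lambda>t i. u i + t * (v i - u i)"
  obtain P Q where PQ: "\<And>t. p (?l t) = poly P t" "\<And>t. q (?l t) = poly Q t"
    using mpoly_fun_line[OF assms(1)] mpoly_fun_line[OF assms(2)] by metis
  have "poly (P * Q) t = 0" for t using assms(3)[of "?l t"] PQ by simp
  then have "P * Q = 0" by (metis poly_0 poly_eq_poly_eq_iff ext)
  then have "P = 0 \<or> Q = 0" by simp
  moreover have "poly P 0 = p u" "poly Q 1 = q v" using PQ(1)[of 0] PQ(2)[of 1] by simp_all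
  ultimately show False using uv by auto
qed

lemma mpoly_fun_tendsto:
  assumes "p \<in> mpoly_fun I" "\<And>i. i \<in> I \<Longrightarrow> ((\<lambda>t. z t i) \<longlongrightarrow> y i) F"
  shows "((\<lambda>t. p (z t)) \<longlongrightarrow> p y) F"
  using assms by (induction rule: mpoly_fun.induct) (auto intro: tendsto_intros)

text \<open>This puts a polynomial without constant term into the ideal of the coordinates, which is
  how the maximal ideal in a chart gets its generators. Products use p q - p0 q0 = (p - p0) q + p0
  (q - q0).\<close>

lemma mpoly_fun_expand_at_0:
  assumes "p \<in> mpoly_fun I" "finite I"
  shows "\<exists>h. (\<forall>i\<in>I. h i \<in> mpoly_fun I) \<and> (\<forall>z. p z = p (\<lambda>_. 0) + (\<Sum>i\<in>I. z i * h i z))"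
  using assms
proof (induction rule: mpoly_fun.induct)
  case (const c)
  then show ?case by (intro exI[of _ "\<lambda>_ _. 0"]) (auto intro: mpoly_fun.const)
next
  case (var i)
  then show ?case
    by (intro exI[of _ "\<lambda>j _. if j = i then 1 else 0"])
      (simp add: mpoly_fun.const if_distrib[of "(*) _"] sum.delta cong: if_cong)
next
  case (add p q)
  from add.IH(1)[OF add.prems] obtain g where
    g: "\<forall>i\<in>I. g i \<in> mpoly_fun I" "\<forall>z. p z = p (\<lambda>_. 0) + (\<Sum>i\<in>I. z i * g i z)" by blast
  from add.IH(2)[OF add.prems] obtain h where
    h: "\<forall>i\<in>I. h i \<in> mpoly_fun I" "\<forall>z. q z = q (\<lambda>_. 0) + (\<Sum>i\<in>I. z i * h i z)" by blast
  show ?case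
  proof (intro exI[of _ "\<lambda>i z. g i z + h i z"] conjI ballI allI)
    fix z show "p z + q z = p (\<lambda>_. 0) + q (\<lambda>_. 0) + (\<Sum>i\<in>I. z i * (g i z + h i z))"
      unfolding g(2)[rule_format, of z] h(2)[rule_format, of z]
      by (simp add: algebra_simps sum.distrib)
  next
    fix i assume "i \<in> I"
    then show "(\<lambda>z. g i z + h i z) \<in> mpoly_fun I" using g(1) h(1) by (intro mpoly_fun.add) auto
  qed
next
  case (mult p q)
  from mult.IH(1)[OF mult.prems] obtain g where
    g: "\<forall>i\<in>I. g i \<in> mpoly_fun I" "\<forall>z. p z = p (\<lambda>_. 0) + (\<Sum>i\<in>I. z i * g i z)" by blast
  from mult.IH(2)[OF mult.prems] obtain h where
    h: "\<forall>i\<in>I. h i \<in> mpoly_fun I" "\<forall>z. q z = q (\<lambda>_. 0) + (\<Sum>i\<in>I. z i * h i z)" by blast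
  show ?case
  proof (intro exI[of _ "\<lambda>i z. g i z * q z + p (\<lambda>_. 0) * h i z"] conjI ballI allI)
    fix z
    have "(\<Sum>i\<in>I. z i * (g i z * q z + p (\<lambda>_. 0) * h i z))
        = (\<Sum>i\<in>I. z i * g i z) * q z + p (\<lambda>_. 0) * (\<Sum>i\<in>I. z i * h i z)"
      by (simp add: algebra_simps sum.distrib sum_distrib_left)
    also have "\<dots> = (p z - p (\<lambda>_. 0)) * q z + p (\<lambda>_. 0) * (q z - q (\<lambda>_. 0))"
    proof -
      have "p z - p (\<lambda>_. 0) = (\<Sum>i\<in>I. z i * g i z)"
        unfolding diff_eq_eq using g(2)[rule_format, of z] by (simp only: add.commute)
      moreover have "q z - q (\<lambda>_. 0) = (\<Sum>i\<in>I. z i * h i z)"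
        unfolding diff_eq_eq using h(2)[rule_format, of z] by (simp only: add.commute)
      ultimately show ?thesis by simp
    qed
    finally have "(\<Sum>i\<in>I. z i * (g i z * q z + p (\<lambda>_. 0) * h i z))
        = (p z - p (\<lambda>_. 0)) * q z + p (\<lambda>_. 0) * (q z - q (\<lambda>_. 0))" .
    then show "p z * q z = p (\<lambda>_. 0) * q (\<lambda>_. 0) +
        (\<Sum>i\<in>I. z i * (g i z * q z + p (\<lambda>_. 0) * h i z))"
      by (simp add: algebra_simps)
  next
    fix i assume "i \<in> I"
    then show "(\<lambda>z. g i z * q z + p (\<lambda>_. 0) * h i z) \<in> mpoly_fun I"
      using g(1) h(1) mult.hyps by (intro mpoly_fun.add mpoly_fun.mult mpoly_fun.const) auto
  qed
qed

section \<open>Counting monomials to find algebraic relations\<close>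

text \<open>Bounding the degree in each variable separately makes the exponent set a function space
  with \<open>(D + 1) ^ card I\<close> elements, and the bounds simply add under
  multiplication.\<close>

definition box_fun :: "'v set \<Rightarrow> nat \<Rightarrow> (('v \<Rightarrow> complex) \<Rightarrow> complex) set" where
  "box_fun I D = {f. \<exists>c. \<forall>z. f z = (\<Sum>\<alpha>\<in>I \<rightarrow>\<^sub>E {..D}. c \<alpha> * (\<Prod>i\<in>I. z i ^ \<alpha> i))}"

lemma box_fun_monomial:
  assumes "\<And>i. i \<in> I \<Longrightarrow> \<alpha> i \<le> D" "finite I"
  shows "(\<lambda>z. c * (\<Prod>i\<in>I. z i ^ \<alpha> i)) \<in> box_fun I D"
proof -
  have *: "restrict \<alpha> I \<in> I \<rightarrow>\<^sub>E {..D}" "finite (I \<rightarrow>\<^sub>E {..D})"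
    using assms by (auto intro: finite_PiE)
  show ?thesis unfolding box_fun_def
    by (rule CollectI, rule exI[of _ "\<lambda>\<beta>. if \<beta> = restrict \<alpha> I then c else 0"])
      (use * in \<open>simp add: if_distrib[of "\<lambda>x. x * _"] cong: if_cong prod.cong\<close>)
qed

lemma box_fun_add:
  assumes "f \<in> box_fun I D" "g \<in> box_fun I D"
  shows "(\<lambda>z. f z + g z) \<in> box_fun I D"
proof -
  from assms obtain a b where
    "\<forall>z. f z = (\<Sum>\<alpha>\<in>I \<rightarrow>\<^sub>E {..D}. a \<alpha> * (\<Prod>i\<in>I. z i ^ \<alpha> i))"
    "\<forall>z. g z = (\<Sum>\<alpha>\<in>I \<rightarrow>\<^sub>E {..D}. b \<alpha> * (\<Prod>i\<in>I. z i ^ \<alpha> i))"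
    unfolding box_fun_def by blast
  then show ?thesis unfolding box_fun_def
    by (intro CollectI exI[of _ "\<lambda>\<alpha>. a \<alpha> + b \<alpha>"]) (simp add: sum.distrib algebra_simps)
qed

lemma box_fun_sum:
  assumes "\<And>k. k \<in> K \<Longrightarrow> f k \<in> box_fun I D"
  shows "(\<lambda>z. \<Sum>k\<in>K. f k z) \<in> box_fun I D"
  using assms
proof (induction K rule: infinite_finite_induct)
  case (insert x F) then show ?case by (simp add: box_fun_add)
qed (auto simp: box_fun_def intro: exI[of _ "\<lambda>_. 0"])

lemma box_fun_mult:
  assumes "f \<in> box_fun I D" "g \<in> box_fun I E" "finite I"
  shows "(\<lambda>z. f z * g z) \<in> box_fun I (D + E)"
proof -
  from assms obtain a b where ab:
    "\<forall>z. f z = (\<Sum>\<alpha>\<in>I \<rightarrow>\<^sub>E {..D}. a \<alpha> * (\<Prod>i\<in>I. z i ^ \<alpha> i))"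
    "\<forall>z. g z = (\<Sum>\<alpha>\<in>I \<rightarrow>\<^sub>E {..E}. b \<alpha> * (\<Prod>i\<in>I. z i ^ \<alpha> i))"
    unfolding box_fun_def by blast
  have "(\<lambda>z. f z * g z) = (\<lambda>z. \<Sum>\<alpha>\<in>I \<rightarrow>\<^sub>E {..D}. \<Sum>\<beta>\<in>I \<rightarrow>\<^sub>E {..E}.
     (a \<alpha> * b \<beta>) * (\<Prod>i\<in>I. z i ^ (\<alpha> i + \<beta> i)))"
    by (rule ext) (simp add: ab sum_product power_add prod.distrib algebra_simps)
  also have "\<dots> \<in> box_fun I (D + E)"
    by (intro box_fun_sum box_fun_monomial) (use assms in \<open>auto intro!: add_mono\<close>)
  finally show ?thesis .
qed

lemma box_fun_mono:
  assumes "f \<in> box_fun I D" "D \<le> E" "finite I"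
  shows "f \<in> box_fun I E"
proof -
  from assms obtain a where a:
    "\<forall>z. f z = (\<Sum>\<alpha>\<in>I \<rightarrow>\<^sub>E {..D}. a \<alpha> * (\<Prod>i\<in>I. z i ^ \<alpha> i))"
    unfolding box_fun_def by blast
  then have "f = (\<lambda>z. \<Sum>\<alpha>\<in>I \<rightarrow>\<^sub>E {..D}. a \<alpha> * (\<Prod>i\<in>I. z i ^ \<alpha> i))" by auto
  also have "\<dots> \<in> box_fun I E"
    by (intro box_fun_sum box_fun_monomial) (use assms in force)+
  finally show ?thesis .
qed

lemma box_fun_const: "finite I \<Longrightarrow> (\<lambda>_. c) \<in> box_fun I D"
  using box_fun_monomial[of I "\<lambda>_. 0" D c] by simp

lemma box_fun_power:
  "f \<in> box_fun I D \<Longrightarrow> finite I \<Longrightarrow> (\<lambda>z. f z ^ k) \<in> box_fun I (k * D)"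
  by (induction k) (auto simp: box_fun_const intro: box_fun_mult)

lemma mpoly_fun_box:
  assumes "p \<in> mpoly_fun I" "finite I"
  shows "\<exists>D. p \<in> box_fun I D"
  using assms
proof (induction rule: mpoly_fun.induct)
  case (var i)
  have "(\<lambda>z. z i) = (\<lambda>z. 1 * (\<Prod>j\<in>I. z j ^ (if j = i then 1 else 0)))"
    using var by (auto simp: if_distrib prod.delta cong: if_cong)
  also have "\<dots> \<in> box_fun I 1" by (rule box_fun_monomial) (use var in auto)
  finally show ?case by blast
next
  case (add p q)
  then obtain D E where "p \<in> box_fun I D" "q \<in> box_fun I E" by blast
  then have "p \<in> box_fun I (max D E)" "q \<in> box_fun I (max D E)"
    using add by (auto intro: box_fun_mono)
  then show ?case using box_fun_add by blast
qed (blast intro: box_fun_const box_fun_mult)+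

lemma mpoly_fun_common_box:
  assumes "finite I" "finite Q" "Q \<subseteq> mpoly_fun I"
  shows "\<exists>D. Q \<subseteq> box_fun I D"
  using assms(2,3)
proof (induction Q rule: finite_induct)
  case (insert p Q)
  then obtain D E where "Q \<subseteq> box_fun I D" "p \<in> box_fun I E"
    using mpoly_fun_box assms(1) by (metis insert_subset)
  then have "insert p Q \<subseteq> box_fun I (max D E)"
    using assms(1) by (auto intro: box_fun_mono)
  then show ?case by blast
qed auto

text \<open>A polynomial in the entries of the list with all exponents below \<open>N\<close>,
  nested one variable at a time: the recursion peels off the first variable, just as the induction
  along a chain of primes does later.\<close>

primrec nested_sum :: "nat \<Rightarrow> 'f list \<Rightarrow> (nat list \<Rightarrow> 'f) \<Rightarrow> 'f :: comm_semiring_1" where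
  "nested_sum N [] c = c []"
| "nested_sum N (h # hs) c = (\<Sum>e<N. h ^ e * nested_sum N hs (\<lambda>l. c (e # l)))"

abbreviation exponents :: "nat \<Rightarrow> nat \<Rightarrow> nat list set" where
  "exponents N r \<equiv> {l. set l \<subseteq> {..<N} \<and> length l = r}"

lemma exponents_Suc: "exponents N (Suc r) = (\<lambda>(e, l). e # l) ` ({..<N} \<times> exponents N r)"
  by (force simp: length_Suc_conv image_iff)

lemma nested_sum_eq:
  "nested_sum N hs c = (\<Sum>l\<in>exponents N (length hs). c l * prod_list (map2 (^) hs l))"
proof (induction hs arbitrary: c)
  case (Cons h hs)
  have "(\<Sum>l\<in>exponents N (length (h # hs)). c l * prod_list (map2 (^) (h # hs) l))
      = (\<Sum>(e, l)\<in>{..<N} \<times> exponents N (length hs). c (e # l) * (h ^ e * prod_list (map2 (^) hs l)))"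
    unfolding length_Cons exponents_Suc
    by (subst sum.reindex) (auto simp: inj_on_def intro!: sum.cong)
  also have "\<dots> = (\<Sum>e<N. \<Sum>l\<in>exponents N (length hs). c (e # l) * (h ^ e * prod_list (map2 (^) hs l)))"
    by (rule sum.cartesian_product[symmetric])
  finally show ?case by (simp add: Cons.IH sum_distrib_left ac_simps)
next
  case Nil
  have "exponents N 0 = {[]}" by auto
  then show ?case by simp
qed

lemma box_fun_monomial_list:
  assumes "finite I" "set ps \<subseteq> box_fun I D"
  shows "length l = length ps \<Longrightarrow>
    (\<lambda>z. prod_list (map2 (^) (map (\<lambda>p. p z) ps) l)) \<in> box_fun I (sum_list l * D)"
  using assms(2)
proof (induction ps arbitrary: l)
  case Nil then show ?case using box_fun_const[OF assms(1)] by simp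
next
  case (Cons p ps)
  then obtain e l' where l: "l = e # l'" "length l' = length ps" by (cases l) auto
  then show ?case
    using box_fun_mult[OF box_fun_power[of p I D e] Cons.IH[of l'] assms(1)] Cons.prems assms(1)
    by (simp add: algebra_simps)
qed

lemma prod_list_map2_divide:
  fixes q :: "'f :: field"
  shows "length l = length ps \<Longrightarrow> q \<noteq> 0 \<Longrightarrow>
    prod_list (map2 (^) (map (\<lambda>p. f p / q) ps) l) * q ^ sum_list l
      = prod_list (map2 (^) (map f ps) l)"
proof (induction ps arbitrary: l)
  case (Cons p ps)
  then obtain e l' where l: "l = e # l'" "length l' = length ps" by (cases l) auto
  then show ?case using Cons.IH[of l'] Cons.prems
    by (simp add: power_add power_divide field_simps)
qed simp

text \<open>More monomials in \<open>card I + 1\<close> fractions than dimensions in the space of numerators.\<close>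

lemma algebraic_dependence:
  assumes "finite I" "set ps \<subseteq> mpoly_fun I" "q \<in> mpoly_fun I" "length ps = Suc (card I)"
  shows "\<exists>N c. (\<exists>l\<in>exponents N (length ps). c l \<noteq> 0) \<and>
    (\<forall>z. q z \<noteq> 0 \<longrightarrow> nested_sum N (map (\<lambda>p. p z / q z) ps) c = 0)"
proof -
  obtain D where D: "set ps \<subseteq> box_fun I D" "q \<in> box_fun I D"
    using mpoly_fun_common_box[OF assms(1), of "insert q (set ps)"] assms by auto
  \<comment> \<open>There are \<open>N ^ Suc r\<close> monomials in the r + 1 fractions, and after
    clearing denominators they lie in a space of dimension at most \<open>N ^ r * C\<close>. Since
    \<open>C\<close> does not involve \<open>N\<close>, it is enough to take \<open>N\<close> larger
    than \<open>C\<close>.\<close>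
  define r C N where "r = card I" and "C = (Suc r * D + 1) ^ r" and "N = Suc C"
  \<comment> \<open>The exponents of a monomial sum up to at most \<open>M\<close>, so
    \<open>q ^ M\<close> clears all denominators at once.\<close>
  define M where "M = Suc r * N"
  define L where "L = exponents N (Suc r)"
  define A where "A = I \<rightarrow>\<^sub>E {..M * D}"
  have fin: "finite L" "finite A"
    using assms(1) by (auto simp: L_def A_def intro: finite_PiE finite_lists_length_eq)
  have cardL: "card L = N ^ Suc r" by (simp add: L_def card_lists_length_eq)
  have "card A = (M * D + 1) ^ r"
    using assms(1) by (simp add: A_def card_PiE r_def)
  also have "\<dots> \<le> (N * (Suc r * D + 1)) ^ r"
  proof (rule power_mono)
    have "M * D + 1 \<le> Suc r * N * D + N" unfolding M_def N_def by simp
    then show "M * D + 1 \<le> N * (Suc r * D + 1)" by (simp only: algebra_simps)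
  qed simp
  also have "\<dots> = N ^ r * C" by (simp only: power_mult_distrib C_def)
  also have "\<dots> < N ^ r * N" by (simp add: N_def)
  finally have card: "card A < card L" by (simp add: cardL mult.commute)
  define g where "g l z = prod_list (map2 (^) (map (\<lambda>p. p z) ps) l) * q z ^ (M - sum_list l)" for l z
  have sum_le: "sum_list l \<le> M" if "l \<in> L" for l
  proof -
    have "set l \<subseteq> {..<N} \<Longrightarrow> sum_list l \<le> length l * N" by (induction l) auto
    then show ?thesis using that by (simp add: L_def M_def)
  qed
  have "g l \<in> box_fun I (M * D)" if "l \<in> L" for l
  proof -
    have "(\<lambda>z. g l z) \<in> box_fun I (sum_list l * D + (M - sum_list l) * D)"
      unfolding g_def using assms that D
      by (intro box_fun_mult box_fun_power box_fun_monomial_list) (auto simp: L_def r_def)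
    also have "sum_list l * D + (M - sum_list l) * D = M * D"
      using sum_le[OF that] by (metis add_mult_distrib le_add_diff_inverse)
    finally show ?thesis by simp
  qed
  then obtain e where e: "\<And>l z. l \<in> L \<Longrightarrow> g l z = (\<Sum>\<alpha>\<in>A. e l \<alpha> * (\<Prod>i\<in>I. z i ^ \<alpha> i))"
    unfolding box_fun_def A_def mem_Collect_eq by metis
  obtain x where x: "\<exists>l\<in>L. x l \<noteq> 0" "\<forall>\<alpha>\<in>A. (\<Sum>l\<in>L. e l \<alpha> * x l) = 0"
    using homogeneous_system_nontrivial[OF fin(2) fin(1) card, of "\<lambda>\<alpha> l. e l \<alpha>"] by blast
  have zero: "(\<Sum>l\<in>L. x l * g l z) = 0" for z
  proof -
    have "(\<Sum>l\<in>L. x l * g l z) = (\<Sum>l\<in>L. \<Sum>\<alpha>\<in>A. x l * (e l \<alpha> * (\<Prod>i\<in>I. z i ^ \<alpha> i)))"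
      using e by (intro sum.cong) (auto simp: sum_distrib_left[symmetric])
    also have "\<dots> = (\<Sum>\<alpha>\<in>A. \<Sum>l\<in>L. x l * (e l \<alpha> * (\<Prod>i\<in>I. z i ^ \<alpha> i)))" by (rule sum.swap)
    also have "\<dots> = (\<Sum>\<alpha>\<in>A. (\<Sum>l\<in>L. e l \<alpha> * x l) * (\<Prod>i\<in>I. z i ^ \<alpha> i))"
      by (rule sum.cong[OF refl]) (simp add: sum_distrib_left sum_distrib_right mult_ac)
    also have "\<dots> = 0" using x(2) by simp
    finally show ?thesis .
  qed
  have "nested_sum N (map (\<lambda>p. p z / q z) ps) x = 0" if q: "q z \<noteq> 0" for z
  proof -
    have "x l * prod_list (map2 (^) (map (\<lambda>p. p z / q z) ps) l) * q z ^ M = x l * g l z"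
      if l: "l \<in> L" for l
    proof -
      have "q z ^ M = q z ^ sum_list l * q z ^ (M - sum_list l)"
        using sum_le[OF l] by (simp flip: power_add)
      moreover have "length l = length ps" using l assms(4) by (simp add: L_def r_def)
      ultimately show ?thesis
        using prod_list_map2_divide[of l ps "q z" "\<lambda>p. p z"] q unfolding g_def by simp
    qed
    then have "nested_sum N (map (\<lambda>p. p z / q z) ps) x * q z ^ M = (\<Sum>l\<in>L. x l * g l z)"
      using assms(4) unfolding nested_sum_eq sum_distrib_right
      by (intro sum.cong) (auto simp: L_def r_def)
    then show ?thesis using zero q by simp
  qed
  moreover have "\<exists>l\<in>exponents N (length ps). x l \<noteq> 0" using x(1) assms(4) by (simp add: L_def r_def)
  ultimately show ?thesis by (intro exI[of _ N] exI[of _ x]) blast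
qed

section \<open>Local rings of spaces with functions\<close>

lemma mem_germ_self: "f \<in> germ X x f"
  by (simp add: germ_def)

lemma germ_eq_iff:
  "germ X x f = germ X x g \<longleftrightarrow> eventually (\<lambda>y. f y = g y) (nhdsin (fs_top X) x)"
proof
  assume "germ X x f = germ X x g"
  then have "f \<in> germ X x g" using mem_germ_self by metis
  then show "eventually (\<lambda>y. f y = g y) (nhdsin (fs_top X) x)" by (simp add: germ_def)
next
  assume *: "eventually (\<lambda>y. f y = g y) (nhdsin (fs_top X) x)"
  have "eventually (\<lambda>y. h y = f y) (nhdsin (fs_top X) x) \<longleftrightarrow>
      eventually (\<lambda>y. h y = g y) (nhdsin (fs_top X) x)" for h
    by (rule eventually_cong[OF *]) simp
  then show "germ X x f = germ X x g" by (simp add: germ_def)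
qed

text \<open>Representatives of germs. The arguments below are carried out with these functions;
  germs are taken only where a statement about the ring is needed.\<close>

definition reg_at :: "'a fspace \<Rightarrow> 'a \<Rightarrow> ('a \<Rightarrow> complex) set" where
  "reg_at X x = {f. \<exists>U. openin (fs_top X) U \<and> x \<in> U \<and> f \<in> fs_reg X U}"

lemma carrier_local_ring: "carrier (local_ring X x) = germ X x ` reg_at X x"
  by (auto simp: local_ring_def reg_at_def)

text \<open>The common interface of SL, its quotient and the subspaces of the quotient.
  \<open>openin_nonzero\<close> allows inverting a function near a point where it is nonzero, and it
  makes vanishing a closed condition.\<close>

locale function_space =
  fixes X :: "'a fspace"
  assumes reg_const: "openin (fs_top X) U \<Longrightarrow> (\<lambda>_. c) \<in> fs_reg X U"
    and reg_add: "openin (fs_top X) U \<Longrightarrow> f \<in> fs_reg X U \<Longrightarrow> g \<in> fs_reg X U \<Longrightarrow>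
      (\<lambda>y. f y + g y) \<in> fs_reg X U"
    and reg_mult: "openin (fs_top X) U \<Longrightarrow> f \<in> fs_reg X U \<Longrightarrow> g \<in> fs_reg X U \<Longrightarrow>
      (\<lambda>y. f y * g y) \<in> fs_reg X U"
    and reg_inverse: "openin (fs_top X) U \<Longrightarrow> f \<in> fs_reg X U \<Longrightarrow> (\<And>y. y \<in> U \<Longrightarrow> f y \<noteq> 0) \<Longrightarrow>
      (\<lambda>y. inverse (f y)) \<in> fs_reg X U"
    and reg_restrict: "openin (fs_top X) U \<Longrightarrow> openin (fs_top X) V \<Longrightarrow> V \<subseteq> U \<Longrightarrow>
      f \<in> fs_reg X U \<Longrightarrow> f \<in> fs_reg X V"
    and openin_nonzero: "openin (fs_top X) U \<Longrightarrow> f \<in> fs_reg X U \<Longrightarrow>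
      openin (fs_top X) {y \<in> U. f y \<noteq> 0}"
begin

abbreviation opn :: "'a set \<Rightarrow> bool" where "opn \<equiv> openin (fs_top X)"

abbreviation pts :: "'a set" where "pts \<equiv> topspace (fs_top X)"

lemma reg_at_const: "x \<in> pts \<Longrightarrow> (\<lambda>_. c) \<in> reg_at X x"
  unfolding reg_at_def using reg_const[OF openin_topspace] by blast

lemma reg_at_common:
  assumes "f \<in> reg_at X x" "g \<in> reg_at X x"
  obtains U where "opn U" "x \<in> U" "f \<in> fs_reg X U" "g \<in> fs_reg X U"
proof -
  from assms obtain U V where "opn U" "x \<in> U" "f \<in> fs_reg X U"
    "opn V" "x \<in> V" "g \<in> fs_reg X V" by (auto simp: reg_at_def)
  then show ?thesis
    using that[of "U \<inter> V"] reg_restrict[of U "U \<inter> V"] reg_restrict[of V "U \<inter> V"]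
    by (simp add: openin_Int)
qed

lemma reg_at_add: "f \<in> reg_at X x \<Longrightarrow> g \<in> reg_at X x \<Longrightarrow> (\<lambda>y. f y + g y) \<in> reg_at X x"
  by (erule (1) reg_at_common) (auto simp: reg_at_def intro: reg_add)

lemma reg_at_mult: "f \<in> reg_at X x \<Longrightarrow> g \<in> reg_at X x \<Longrightarrow> (\<lambda>y. f y * g y) \<in> reg_at X x"
  by (erule (1) reg_at_common) (auto simp: reg_at_def intro: reg_mult)

lemma reg_at_inverse:
  assumes "f \<in> reg_at X x" "f x \<noteq> 0"
  shows "(\<lambda>y. inverse (f y)) \<in> reg_at X x"
proof -
  from assms(1) obtain U where U: "opn U" "x \<in> U" "f \<in> fs_reg X U"
    by (auto simp: reg_at_def)
  define V where "V = {y \<in> U. f y \<noteq> 0}"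
  have V: "opn V" "V \<subseteq> U" "x \<in> V"
    using openin_nonzero[OF U(1,3)] U(2) assms(2) by (auto simp: V_def)
  have "(\<lambda>y. inverse (f y)) \<in> fs_reg X V"
    by (rule reg_inverse[OF V(1) reg_restrict[OF U(1) V(1,2) U(3)]]) (simp add: V_def)
  then show ?thesis using V by (auto simp: reg_at_def)
qed

lemma reg_at_sum:
  assumes "x \<in> pts" "\<And>k. k \<in> K \<Longrightarrow> f k \<in> reg_at X x"
  shows "(\<lambda>y. \<Sum>k\<in>K. f k y) \<in> reg_at X x"
  using assms(2)
  by (induction K rule: infinite_finite_induct) (auto intro: reg_at_const[OF assms(1)] reg_at_add)

lemma reg_at_power:
  assumes "x \<in> pts" "f \<in> reg_at X x"
  shows "(\<lambda>y. f y ^ k) \<in> reg_at X x"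
  by (induction k) (auto intro: reg_at_const[OF assms(1)] reg_at_mult assms(2))

lemma reg_at_mpoly_fun:
  assumes "x \<in> pts" "p \<in> mpoly_fun I" "\<And>i. i \<in> I \<Longrightarrow> f i \<in> reg_at X x"
  shows "(\<lambda>y. p (\<lambda>i. f i y)) \<in> reg_at X x"
  using assms(2,3)
  by (induction rule: mpoly_fun.induct) (auto intro: reg_at_const[OF assms(1)] reg_at_add reg_at_mult)

lemma reg_at_nested_sum:
  assumes "x \<in> pts" "set hs \<subseteq> reg_at X x"
  shows "(\<lambda>y. nested_sum N (map (\<lambda>h. h y) hs) c) \<in> reg_at X x"
  using assms(2)
  by (induction hs arbitrary: c)
    (auto intro!: reg_at_const[OF assms(1)] reg_at_sum[OF assms(1)] reg_at_mult reg_at_power[OF assms(1)])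

end

section \<open>The local ring as a ring of germs of functions\<close>

text \<open>The ring axioms are an assumption of the locale because they can be read off from
  normality, which says that the local rings are domains.\<close>

locale local_function_ring = function_space X for X :: "'a fspace" +
  fixes x :: 'a
  assumes x_in: "x \<in> topspace (fs_top X)" and cring: "cring (local_ring X x)"
begin

abbreviation R :: "('a \<Rightarrow> complex) set ring" where "R \<equiv> local_ring X x"

abbreviation reg :: "('a \<Rightarrow> complex) set" where "reg \<equiv> reg_at X x"

abbreviation near :: "('a \<Rightarrow> bool) \<Rightarrow> bool" where "near P \<equiv> eventually P (nhdsin (fs_top X) x)"

lemma near_iff: "near P \<longleftrightarrow> (\<exists>V. opn V \<and> x \<in> V \<and> (\<forall>y\<in>V. P y))"
  using x_in by (simp add: eventually_nhdsin)

lemma near_at: "near P \<Longrightarrow> P x"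
  by (auto simp: near_iff)

text \<open>The product in \<open>local_ring\<close> is a union over all pairs of representatives,
  and every member of this union is the same germ.\<close>

lemma germ_mult: "germ X x f \<otimes>\<^bsub>R\<^esub> germ X x g = germ X x (\<lambda>y. f y * g y)"
proof -
  have *: "germ X x (\<lambda>y. f' y * g' y) = germ X x (\<lambda>y. f y * g y)"
    if "f' \<in> germ X x f" "g' \<in> germ X x g" for f' g'
    unfolding germ_eq_iff using that[unfolded germ_def mem_Collect_eq]
    by (rule eventually_elim2) simp
  have "germ X x f \<otimes>\<^bsub>R\<^esub> germ X x g
      = (\<Union>f'\<in>germ X x f. \<Union>g'\<in>germ X x g. germ X x (\<lambda>y. f' y * g' y))"
    by (simp add: local_ring_def)
  also have "\<dots> = (\<Union>f'\<in>germ X x f. \<Union>g'\<in>germ X x g. germ X x (\<lambda>y. f y * g y))"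
    by (intro SUP_cong refl *)
  also have "\<dots> = germ X x (\<lambda>y. f y * g y)"
    using mem_germ_self[of f X x] mem_germ_self[of g X x] by blast
  finally show ?thesis .
qed

lemma germ_add: "germ X x f \<oplus>\<^bsub>R\<^esub> germ X x g = germ X x (\<lambda>y. f y + g y)"
proof -
  have *: "germ X x (\<lambda>y. f' y + g' y) = germ X x (\<lambda>y. f y + g y)"
    if "f' \<in> germ X x f" "g' \<in> germ X x g" for f' g'
    unfolding germ_eq_iff using that[unfolded germ_def mem_Collect_eq]
    by (rule eventually_elim2) simp
  have "germ X x f \<oplus>\<^bsub>R\<^esub> germ X x g
      = (\<Union>f'\<in>germ X x f. \<Union>g'\<in>germ X x g. germ X x (\<lambda>y. f' y + g' y))"
    by (simp add: local_ring_def)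
  also have "\<dots> = (\<Union>f'\<in>germ X x f. \<Union>g'\<in>germ X x g. germ X x (\<lambda>y. f y + g y))"
    by (intro SUP_cong refl *)
  also have "\<dots> = germ X x (\<lambda>y. f y + g y)"
    using mem_germ_self[of f X x] mem_germ_self[of g X x] by blast
  finally show ?thesis .
qed

lemma germ_zero: "\<zero>\<^bsub>R\<^esub> = germ X x (\<lambda>_. 0)" and germ_one: "\<one>\<^bsub>R\<^esub> = germ X x (\<lambda>_. 1)"
  by (simp_all add: local_ring_def)

lemma const_reg: "(\<lambda>_. c) \<in> reg"
  using reg_at_const[OF x_in] .

lemma local_max_ideal_eq: "local_max_ideal X x = germ X x ` {f \<in> reg. f x = 0}"
proof -
  have "(\<forall>g\<in>germ X x f. g x = 0) \<longleftrightarrow> f x = 0" for f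
    using mem_germ_self[of f X x] near_at by (fastforce simp: germ_def)
  then show ?thesis by (auto simp: local_max_ideal_def carrier_local_ring)
qed

text \<open>Ideals are built from conditions on functions: the maximal ideal, the kernel of a
  derivation and the coordinate primes all arise in this way. Closure under negation comes from
  multiplying by minus one.\<close>

lemma ideal_germ_image:
  assumes "J \<subseteq> reg" "(\<lambda>_. 0) \<in> J"
    and add: "\<And>f g. f \<in> J \<Longrightarrow> g \<in> J \<Longrightarrow> (\<lambda>y. f y + g y) \<in> J"
    and mult: "\<And>f g. f \<in> reg \<Longrightarrow> g \<in> J \<Longrightarrow> (\<lambda>y. f y * g y) \<in> J"
  shows "ideal (germ X x ` J) R"
proof -
  interpret cring R by (rule cring)
  have mult': "A \<otimes>\<^bsub>R\<^esub> B \<in> germ X x ` J" if "A \<in> carrier R" "B \<in> germ X x ` J" for A B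
    using that mult by (auto simp: carrier_local_ring germ_mult)
  have sub: "germ X x ` J \<subseteq> carrier R" using assms(1) by (auto simp: carrier_local_ring)
  show ?thesis
  proof (rule idealI[OF ring_axioms])
    show "subgroup (germ X x ` J) (add_monoid R)"
    proof (rule add.subgroupI)
      show "germ X x ` J \<noteq> {}" using assms(2) by blast
      fix A assume A: "A \<in> germ X x ` J"
      have "\<ominus>\<^bsub>R\<^esub> A = (\<ominus>\<^bsub>R\<^esub> \<one>\<^bsub>R\<^esub>) \<otimes>\<^bsub>R\<^esub> A"
        using A sub by (simp add: l_minus subset_iff)
      then show "\<ominus>\<^bsub>R\<^esub> A \<in> germ X x ` J" using mult'[OF _ A] by simp
    next
      fix A B assume "A \<in> germ X x ` J" "B \<in> germ X x ` J"
      then show "A \<oplus>\<^bsub>R\<^esub> B \<in> germ X x ` J" using add by (auto simp: germ_add)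
    qed (rule sub)
  next
    fix A B assume AB: "A \<in> germ X x ` J" "B \<in> carrier R"
    show *: "B \<otimes>\<^bsub>R\<^esub> A \<in> germ X x ` J" by (rule mult'[OF AB(2,1)])
    have "A \<in> carrier R" using AB(1) sub by blast
    then have "A \<otimes>\<^bsub>R\<^esub> B = B \<otimes>\<^bsub>R\<^esub> A" using AB(2) by (rule m_comm)
    with * show "A \<otimes>\<^bsub>R\<^esub> B \<in> germ X x ` J" by (simp only:)
  qed
qed

definition fun_ideal :: "('a \<Rightarrow> complex) set set \<Rightarrow> ('a \<Rightarrow> complex) set" where
  "fun_ideal P = {f \<in> reg. germ X x f \<in> P}"

lemma fun_ideal_add:
  assumes "ideal P R" "f \<in> fun_ideal P" "g \<in> fun_ideal P"
  shows "(\<lambda>y. f y + g y) \<in> fun_ideal P"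
proof -
  interpret ideal P R by (rule assms(1))
  show ?thesis using assms a_closed
    by (auto simp: fun_ideal_def reg_at_add simp flip: germ_add)
qed

lemma fun_ideal_mult:
  assumes "ideal P R" "f \<in> reg" "g \<in> fun_ideal P"
  shows "(\<lambda>y. f y * g y) \<in> fun_ideal P"
proof -
  interpret ideal P R by (rule assms(1))
  show ?thesis using assms I_l_closed
    by (auto simp: fun_ideal_def reg_at_mult carrier_local_ring simp flip: germ_mult)
qed

lemma fun_ideal_zero: "ideal P R \<Longrightarrow> (\<lambda>_. 0) \<in> fun_ideal P"
  using const_reg ideal.axioms(1) additive_subgroup.zero_closed germ_zero
  by (fastforce simp: fun_ideal_def)

lemma fun_ideal_sum:
  assumes "ideal P R" "\<And>k. k \<in> K \<Longrightarrow> f k \<in> fun_ideal P"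
  shows "(\<lambda>y. \<Sum>k\<in>K. f k y) \<in> fun_ideal P"
  using assms(2)
  by (induction K rule: infinite_finite_induct)
    (auto intro: fun_ideal_zero[OF assms(1)] fun_ideal_add[OF assms(1)])

text \<open>A prime ideal is proper, so it contains no unit; this is what ends the independence
  argument.\<close>

lemma fun_ideal_const:
  assumes "primeideal P R" "(\<lambda>_. c) \<in> fun_ideal P"
  shows "c = 0"
proof (rule ccontr)
  assume "c \<noteq> 0"
  interpret primeideal P R by (rule assms(1))
  have "(\<lambda>_. inverse c * c) \<in> fun_ideal P"
    using fun_ideal_mult[OF is_ideal const_reg assms(2)] .
  then have "\<one>\<^bsub>R\<^esub> \<in> P" using \<open>c \<noteq> 0\<close> by (simp add: fun_ideal_def germ_one)
  then show False using one_imp_carrier I_notcarr by blast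
qed

lemma fun_ideal_prime:
  assumes "primeideal P R" "f \<in> reg" "g \<in> reg" "(\<lambda>y. f y * g y) \<in> fun_ideal P"
  shows "f \<in> fun_ideal P \<or> g \<in> fun_ideal P"
proof -
  interpret primeideal P R by (rule assms(1))
  have "germ X x f \<otimes>\<^bsub>R\<^esub> germ X x g \<in> P" using assms(4) by (simp add: fun_ideal_def germ_mult)
  then show ?thesis using I_prime assms(2,3) by (auto simp: fun_ideal_def carrier_local_ring)
qed

lemma fun_ideal_prime_power:
  assumes "primeideal P R" "f \<in> reg" "g \<in> reg" "(\<lambda>y. f y ^ k * g y) \<in> fun_ideal P" "f \<notin> fun_ideal P"
  shows "g \<in> fun_ideal P"
  using assms(4)
proof (induction k)
  case (Suc k)
  have "(\<lambda>y. f y * (f y ^ k * g y)) \<in> fun_ideal P" using Suc.prems by (simp add: mult.assoc)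
  then have "(\<lambda>y. f y ^ k * g y) \<in> fun_ideal P"
    using fun_ideal_prime[OF assms(1,2) reg_at_mult[OF reg_at_power[OF x_in assms(2)] assms(3)]]
      assms(5) by blast
  then show ?case by (rule Suc.IH)
qed simp

text \<open>Coquand and Lombardi: factor out the lowest power of \<open>h\<close>, pass to the next prime, which
  contains \<open>h\<close>, and go on with the lowest coefficient; a nonzero constant remains.\<close>

lemma prime_chain_independent:
  assumes "set hs \<subseteq> reg" "\<And>k. k \<le> length hs \<Longrightarrow> primeideal (P k) R"
    "\<And>k. k < length hs \<Longrightarrow> P k \<subseteq> P (Suc k)"
    "\<And>k. k < length hs \<Longrightarrow> hs ! k \<in> fun_ideal (P (Suc k)) - fun_ideal (P k)"
    "(\<lambda>y. nested_sum N (map (\<lambda>h. h y) hs) c) \<in> fun_ideal (P 0)"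
    "l \<in> exponents N (length hs)"
  shows "c l = 0"
  using assms
proof (induction hs arbitrary: P c l)
  case Nil
  then show ?case using fun_ideal_const[of "P 0" "c []"] by auto
next
  case (Cons h hs)
  show ?case
  proof (rule ccontr)
    assume "c l \<noteq> 0"
    moreover obtain e' l' where "l = e' # l'" "e' < N" "l' \<in> exponents N (length hs)"
      using Cons.prems(6) by (cases l) auto
    ultimately have ex: "\<exists>e. e < N \<and> (\<exists>l\<in>exponents N (length hs). c (e # l) \<noteq> 0)" by blast
    \<comment> \<open>\<open>e\<close> is the lowest power of \<open>h\<close> that occurs with a
      nonzero coefficient.\<close>
    define e where "e = (LEAST e. e < N \<and> (\<exists>l\<in>exponents N (length hs). c (e # l) \<noteq> 0))"
    have e: "e < N" "\<exists>l\<in>exponents N (length hs). c (e # l) \<noteq> 0"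
      using LeastI_ex[OF ex] unfolding e_def by blast+
    have below: "c (e' # l) = 0" if "e' < e" "l \<in> exponents N (length hs)" for e' l
      using not_less_Least[OF that(1)[unfolded e_def]] that e(1) by auto
    \<comment> \<open>\<open>F k\<close> is the coefficient of the k-th power of \<open>h\<close>,
      and \<open>K\<close> gathers everything above \<open>e\<close>, so the whole sum is h ^ e * (F
      e + h * K).\<close>
    define F where "F e y = nested_sum N (map (\<lambda>h. h y) hs) (\<lambda>l. c (e # l))" for e y
    define K where "K y = (\<Sum>k\<in>{Suc e..<N}. h y ^ (k - Suc e) * F k y)" for y
    have F0: "F k y = 0" if "k < e" for k y
      using below[OF that] unfolding F_def nested_sum_eq by (intro sum.neutral) auto
    have "nested_sum N (map (\<lambda>h. h y) (h # hs)) c = h y ^ e * (F e y + h y * K y)" for y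
    proof -
      have "nested_sum N (map (\<lambda>h. h y) (h # hs)) c = (\<Sum>k<N. h y ^ k * F k y)"
        by (simp add: F_def)
      also have "\<dots> = (\<Sum>k\<in>{e..<N}. h y ^ k * F k y)"
        by (rule sum.mono_neutral_right) (use F0 in auto)
      also have "\<dots> = h y ^ e * F e y + (\<Sum>k\<in>{Suc e..<N}. h y ^ k * F k y)"
        using e(1) by (simp add: sum.atLeast_Suc_lessThan)
      also have "(\<Sum>k\<in>{Suc e..<N}. h y ^ k * F k y) = h y ^ e * (h y * K y)"
        unfolding K_def sum_distrib_left
        by (rule sum.cong[OF refl]) (simp add: algebra_simps flip: power_add power_Suc)
      finally show ?thesis by (simp add: algebra_simps)
    qed
    then have 1: "(\<lambda>y. h y ^ e * (F e y + h y * K y)) \<in> fun_ideal (P 0)"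
      using Cons.prems(5) by simp
    have h: "h \<in> reg" "h \<in> fun_ideal (P (Suc 0))" "h \<notin> fun_ideal (P 0)"
      using Cons.prems(1) Cons.prems(4)[of 0] by auto
    have F: "F k \<in> reg" for k
      unfolding F_def using Cons.prems(1) by (intro reg_at_nested_sum[OF x_in]) auto
    have K: "K \<in> reg"
      unfolding K_def by (intro reg_at_sum reg_at_mult reg_at_power x_in h(1) F)
    have pr: "primeideal (P 0) R" "primeideal (P (Suc 0)) R"
      using Cons.prems(2)[of 0] Cons.prems(2)[of "Suc 0"] by auto
    have id: "ideal (P (Suc 0)) R" using pr(2) by (simp add: primeideal.axioms(1))
    \<comment> \<open>\<open>h\<close> is not in the first prime, so its power can be cancelled
      there. The next prime contains \<open>h\<close>, the term with \<open>K\<close> can be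
      subtracted, and \<open>F e\<close> remains, to which the induction applies along the shifted
      chain.\<close>
    have "(\<lambda>y. F e y + h y * K y) \<in> fun_ideal (P 0)"
      by (rule fun_ideal_prime_power[OF pr(1) h(1) _ 1 h(3)]) (intro reg_at_add reg_at_mult F K h(1))
    then have "(\<lambda>y. F e y + h y * K y) \<in> fun_ideal (P (Suc 0))"
      using Cons.prems(3)[of 0] by (auto simp: fun_ideal_def)
    moreover have "(\<lambda>y. (- K y) * h y) \<in> fun_ideal (P (Suc 0))"
      using fun_ideal_mult[OF id reg_at_mult[OF const_reg K] h(2), of "-1"] by simp
    ultimately have "(\<lambda>y. (F e y + h y * K y) + (- K y) * h y) \<in> fun_ideal (P (Suc 0))"
      by (rule fun_ideal_add[OF id])
    then have Fe: "(\<lambda>y. nested_sum N (map (\<lambda>h. h y) hs) (\<lambda>l. c (e # l))) \<in> fun_ideal (P (Suc 0))"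
      by (simp add: F_def algebra_simps)
    have "c (e # l) = 0" if "l \<in> exponents N (length hs)" for l
    proof (rule Cons.IH[of "\<lambda>k. P (Suc k)" "\<lambda>l. c (e # l)" l])
      fix k assume "k < length hs"
      then show "hs ! k \<in> fun_ideal (P (Suc (Suc k))) - fun_ideal (P (Suc k))"
        using Cons.prems(4)[of "Suc k"] by simp
    qed (use Cons.prems(1-3) Fe that in auto)
    then show False using e(2) by blast
  qed
qed

end

section \<open>Krull dimension and smoothness from parametrizations\<close>

context local_function_ring
begin

text \<open>Germs at \<open>x\<close> pull back along \<open>\<psi>\<close> to fractions of
  polynomials. Nothing is asked at parameters that \<open>\<psi>\<close> sends outside
  \<open>V\<close>, so \<open>\<psi>\<close> may leave the space and need not be injective.\<close>

definition parametrized :: "'v set \<Rightarrow> (('v \<Rightarrow> complex) \<Rightarrow> 'a) \<Rightarrow> bool" where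
  "parametrized I \<psi> \<longleftrightarrow> (\<forall>f\<in>reg. \<exists>V p q. opn V \<and> x \<in> V \<and> p \<in> mpoly_fun I \<and>
     q \<in> mpoly_fun I \<and> (\<forall>z. \<psi> z \<in> V \<longrightarrow> q z \<noteq> 0 \<and> f (\<psi> z) = p z / q z))"

lemma parametrizedE:
  assumes "parametrized I \<psi>" "f \<in> reg"
  obtains V p q where "opn V" "x \<in> V" "p \<in> mpoly_fun I" "q \<in> mpoly_fun I"
    "\<And>z. \<psi> z \<in> V \<Longrightarrow> q z \<noteq> 0" "\<And>z. \<psi> z \<in> V \<Longrightarrow> f (\<psi> z) = p z / q z"
  using assms unfolding parametrized_def by metis

text \<open>\<open>algebraic_dependence\<close> expects a single denominator; cross-multiplying
  provides it.\<close>

lemma parametrized_common_denominator: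
  assumes "parametrized I \<psi>" "set hs \<subseteq> reg"
  shows "\<exists>V ps q. opn V \<and> x \<in> V \<and> set ps \<subseteq> mpoly_fun I \<and> q \<in> mpoly_fun I \<and>
     length ps = length hs \<and>
     (\<forall>z. \<psi> z \<in> V \<longrightarrow> q z \<noteq> 0 \<and> map (\<lambda>h. h (\<psi> z)) hs = map (\<lambda>p. p z / q z) ps)"
  using assms(2)
proof (induction hs)
  case Nil
  show ?case
    by (rule exI[of _ "pts"], rule exI[of _ "[]"], rule exI[of _ "\<lambda>_. 1"])
      (simp add: x_in mpoly_fun.const)
next
  case (Cons h hs)
  then obtain V ps q where 1: "opn V" "x \<in> V" "set ps \<subseteq> mpoly_fun I"
    "q \<in> mpoly_fun I" "length ps = length hs"
    "\<forall>z. \<psi> z \<in> V \<longrightarrow> q z \<noteq> 0 \<and> map (\<lambda>h. h (\<psi> z)) hs = map (\<lambda>p. p z / q z) ps"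
    by auto
  obtain W p r where 2: "opn W" "x \<in> W" "p \<in> mpoly_fun I" "r \<in> mpoly_fun I"
    "\<And>z. \<psi> z \<in> W \<Longrightarrow> r z \<noteq> 0" "\<And>z. \<psi> z \<in> W \<Longrightarrow> h (\<psi> z) = p z / r z"
    using parametrizedE[OF assms(1), of h] Cons.prems by auto
  show ?case
  proof (intro exI conjI allI impI)
    show "opn (V \<inter> W)" "x \<in> V \<inter> W" using 1 2 by auto
    show "(\<lambda>z. q z * r z) \<in> mpoly_fun I" using 1 2 by (intro mpoly_fun.mult)
    show "set ((\<lambda>z. p z * q z) # map (\<lambda>p z. p z * r z) ps) \<subseteq> mpoly_fun I"
      using 1 2 by (auto intro: mpoly_fun.mult)
    show "length ((\<lambda>z. p z * q z) # map (\<lambda>p z. p z * r z) ps) = length (h # hs)"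
      using 1 by simp
    fix z assume "\<psi> z \<in> V \<inter> W"
    then have z: "\<psi> z \<in> V" "\<psi> z \<in> W" by auto
    then show "q z * r z \<noteq> 0" using 1(6) 2(5) by auto
    show "map (\<lambda>h. h (\<psi> z)) (h # hs)
        = map (\<lambda>p. p z / (q z * r z)) ((\<lambda>z. p z * q z) # map (\<lambda>p z. p z * r z) ps)"
      using 1(6) 2(5,6) z by (auto simp: o_def)
  qed
qed

text \<open>A chain of length above \<open>card I\<close> provides card I + 1 functions, each in one
  prime but not in the preceding one. They satisfy a polynomial relation at the points
  \<open>\<psi> z\<close> near \<open>x\<close>; these meet every nonempty open part of
  \<open>U\<close>, so the relation holds near \<open>x\<close>, contrary to independence along the
  chain.\<close>

lemma krull_dim_le:
  assumes "finite I" "parametrized I \<psi>" "opn U" "x \<in> U"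
    and dense: "\<And>W. opn W \<Longrightarrow> W \<subseteq> U \<Longrightarrow> W \<noteq> {} \<Longrightarrow> \<exists>z. \<psi> z \<in> W"
  shows "krull_dim R \<le> enat (card I)"
  unfolding krull_dim_def
proof (rule Sup_least, clarify)
  fix k P
  assume prime: "\<forall>i\<le>k. primeideal (P i) R" and chain: "\<forall>i<k. P i \<subset> P (Suc i)"
  define r where "r = Suc (card I)"
  have "\<not> card I < k"
  proof
    assume k: "card I < k"
    have "\<exists>f. f \<in> fun_ideal (P (Suc i)) - fun_ideal (P i)" if "i < k" for i
    proof -
      have "P i \<subset> P (Suc i)" using chain that by simp
      then obtain A where A: "A \<in> P (Suc i)" "A \<notin> P i" by blast
      have "primeideal (P (Suc i)) R" using prime that by simp
      then have "P (Suc i) \<subseteq> carrier R"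
        by (intro additive_subgroup.a_subset ideal.axioms(1) primeideal.axioms(1))
      then obtain f where "f \<in> reg" "A = germ X x f" using A(1) by (auto simp: carrier_local_ring)
      then show ?thesis using A by (auto simp: fun_ideal_def)
    qed
    then obtain h where h: "\<And>i. i < k \<Longrightarrow> h i \<in> fun_ideal (P (Suc i)) - fun_ideal (P i)" by metis
    define hs where "hs = map h [0..<r]"
    have len: "length hs = r" by (simp add: hs_def)
    have rk: "r \<le> k" using k by (simp add: r_def)
    have hs: "set hs \<subseteq> reg" using h rk by (fastforce simp: hs_def fun_ideal_def)
    obtain V ps q where V: "opn V" "x \<in> V" "set ps \<subseteq> mpoly_fun I"
      "q \<in> mpoly_fun I" "length ps = length hs"
      "\<forall>z. \<psi> z \<in> V \<longrightarrow> q z \<noteq> 0 \<and> map (\<lambda>h. h (\<psi> z)) hs = map (\<lambda>p. p z / q z) ps"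
      using parametrized_common_denominator[OF assms(2) hs] by blast
    obtain N c where c: "\<exists>l\<in>exponents N (length ps). c l \<noteq> 0"
      "\<forall>z. q z \<noteq> 0 \<longrightarrow> nested_sum N (map (\<lambda>p. p z / q z) ps) c = 0"
      using algebraic_dependence[OF assms(1) V(3,4)] V(5) len by (auto simp: r_def)
    define F where "F y = nested_sum N (map (\<lambda>h. h y) hs) c" for y
    have F: "F \<in> reg" unfolding F_def by (rule reg_at_nested_sum[OF x_in hs])
    then obtain U' where U': "opn U'" "x \<in> U'" "F \<in> fs_reg X U'"
      by (auto simp: reg_at_def)
    define W where "W = {y \<in> U'. F y \<noteq> 0} \<inter> (V \<inter> U)"
    have "opn W" unfolding W_def
      by (intro openin_Int openin_nonzero U' V(1) assms(3))
    moreover have "\<psi> z \<notin> W" for z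
      using V(6) c(2) by (auto simp: W_def F_def)
    ultimately have "W = {}" using dense[of W] by (auto simp: W_def)
    then have "near (\<lambda>y. F y = 0)" unfolding near_iff
      by (intro exI[of _ "U' \<inter> (V \<inter> U)"]) (use U' V(1,2) assms(3,4) in \<open>auto simp: W_def\<close>)
    then have "germ X x F = germ X x (\<lambda>_. 0)" by (simp add: germ_eq_iff)
    moreover have "(\<lambda>_. 0) \<in> fun_ideal (P 0)"
      using prime by (intro fun_ideal_zero primeideal.axioms(1)) simp
    ultimately have "F \<in> fun_ideal (P 0)" using F by (simp add: fun_ideal_def)
    then have F0: "(\<lambda>y. nested_sum N (map (\<lambda>h. h y) hs) c) \<in> fun_ideal (P 0)"
      by (simp add: F_def[abs_def])
    obtain l where l: "l \<in> exponents N (length hs)" "c l \<noteq> 0" using c(1) V(5) by auto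
    have "c l = 0"
    proof (rule prime_chain_independent[of hs P N c l])
      fix i assume i: "i < length hs"
      then show "hs ! i \<in> fun_ideal (P (Suc i)) - fun_ideal (P i)"
        using h[of i] rk len by (simp add: hs_def)
      have "P i \<subset> P (Suc i)" using chain rk len i by simp
      then show "P i \<subseteq> P (Suc i)" by blast
    qed (use prime rk len hs F0 l(1) in auto)
    then show False using l by simp
  qed
  then show "enat k \<le> enat (card I)" by simp
qed

lemma ideal_local_max_ideal: "ideal (local_max_ideal X x) R"
  unfolding local_max_ideal_eq
  by (rule ideal_germ_image) (auto simp: const_reg reg_at_add reg_at_mult)

text \<open>Every tangent direction along which the \<open>a l\<close> are dual coordinates costs a generator of the
  maximal ideal.\<close>

lemma card_generators_ge:
  fixes \<gamma> :: "'l \<Rightarrow> complex \<Rightarrow> 'a"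
  assumes "finite L" and base: "\<And>l. l \<in> L \<Longrightarrow> \<gamma> l 0 = x"
    and diff: "\<And>l f. l \<in> L \<Longrightarrow> f \<in> reg \<Longrightarrow>
      \<exists>D. ((\<lambda>t. f (\<gamma> l t)) has_field_derivative D) (at 0)"
    and cont: "\<And>l V. l \<in> L \<Longrightarrow> opn V \<Longrightarrow> x \<in> V \<Longrightarrow>
      eventually (\<lambda>t. \<gamma> l t \<in> V) (nhds 0)"
    and a: "\<And>l. l \<in> L \<Longrightarrow> a l \<in> reg" "\<And>l. l \<in> L \<Longrightarrow> a l x = 0"
    and dual: "\<And>k l. k \<in> L \<Longrightarrow> l \<in> L \<Longrightarrow> 
      ((\<lambda>t. a l (\<gamma> k t)) has_field_derivative (if k = l then 1 else 0)) (at 0)"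
    and S: "finite S" "S \<subseteq> carrier R" "Idl\<^bsub>R\<^esub> S = local_max_ideal X x"
  shows "card L \<le> card S"
proof (rule ccontr)
  assume "\<not> card L \<le> card S"
  interpret cring R by (rule cring)
  obtain \<phi> where \<phi>: "\<And>s. s \<in> S \<Longrightarrow> \<phi> s \<in> reg \<and> s = germ X x (\<phi> s)"
  proof -
    have "\<forall>s\<in>S. \<exists>f. f \<in> reg \<and> s = germ X x f" using S(2) unfolding carrier_local_ring by blast
    from bchoice[OF this] show ?thesis using that by blast
  qed
  define dv where "dv l f = (SOME D. ((\<lambda>t. f (\<gamma> l t)) has_field_derivative D) (at 0))" for l f
  have dv: "((\<lambda>t. f (\<gamma> l t)) has_field_derivative dv l f) (at 0)" if "l \<in> L" "f \<in> reg" for l f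
    unfolding dv_def by (rule someI_ex[OF diff[OF that]])
  \<comment> \<open>With fewer generators than directions, some nonzero combination \<open>y\<close>
    of the directional derivatives kills every generator.\<close>
  obtain y where y: "\<exists>l\<in>L. y l \<noteq> 0" "\<forall>s\<in>S. (\<Sum>l\<in>L. dv l (\<phi> s) * y l) = 0"
    using homogeneous_system_nontrivial[OF S(1) assms(1), of "\<lambda>s l. dv l (\<phi> s)"]
      \<open>\<not> card L \<le> card S\<close> unfolding not_le by blast
  define D where "D f = (\<Sum>l\<in>L. dv l f * y l)" for f
  \<comment> \<open>\<open>D\<close> is well defined on germs because the curves stay in any given
    neighbourhood of \<open>x\<close> for small parameters.\<close>
  have D_cong: "D f = D g" if near: "near (\<lambda>v. f v = g v)" and "f \<in> reg" "g \<in> reg" for f g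
  proof -
    obtain V where V: "opn V" "x \<in> V" "\<forall>v\<in>V. f v = g v"
      using near unfolding near_iff by blast
    have "dv l f = dv l g" if l: "l \<in> L" for l
    proof -
      have "eventually (\<lambda>t. f (\<gamma> l t) = g (\<gamma> l t)) (nhds 0)"
        using V(3) by (intro eventually_mono[OF cont[OF l V(1,2)]]) auto
      then have "((\<lambda>t. g (\<gamma> l t)) has_field_derivative dv l f) (at 0)"
        using dv[OF l \<open>f \<in> reg\<close>] by (simp add: DERIV_cong_ev[OF refl _ refl])
      then show ?thesis using dv[OF l \<open>g \<in> reg\<close>] by (rule DERIV_unique)
    qed
    then show ?thesis by (simp add: D_def)
  qed
  have "dv l (\<lambda>v. f v + g v) = dv l f + dv l g" if "l \<in> L" "f \<in> reg" "g \<in> reg" for l f g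
    using that by (intro DERIV_unique[OF dv DERIV_add] dv reg_at_add)
  then have D_add: "D (\<lambda>v. f v + g v) = D f + D g" if "f \<in> reg" "g \<in> reg" for f g
    using that by (simp add: D_def sum.distrib algebra_simps)
  have "dv l (\<lambda>v. f v * g v) = g x * dv l f + f x * dv l g" if "l \<in> L" "f \<in> reg" "g \<in> reg" for l f g
    using DERIV_unique[OF dv[OF that(1) reg_at_mult[OF that(2,3)]]
      DERIV_mult[OF dv[OF that(1,2)] dv[OF that(1,3)]]] base[OF that(1)] by simp
  then have D_mult: "D (\<lambda>v. f v * g v) = f x * D g + g x * D f" if "f \<in> reg" "g \<in> reg" for f g
    using that by (simp add: D_def sum.distrib sum_distrib_left algebra_simps)
  have dual': "dv k (a l) = (if k = l then 1 else 0)" if "k \<in> L" "l \<in> L" for k l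
    using DERIV_unique[OF dv[OF that(1) a(1)[OF that(2)]] dual[OF that]] .
  have "dv l (\<lambda>_. 0) = 0" if "l \<in> L" for l
    using DERIV_unique[OF dv[OF that const_reg] DERIV_const] .
  then have D_0: "D (\<lambda>_. 0) = 0" by (simp add: D_def)
  \<comment> \<open>By the Leibniz rule the functions that vanish at \<open>x\<close> and are killed
    by \<open>D\<close> form an ideal. It contains the generators, hence the whole maximal ideal,
    whereas \<open>D (a l)\<close> equals \<open>y l\<close>.\<close>
  define J where "J = {f \<in> reg. f x = 0 \<and> D f = 0}"
  have "ideal (germ X x ` J) R"
    by (rule ideal_germ_image)
      (auto simp: J_def const_reg reg_at_add reg_at_mult D_add D_mult D_0)
  moreover have "S \<subseteq> germ X x ` J"
  proof
    fix s assume s: "s \<in> S"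
    then have "s \<in> local_max_ideal X x" using genideal_self[OF S(2)] S(3) by blast
    then have "\<phi> s x = 0" using \<phi>[OF s] mem_germ_self[of "\<phi> s" X x]
      by (auto simp: local_max_ideal_def)
    then have "\<phi> s \<in> J" using \<phi>[OF s] y(2) s by (simp add: J_def D_def)
    then show "s \<in> germ X x ` J" using \<phi>[OF s] by blast
  qed
  ultimately have "Idl\<^bsub>R\<^esub> S \<subseteq> germ X x ` J" by (rule genideal_minimal)
  then have max: "local_max_ideal X x \<subseteq> germ X x ` J" by (simp add: S(3))
  have "y l = 0" if l: "l \<in> L" for l
  proof -
    have "germ X x (a l) \<in> germ X x ` J"
      using max a[OF l] by (auto simp: local_max_ideal_eq)
    then obtain f where "f \<in> J" "near (\<lambda>v. a l v = f v)" by (auto simp: germ_eq_iff)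
    then have "D (a l) = 0" using D_cong[of "a l" f] a(1)[OF l] by (simp add: J_def)
    then show ?thesis using l assms(1) by (simp add: D_def dual' if_distrib[of "\<lambda>u. u * _"] cong: if_cong sum.cong)
  qed
  then show False using y(1) by blast
qed

text \<open>Here \<open>x\<close> is the origin of an affine chart. The coordinates generate the
  maximal ideal by expansion at 0; \<open>krull_dim_le\<close> bounds the dimension above, and the
  coordinate subspaces give a chain of primes with \<open>card I\<close> steps. The assumption
  \<open>cont\<close> is continuity at the origin in polynomial form.\<close>

lemma smooth_at_chart:
  fixes \<psi> :: "('v \<Rightarrow> complex) \<Rightarrow> 'a" and y :: "'v \<Rightarrow> 'a \<Rightarrow> complex"
  assumes fin: "finite I" and par: "parametrized I \<psi>" and y: "\<And>i. i \<in> I \<Longrightarrow> y i \<in> reg"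
    and U: "opn U" "x \<in> U"
    and surj: "\<And>v. v \<in> U \<Longrightarrow> v = \<psi> (\<lambda>i. if i \<in> I then y i v else 0)"
    and coord: "\<And>z i. \<psi> z \<in> U \<Longrightarrow> i \<in> I \<Longrightarrow> y i (\<psi> z) = z i"
    and cont: "\<And>V. opn V \<Longrightarrow> x \<in> V \<Longrightarrow>
      \<exists>F\<in>mpoly_fun I. F (\<lambda>_. 0) \<noteq> 0 \<and> (\<forall>z. F z \<noteq> 0 \<longrightarrow> \<psi> z \<in> V)"
    and base: "\<psi> (\<lambda>_. 0) = x"
  shows "smooth_at X x"
proof -
  interpret cring R by (rule cring)
  have y0: "y i x = 0" if "i \<in> I" for i using coord[of "\<lambda>_. 0" i] base U that by simp
  have fraction: "\<exists>p q. p \<in> mpoly_fun I \<and> q \<in> mpoly_fun I \<and> q (\<lambda>_. 0) \<noteq> 0 \<and>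
      near (\<lambda>v. f v = p (\<lambda>i. y i v) / q (\<lambda>i. y i v))" if "f \<in> reg" for f
  proof -
    obtain V p q where V: "opn V" "x \<in> V" "p \<in> mpoly_fun I" "q \<in> mpoly_fun I"
      "\<And>z. \<psi> z \<in> V \<Longrightarrow> q z \<noteq> 0" "\<And>z. \<psi> z \<in> V \<Longrightarrow> f (\<psi> z) = p z / q z"
      using parametrizedE[OF par \<open>f \<in> reg\<close>] by metis
    have "f v = p (\<lambda>i. y i v) / q (\<lambda>i. y i v)" if v: "v \<in> V \<inter> U" for v
    proof -
      let ?z = "\<lambda>i. if i \<in> I then y i v else 0"
      have "v = \<psi> ?z" using surj v by blast
      then have "f v = p ?z / q ?z" using V(6)[of ?z] v by simp
      moreover have "p ?z = p (\<lambda>i. y i v)" "q ?z = q (\<lambda>i. y i v)"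
        by (rule mpoly_fun_cong[OF V(3)] mpoly_fun_cong[OF V(4)], simp)+
      ultimately show ?thesis by simp
    qed
    then have "near (\<lambda>v. f v = p (\<lambda>i. y i v) / q (\<lambda>i. y i v))"
      unfolding near_iff using V(1,2) U by (intro exI[of _ "V \<inter> U"]) auto
    moreover have "q (\<lambda>_. 0) \<noteq> 0" using V(5) base V(2) by simp
    ultimately show ?thesis using V(3,4) by blast
  qed
  have poly_reg: "(\<lambda>v. p (\<lambda>i. y i v)) \<in> reg" if "p \<in> mpoly_fun I" for p
    by (rule reg_at_mpoly_fun[OF x_in that y])
  have poly_at: "p (\<lambda>i. y i x) = p (\<lambda>_. 0)" if "p \<in> mpoly_fun I" for p
    by (rule mpoly_fun_cong[OF that]) (simp add: y0)
  define proj where "proj A z = (\<lambda>i. if i \<in> A then 0 else z i)" for A and z :: "'v \<Rightarrow> complex"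
  have proj_poly: "(\<lambda>z. p (proj A z)) \<in> mpoly_fun I" if "p \<in> mpoly_fun I" for p A
  proof (rule mpoly_fun_compose[OF that])
    fix i assume "i \<in> I"
    then show "(\<lambda>z. proj A z i) \<in> mpoly_fun I"
      by (cases "i \<in> A") (auto simp: proj_def intro: mpoly_fun.intros)
  qed
  have proj0: "proj A (\<lambda>_. 0) = (\<lambda>_. 0)" for A by (auto simp: proj_def)
  \<comment> \<open>A polynomial that is nonzero at the origin is also nonzero at some other point
    of every axis; such points tell the coordinate germs apart.\<close>
  have axis: "\<exists>t. t \<noteq> 0 \<and> F (\<lambda>j. if j = i then t else 0) \<noteq> 0"
    if F: "F \<in> mpoly_fun I" "F (\<lambda>_. 0) \<noteq> 0" for F i
  proof -
    have "((\<lambda>t. F (\<lambda>j. if j = i then t else 0)) \<longlongrightarrow> F (\<lambda>_. 0)) (at 0)"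
    proof (rule mpoly_fun_tendsto[OF F(1)])
      fix j show "((\<lambda>t::complex. if j = i then t else 0) \<longlongrightarrow> 0) (at 0)"
        by (cases "j = i") (simp_all add: tendsto_ident_at)
    qed
    then have "eventually (\<lambda>t. F (\<lambda>j. if j = i then t else 0) \<noteq> 0) (at 0)"
      using F(2) by (rule tendsto_imp_eventually_ne)
    moreover have "eventually (\<lambda>t::complex. t \<noteq> 0) (at 0)" by (rule eventually_neq_at_within)
    ultimately have "eventually (\<lambda>t. t \<noteq> 0 \<and> F (\<lambda>j. if j = i then t else 0) \<noteq> 0) (at 0)"
      by eventually_elim simp
    then show ?thesis by (rule eventually_happens'[OF at_neq_bot])
  qed
  define S where "S = (\<lambda>i. germ X x (y i)) ` I"
  have S: "finite S" "S \<subseteq> carrier R" using fin y by (auto simp: S_def carrier_local_ring)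
  \<comment> \<open>The generators have to be distinct germs, since \<open>smooth_at\<close> counts
    them as a set.\<close>
  have "inj_on (\<lambda>i. germ X x (y i)) I"
  proof (rule inj_onI, rule ccontr)
    fix i j assume ij: "i \<in> I" "j \<in> I" "germ X x (y i) = germ X x (y j)" "i \<noteq> j"
    then obtain V where V: "opn V" "x \<in> V" "\<forall>v\<in>V. y i v = y j v"
      unfolding germ_eq_iff near_iff by blast
    then obtain F where F: "F \<in> mpoly_fun I" "F (\<lambda>_. 0) \<noteq> 0" "\<forall>z. F z \<noteq> 0 \<longrightarrow> \<psi> z \<in> V \<inter> U"
      using cont[of "V \<inter> U"] U by auto
    then obtain t where t: "t \<noteq> 0" "\<psi> (\<lambda>k. if k = i then t else 0) \<in> V \<inter> U" using axis by blast
    have "y i (\<psi> (\<lambda>k. if k = i then t else 0)) = t" "y j (\<psi> (\<lambda>k. if k = i then t else 0)) = 0"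
      using coord[of "\<lambda>k. if k = i then t else 0"] t ij by auto
    then show False using V(3) t by auto
  qed
  then have cardS: "card S = card I" by (simp add: S_def card_image)
  have "Idl\<^bsub>R\<^esub> S = local_max_ideal X x"
  proof
    have "S \<subseteq> local_max_ideal X x" using y y0 by (auto simp: S_def local_max_ideal_eq)
    then show "Idl\<^bsub>R\<^esub> S \<subseteq> local_max_ideal X x" by (rule genideal_minimal[OF ideal_local_max_ideal])
    have id: "ideal (Idl\<^bsub>R\<^esub> S) R" by (rule genideal_ideal[OF S(2)])
    show "local_max_ideal X x \<subseteq> Idl\<^bsub>R\<^esub> S"
    proof
      fix A assume "A \<in> local_max_ideal X x"
      then obtain f where f: "f \<in> reg" "f x = 0" "A = germ X x f" by (auto simp: local_max_ideal_eq)
      obtain p q where pq: "p \<in> mpoly_fun I" "q \<in> mpoly_fun I" "q (\<lambda>_. 0) \<noteq> 0"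
        "near (\<lambda>v. f v = p (\<lambda>i. y i v) / q (\<lambda>i. y i v))" using fraction[OF f(1)] by blast
      have "p (\<lambda>_. 0) = 0" using near_at[OF pq(4)] f(2) pq(3) poly_at[OF pq(1)] poly_at[OF pq(2)] by simp
      then obtain h where h: "\<forall>i\<in>I. h i \<in> mpoly_fun I" "\<forall>z. p z = (\<Sum>i\<in>I. z i * h i z)"
        using mpoly_fun_expand_at_0[OF pq(1) fin] by auto
      define g where "g i v = h i (\<lambda>i. y i v) * inverse (q (\<lambda>i. y i v))" for i v
      have g: "g i \<in> reg" if "i \<in> I" for i
        unfolding g_def using h(1) that pq
        by (intro reg_at_mult reg_at_inverse poly_reg) (auto simp: poly_at)
      have "(\<lambda>v. g i v * y i v) \<in> fun_ideal (Idl\<^bsub>R\<^esub> S)" if "i \<in> I" for i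
        using genideal_self[OF S(2)] that
        by (intro fun_ideal_mult[OF id g]) (auto simp: fun_ideal_def y S_def)
      then have "(\<lambda>v. \<Sum>i\<in>I. g i v * y i v) \<in> fun_ideal (Idl\<^bsub>R\<^esub> S)" by (rule fun_ideal_sum[OF id])
      moreover have "p (\<lambda>i. y i v) / q (\<lambda>i. y i v) = (\<Sum>i\<in>I. g i v * y i v)" for v
        unfolding h(2)[rule_format] g_def
        by (simp add: divide_inverse sum_distrib_left mult_ac)
      then have "germ X x f = germ X x (\<lambda>v. \<Sum>i\<in>I. g i v * y i v)" using pq(4) by (simp add: germ_eq_iff)
      ultimately show "A \<in> Idl\<^bsub>R\<^esub> S" using f(3) by (simp add: fun_ideal_def)
    qed
  qed
  moreover have "krull_dim R = enat (card I)"
  proof (rule antisym)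
    show "krull_dim R \<le> enat (card I)"
    proof (rule krull_dim_le[OF fin par U])
      fix W assume "W \<subseteq> U" "W \<noteq> {}"
      then obtain v where "v \<in> W" "v \<in> U" by blast
      with surj[of v] have "\<psi> (\<lambda>i. if i \<in> I then y i v else 0) \<in> W" by simp
      then show "\<exists>z. \<psi> z \<in> W" by (rule exI[of "\<lambda>z. \<psi> z \<in> W"])
    qed
    \<comment> \<open>\<open>J A\<close> consists of the functions that vanish, near
      \<open>x\<close>, on the coordinate subspace where the variables in \<open>A\<close> are zero.
      It is prime because polynomials on that subspace have no zero divisors.\<close>
    define J where "J A = {f \<in> reg. \<exists>V. opn V \<and> x \<in> V \<and>
      (\<forall>z. (\<forall>i\<in>A. z i = 0) \<longrightarrow> \<psi> z \<in> V \<longrightarrow> f (\<psi> z) = 0)}" for A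
    have J_cong: "f \<in> J A" if near: "near (\<lambda>v. f v = g v)" and "f \<in> reg" and g: "g \<in> J A" for f g A
    proof -
      obtain V W where "opn V" "x \<in> V" "\<forall>v\<in>V. f v = g v" "opn W" "x \<in> W"
        "\<forall>z. (\<forall>i\<in>A. z i = 0) \<longrightarrow> \<psi> z \<in> W \<longrightarrow> g (\<psi> z) = 0"
        using near g unfolding near_iff J_def by blast
      then show ?thesis unfolding J_def using \<open>f \<in> reg\<close>
        by (intro CollectI conjI exI[of _ "V \<inter> W"]) auto
    qed
    have ideal: "ideal (germ X x ` J A) R" for A
    proof (rule ideal_germ_image)
      show "(\<lambda>_. 0) \<in> J A" using U by (auto simp: J_def const_reg)
      fix f g
      show "(\<lambda>v. f v * g v) \<in> J A" if "f \<in> reg" "g \<in> J A"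
        using that by (auto simp: J_def intro: reg_at_mult)
      assume "f \<in> J A" "g \<in> J A"
      then obtain V W where "opn V" "x \<in> V" "opn W" "x \<in> W" "f \<in> reg" "g \<in> reg"
        "\<forall>z. (\<forall>i\<in>A. z i = 0) \<longrightarrow> \<psi> z \<in> V \<longrightarrow> f (\<psi> z) = 0"
        "\<forall>z. (\<forall>i\<in>A. z i = 0) \<longrightarrow> \<psi> z \<in> W \<longrightarrow> g (\<psi> z) = 0"
        unfolding J_def by blast
      then show "(\<lambda>v. f v + g v) \<in> J A" unfolding J_def
        by (intro CollectI conjI exI[of _ "V \<inter> W"] reg_at_add) auto
    qed (auto simp: J_def)
    have mem_iff: "germ X x f \<in> germ X x ` J A \<longleftrightarrow> f \<in> J A" if "f \<in> reg" for f A
      using J_cong that by (auto simp: germ_eq_iff)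
    have prime: "primeideal (germ X x ` J A) R" if "A \<subseteq> I" for A
    proof (rule primeidealI[OF ideal cring])
      have "(\<lambda>_. 1) \<notin> J A"
        using base by (auto simp: J_def dest!: spec[of _ "\<lambda>_. 0"])
      then show "carrier R \<noteq> germ X x ` J A"
        using mem_iff[OF const_reg, of 1 A] const_reg[of 1] unfolding carrier_local_ring by blast
      fix a b assume ab: "a \<in> carrier R" "b \<in> carrier R" "a \<otimes>\<^bsub>R\<^esub> b \<in> germ X x ` J A"
      then obtain f g where fg: "f \<in> reg" "g \<in> reg" "a = germ X x f" "b = germ X x g"
        by (auto simp: carrier_local_ring)
      then have "(\<lambda>v. f v * g v) \<in> J A"
        using ab(3) mem_iff[OF reg_at_mult[OF fg(1,2)]] by (simp add: germ_mult)
      then obtain V where V: "opn V" "x \<in> V"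
        "\<forall>z. (\<forall>i\<in>A. z i = 0) \<longrightarrow> \<psi> z \<in> V \<longrightarrow> f (\<psi> z) * g (\<psi> z) = 0" unfolding J_def by blast
      obtain V1 p1 q1 where 1: "opn V1" "x \<in> V1" "p1 \<in> mpoly_fun I"
        "q1 \<in> mpoly_fun I" "\<And>z. \<psi> z \<in> V1 \<Longrightarrow> q1 z \<noteq> 0" "\<And>z. \<psi> z \<in> V1 \<Longrightarrow> f (\<psi> z) = p1 z / q1 z"
        using parametrizedE[OF par fg(1)] by metis
      obtain V2 p2 q2 where 2: "opn V2" "x \<in> V2" "p2 \<in> mpoly_fun I"
        "q2 \<in> mpoly_fun I" "\<And>z. \<psi> z \<in> V2 \<Longrightarrow> q2 z \<noteq> 0" "\<And>z. \<psi> z \<in> V2 \<Longrightarrow> g (\<psi> z) = p2 z / q2 z"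
        using parametrizedE[OF par fg(2)] by metis
      obtain F where F: "F \<in> mpoly_fun I" "F (\<lambda>_. 0) \<noteq> 0" "\<forall>z. F z \<noteq> 0 \<longrightarrow> \<psi> z \<in> V \<inter> (V1 \<inter> V2)"
        using cont[of "V \<inter> (V1 \<inter> V2)"] V 1 2 by auto
      let ?p = "\<lambda>p z. p (proj A z)"
      \<comment> \<open>The factor \<open>F\<close> extends the vanishing of the product from a
        neighbourhood to the entire subspace. It is nonzero at the origin, so it can be cancelled
        afterwards.\<close>
      have zero: "F (proj A z) * (p1 (proj A z) * p2 (proj A z)) = 0" for z
      proof (cases "F (proj A z) = 0")
        case False
        then have *: "\<psi> (proj A z) \<in> V" "\<psi> (proj A z) \<in> V1" "\<psi> (proj A z) \<in> V2" using F by auto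
        have "f (\<psi> (proj A z)) * g (\<psi> (proj A z)) = 0" using V(3) * by (simp add: proj_def)
        then show ?thesis using 1(5,6)[of "proj A z"] 2(5,6)[of "proj A z"] * by auto
      qed simp
      have "(\<forall>z. ?p F z = 0) \<or> (\<forall>z. ?p p1 z * ?p p2 z = 0)"
        by (rule mpoly_fun_mult_eq_0[of _ I]) (intro proj_poly mpoly_fun.mult F 1 2 zero)+
      moreover have "?p F (\<lambda>_. 0) \<noteq> 0" using F(2) by (simp add: proj0)
      ultimately have "\<And>z. ?p p1 z * ?p p2 z = 0" by blast
      then have "(\<forall>z. ?p p1 z = 0) \<or> (\<forall>z. ?p p2 z = 0)"
        by (intro mpoly_fun_mult_eq_0[of _ I] proj_poly 1 2)
      moreover have proj_id: "proj A z = z" if "\<forall>i\<in>A. z i = 0" for z using that by (auto simp: proj_def)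
      ultimately have "(\<forall>z. (\<forall>i\<in>A. z i = 0) \<longrightarrow> \<psi> z \<in> V1 \<longrightarrow> f (\<psi> z) = 0)
        \<or> (\<forall>z. (\<forall>i\<in>A. z i = 0) \<longrightarrow> \<psi> z \<in> V2 \<longrightarrow> g (\<psi> z) = 0)"
      proof (elim disjE)
        assume *: "\<forall>z. ?p p1 z = 0"
        have "f (\<psi> z) = 0" if "\<forall>i\<in>A. z i = 0" "\<psi> z \<in> V1" for z
          using *[rule_format, of z] proj_id[OF that(1)] 1(6)[OF that(2)] by simp
        then show ?thesis by blast
      next
        assume *: "\<forall>z. ?p p2 z = 0"
        have "g (\<psi> z) = 0" if "\<forall>i\<in>A. z i = 0" "\<psi> z \<in> V2" for z
          using *[rule_format, of z] proj_id[OF that(1)] 2(6)[OF that(2)] by simp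
        then show ?thesis by blast
      qed
      then have "f \<in> J A \<or> g \<in> J A" using fg 1(1,2) 2(1,2) unfolding J_def by blast
      then show "a \<in> germ X x ` J A \<or> b \<in> germ X x ` J A" using fg by blast
    qed
    have strict: "germ X x ` J A \<subset> germ X x ` J (insert i A)" if "i \<in> I" "i \<notin> A" for A i
    proof -
      have "J A \<subseteq> J (insert i A)" by (auto simp: J_def)
      moreover have "y i \<in> J (insert i A)"
        using y coord U that(1) by (auto simp: J_def intro!: exI[of _ U])
      moreover have "y i \<notin> J A"
      proof
        assume "y i \<in> J A"
        then obtain V where V: "opn V" "x \<in> V"
          "\<forall>z. (\<forall>i\<in>A. z i = 0) \<longrightarrow> \<psi> z \<in> V \<longrightarrow> y i (\<psi> z) = 0" unfolding J_def by blast
        then obtain F where F: "F \<in> mpoly_fun I" "F (\<lambda>_. 0) \<noteq> 0" "\<forall>z. F z \<noteq> 0 \<longrightarrow> \<psi> z \<in> V \<inter> U"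
          using cont[of "V \<inter> U"] U by auto
        then obtain t where t: "t \<noteq> 0" "\<psi> (\<lambda>k. if k = i then t else 0) \<in> V \<inter> U" using axis by blast
        have "y i (\<psi> (\<lambda>k. if k = i then t else 0)) = 0"
        proof (rule V(3)[rule_format])
          show "\<psi> (\<lambda>k. if k = i then t else 0) \<in> V" using t(2) by blast
        qed (use that(2) in auto)
        then show False using coord[OF _ \<open>i \<in> I\<close>] t by auto
      qed
      ultimately have "germ X x ` J A \<subseteq> germ X x ` J (insert i A)"
        "germ X x (y i) \<in> germ X x ` J (insert i A)" "germ X x (y i) \<notin> germ X x ` J A"
        using mem_iff[OF y[OF that(1)]] by (simp_all only: image_mono simp_thms)
      then show ?thesis by blast
    qed
    obtain xs where xs: "set xs = I" "distinct xs" using finite_distinct_list[OF fin] by blast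
    then have len: "length xs = card I" by (simp flip: distinct_card)
    \<comment> \<open>Killing the coordinates one after the other gives a strict chain with
      \<open>card I\<close> steps.\<close>
    define P where "P k = germ X x ` J (set (take k xs))" for k
    have "P k \<subset> P (Suc k)" if "k < card I" for k
    proof -
      have "set (take (Suc k) xs) = insert (xs ! k) (set (take k xs))"
        using that len by (simp add: take_Suc_conv_app_nth)
      moreover have "xs ! k \<notin> set (take k xs)"
        using that len xs(2) by (auto simp: in_set_conv_nth nth_eq_iff_index_eq)
      moreover have "xs ! k \<in> I" using that len xs(1) by (metis nth_mem)
      ultimately show ?thesis using strict by (simp add: P_def)
    qed
    moreover have "primeideal (P k) R" for k
      unfolding P_def using xs(1) set_take_subset[of k xs] by (intro prime) simp
    ultimately show "enat (card I) \<le> krull_dim R"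
      unfolding krull_dim_def by (intro Sup_upper) blast
  qed
  ultimately show ?thesis unfolding smooth_at_def using S cardS by (intro exI[of _ S]) simp
qed

end

section \<open>Regular functions on SL, on quotients and on subspaces\<close>

lemma topspace_SL_variety: "topspace (fs_top (SL_variety n)) = carrier (SL n)"
  by (simp add: SL_variety_def topspace_zariski_SL)

lemma fs_reg_SL:
  "f \<in> fs_reg (SL_variety n) U \<longleftrightarrow> (\<forall>x\<in>U. \<exists>V. openin (zariski_SL n) V \<and> x \<in> V \<and> V \<subseteq> U \<and>
      (\<exists>p\<in>poly_fun n. \<exists>q\<in>poly_fun n. \<forall>y\<in>V. q y \<noteq> 0 \<and> f y = p y / q y))"
  by (simp add: SL_variety_def)

lemma openin_zariski_nonzero: "p \<in> poly_fun n \<Longrightarrow> openin (zariski_SL n) {A \<in> carrier (SL n). p A \<noteq> 0}"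
  unfolding openin_zariski_SL by (rule exI[of _ "{p}"]) auto

lemma function_space_SL: "function_space (SL_variety n)"
proof
  fix U and f :: "complex mat \<Rightarrow> complex" assume U: "openin (fs_top (SL_variety n)) U"
  have U': "openin (zariski_SL n) U" using U by (simp add: SL_variety_def)
  note regD = fs_reg_SL[THEN iffD1, THEN bspec]
  have ex: "\<exists>V. openin (zariski_SL n) V \<and> x \<in> V \<and> V \<subseteq> U \<and>
      (\<exists>p\<in>poly_fun n. \<exists>q\<in>poly_fun n. \<forall>y\<in>V. q y \<noteq> 0 \<and> f y = p y / q y)"
    if "p \<in> poly_fun n" "q \<in> poly_fun n" "\<forall>y\<in>V. q y \<noteq> 0 \<and> f y = p y / q y"
      "openin (zariski_SL n) V" "x \<in> V" "V \<subseteq> U" for x U V p q and f :: "complex mat \<Rightarrow> complex"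
    using that by (intro exI[of _ V] conjI bexI[of _ p] bexI[of _ q])
  have top: "fs_top (SL_variety n) = zariski_SL n" by (simp add: SL_variety_def)
  show "(\<lambda>_. c) \<in> fs_reg (SL_variety n) U" for c
  proof -
    have "(\<lambda>_. c) \<in> poly_fun n" "(\<lambda>_. 1) \<in> poly_fun n" "\<forall>y\<in>U. 1 \<noteq> (0::complex) \<and> c = c / 1"
      by (auto intro: poly_fun.const)
    from ex[OF this U' _ subset_refl] show ?thesis unfolding fs_reg_SL by (rule ballI)
  qed
  show "f \<in> fs_reg (SL_variety n) V"
    if V: "openin (fs_top (SL_variety n)) V" "V \<subseteq> U" and f: "f \<in> fs_reg (SL_variety n) U" for V
    unfolding fs_reg_SL
  proof
    fix x assume x: "x \<in> V"
    then have "x \<in> U" using V(2) by blast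
    from regD[OF f this] obtain W p q where W: "openin (zariski_SL n) W" "x \<in> W" "p \<in> poly_fun n"
      "q \<in> poly_fun n" "\<forall>y\<in>W. q y \<noteq> 0 \<and> f y = p y / q y" by blast
    show "\<exists>W. openin (zariski_SL n) W \<and> x \<in> W \<and> W \<subseteq> V \<and>
      (\<exists>p\<in>poly_fun n. \<exists>q\<in>poly_fun n. \<forall>y\<in>W. q y \<noteq> 0 \<and> f y = p y / q y)"
      by (rule ex[of p q "W \<inter> V"]) (use W V(1) x in \<open>auto simp: top\<close>)
  qed
  {
    fix g :: "complex mat \<Rightarrow> complex"
    assume f: "f \<in> fs_reg (SL_variety n) U" and g: "g \<in> fs_reg (SL_variety n) U"
    have "(\<lambda>y. f y + g y) \<in> fs_reg (SL_variety n) U \<and> (\<lambda>y. f y * g y) \<in> fs_reg (SL_variety n) U"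
      unfolding fs_reg_SL
    proof (intro conjI ballI)
      fix x assume x: "x \<in> U"
      from regD[OF f x] obtain V p q where V: "openin (zariski_SL n) V" "x \<in> V" "V \<subseteq> U" "p \<in> poly_fun n"
        "q \<in> poly_fun n" "\<forall>y\<in>V. q y \<noteq> 0 \<and> f y = p y / q y" by blast
      from regD[OF g x] obtain W r s where W: "openin (zariski_SL n) W" "x \<in> W" "W \<subseteq> U" "r \<in> poly_fun n"
        "s \<in> poly_fun n" "\<forall>y\<in>W. s y \<noteq> 0 \<and> g y = r y / s y" by blast
      have VW: "openin (zariski_SL n) (V \<inter> W)" "x \<in> V \<inter> W" "V \<inter> W \<subseteq> U" using V W by auto
      have qs: "(\<lambda>y. q y * s y) \<in> poly_fun n" using V W by (intro poly_fun.mult)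
      have num: "(\<lambda>y. p y * s y + r y * q y) \<in> poly_fun n" using V W by (intro poly_fun.mult poly_fun.add)
      have "\<forall>y\<in>V \<inter> W. q y * s y \<noteq> 0 \<and> f y + g y = (p y * s y + r y * q y) / (q y * s y)"
        using V(6) W(6) by (auto simp: add_frac_eq)
      from ex[OF num qs this VW] show "\<exists>V. openin (zariski_SL n) V \<and> x \<in> V \<and> V \<subseteq> U \<and>
        (\<exists>p\<in>poly_fun n. \<exists>q\<in>poly_fun n. \<forall>y\<in>V. q y \<noteq> 0 \<and> f y + g y = p y / q y)" .
      have num: "(\<lambda>y. p y * r y) \<in> poly_fun n" using V W by (intro poly_fun.mult)
      have "\<forall>y\<in>V \<inter> W. q y * s y \<noteq> 0 \<and> f y * g y = (p y * r y) / (q y * s y)"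
        using V(6) W(6) by auto
      from ex[OF num qs this VW] show "\<exists>V. openin (zariski_SL n) V \<and> x \<in> V \<and> V \<subseteq> U \<and>
        (\<exists>p\<in>poly_fun n. \<exists>q\<in>poly_fun n. \<forall>y\<in>V. q y \<noteq> 0 \<and> f y * g y = p y / q y)" .
    qed
    then show "(\<lambda>y. f y + g y) \<in> fs_reg (SL_variety n) U" "(\<lambda>y. f y * g y) \<in> fs_reg (SL_variety n) U"
      by blast+
  }
  assume f: "f \<in> fs_reg (SL_variety n) U"
  show "(\<lambda>y. inverse (f y)) \<in> fs_reg (SL_variety n) U" if nz: "\<And>y. y \<in> U \<Longrightarrow> f y \<noteq> 0"
    unfolding fs_reg_SL
  proof
    fix x assume x: "x \<in> U"
    from regD[OF f x] obtain V p q where V: "openin (zariski_SL n) V" "x \<in> V" "V \<subseteq> U" "p \<in> poly_fun n"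
      "q \<in> poly_fun n" "\<forall>y\<in>V. q y \<noteq> 0 \<and> f y = p y / q y" by blast
    have "\<forall>y\<in>V. p y \<noteq> 0 \<and> inverse (f y) = q y / p y"
      using V(3,6) nz by (auto simp: subset_iff)
    from ex[OF V(5,4) this V(1-3)] show "\<exists>V. openin (zariski_SL n) V \<and> x \<in> V \<and> V \<subseteq> U \<and>
      (\<exists>p\<in>poly_fun n. \<exists>q\<in>poly_fun n. \<forall>y\<in>V. q y \<noteq> 0 \<and> inverse (f y) = p y / q y)" .
  qed
  show "openin (fs_top (SL_variety n)) {y \<in> U. f y \<noteq> 0}"
    unfolding top
  proof (subst openin_subopen, clarify)
    fix x assume x: "x \<in> U" "f x \<noteq> 0"
    from regD[OF f x(1)] obtain V p q where V: "openin (zariski_SL n) V" "x \<in> V" "V \<subseteq> U" "p \<in> poly_fun n"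
      "q \<in> poly_fun n" "\<forall>y\<in>V. q y \<noteq> 0 \<and> f y = p y / q y" by blast
    show "\<exists>T. openin (zariski_SL n) T \<and> x \<in> T \<and> T \<subseteq> {y \<in> U. f y \<noteq> 0}"
      by (rule exI[of _ "V \<inter> {y \<in> carrier (SL n). p y \<noteq> 0}"])
        (use openin_zariski_nonzero[OF V(4)] V x openin_subset[OF V(1)] in \<open>auto simp: topspace_zariski_SL\<close>)
  qed
qed

text \<open>Open sets and regular functions of the quotient are defined by pulling back, so every
  axiom is inherited.\<close>

lemma function_space_quotient:
  assumes "function_space X"
  shows "function_space (quotient_fspace X \<pi>)"
proof -
  interpret function_space X by (rule assms)
  have reg: "f \<in> fs_reg (quotient_fspace X \<pi>) V \<longleftrightarrow>
      (\<lambda>y. f (\<pi> y)) \<in> fs_reg X {x \<in> topspace (fs_top X). \<pi> x \<in> V}" for f V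
    by (simp add: quotient_fspace_def o_def)
  show ?thesis
  proof
    fix U V f
    assume U: "openin (fs_top (quotient_fspace X \<pi>)) U" and f: "f \<in> fs_reg (quotient_fspace X \<pi>) U"
    have "{x \<in> topspace (fs_top X). \<pi> x \<in> {y \<in> U. f y \<noteq> 0}}
        = {x \<in> {x \<in> topspace (fs_top X). \<pi> x \<in> U}. f (\<pi> x) \<noteq> 0}" by auto
    then show "openin (fs_top (quotient_fspace X \<pi>)) {y \<in> U. f y \<noteq> 0}"
      using U f openin_nonzero[of "{x \<in> topspace (fs_top X). \<pi> x \<in> U}" "\<lambda>y. f (\<pi> y)"]
      by (auto simp: openin_quotient_fspace reg)
    assume V: "openin (fs_top (quotient_fspace X \<pi>)) V" "V \<subseteq> U"
    then have "{x \<in> topspace (fs_top X). \<pi> x \<in> V} \<subseteq> {x \<in> topspace (fs_top X). \<pi> x \<in> U}" by auto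
    then show "f \<in> fs_reg (quotient_fspace X \<pi>) V"
      using reg_restrict U f V unfolding openin_quotient_fspace reg by blast
  qed (auto simp: openin_quotient_fspace reg intro: reg_const reg_add reg_mult reg_inverse)
qed

lemma function_space_sub:
  assumes "function_space X"
  shows "function_space (sub_fspace X Z)"
proof -
  interpret function_space X by (rule assms)
  have reg: "f \<in> fs_reg (sub_fspace X Z) U \<longleftrightarrow> (\<forall>x\<in>U. \<exists>V g. openin (fs_top X) V \<and> x \<in> V \<and>
      g \<in> fs_reg X V \<and> (\<forall>y\<in>V \<inter> U. f y = g y))" for f U
    by (simp add: sub_fspace_def)
  note regD = reg[THEN iffD1, THEN bspec]
  have top: "fs_top (sub_fspace X Z) = subtopology (fs_top X) Z" by (simp add: sub_fspace_def)
  show ?thesis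
  proof
    fix U f assume U: "openin (fs_top (sub_fspace X Z)) U"
    have sub: "U \<subseteq> topspace (fs_top X)"
      using openin_subset[OF U] by (auto simp: top topspace_subtopology)
    show "(\<lambda>_. c) \<in> fs_reg (sub_fspace X Z) U" for c
      unfolding reg
      using reg_const[OF openin_topspace] sub by (intro ballI exI[of _ "topspace (fs_top X)"]) auto
    assume f: "f \<in> fs_reg (sub_fspace X Z) U"
    show "f \<in> fs_reg (sub_fspace X Z) V" if "V \<subseteq> U" for V
      unfolding reg
    proof
      fix x assume "x \<in> V"
      then have "x \<in> U" using that by blast
      from regD[OF f this] that show "\<exists>W g. openin (fs_top X) W \<and> x \<in> W \<and> g \<in> fs_reg X W \<and>
        (\<forall>y\<in>W \<inter> V. f y = g y)" by blast
    qed
    show "openin (fs_top (sub_fspace X Z)) {y \<in> U. f y \<noteq> 0}"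
    proof (subst openin_subopen, clarify)
      fix x assume x: "x \<in> U" "f x \<noteq> 0"
      from regD[OF f x(1)] obtain V g where V: "openin (fs_top X) V" "x \<in> V" "g \<in> fs_reg X V"
        "\<forall>y\<in>V \<inter> U. f y = g y" by blast
      have "openin (fs_top (sub_fspace X Z)) (U \<inter> (Z \<inter> {y \<in> V. g y \<noteq> 0}))"
        using openin_nonzero[OF V(1,3)] U unfolding top
        by (intro openin_Int openin_subtopology_Int2)
      then show "\<exists>T. openin (fs_top (sub_fspace X Z)) T \<and> x \<in> T \<and> T \<subseteq> {y \<in> U. f y \<noteq> 0}"
        using V x openin_subset[OF U]
        by (intro exI[of _ "U \<inter> (Z \<inter> {y \<in> V. g y \<noteq> 0})"]) (auto simp: top topspace_subtopology)
    qed
    show "(\<lambda>y. inverse (f y)) \<in> fs_reg (sub_fspace X Z) U" if nz: "\<And>y. y \<in> U \<Longrightarrow> f y \<noteq> 0"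
      unfolding reg
    proof
      fix x assume x: "x \<in> U"
      from regD[OF f x] obtain V g where V: "openin (fs_top X) V" "x \<in> V" "g \<in> fs_reg X V"
        "\<forall>y\<in>V \<inter> U. f y = g y" by blast
      let ?W = "{y \<in> V. g y \<noteq> 0}"
      have W: "openin (fs_top X) ?W" by (rule openin_nonzero[OF V(1,3)])
      have "g \<in> fs_reg X ?W" by (rule reg_restrict[OF V(1) W _ V(3)]) auto
      then have "(\<lambda>y. inverse (g y)) \<in> fs_reg X ?W" by (rule reg_inverse[OF W]) auto
      moreover have "x \<in> ?W" "\<forall>y\<in>?W \<inter> U. inverse (f y) = inverse (g y)"
        using V nz[OF x] x by auto
      ultimately show "\<exists>V g. openin (fs_top X) V \<and> x \<in> V \<and> g \<in> fs_reg X V \<and>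
        (\<forall>y\<in>V \<inter> U. inverse (f y) = g y)" using W
        by (intro exI[of _ ?W] exI[of _ "\<lambda>y. inverse (g y)"]) simp
    qed
    fix g assume g: "g \<in> fs_reg (sub_fspace X Z) U"
    have "(\<lambda>y. f y + g y) \<in> fs_reg (sub_fspace X Z) U \<and> (\<lambda>y. f y * g y) \<in> fs_reg (sub_fspace X Z) U"
      unfolding reg
    proof (intro conjI ballI)
      fix x assume x: "x \<in> U"
      from regD[OF f x] obtain V f' where V: "openin (fs_top X) V" "x \<in> V" "f' \<in> fs_reg X V"
        "\<forall>y\<in>V \<inter> U. f y = f' y" by blast
      from regD[OF g x] obtain W g' where W: "openin (fs_top X) W" "x \<in> W" "g' \<in> fs_reg X W"
        "\<forall>y\<in>W \<inter> U. g y = g' y" by blast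
      have VW: "openin (fs_top X) (V \<inter> W)" "x \<in> V \<inter> W" using V W by auto
      have r: "f' \<in> fs_reg X (V \<inter> W)" "g' \<in> fs_reg X (V \<inter> W)"
        using reg_restrict V W VW(1) by blast+
      show "\<exists>V h. openin (fs_top X) V \<and> x \<in> V \<and> h \<in> fs_reg X V \<and> (\<forall>y\<in>V \<inter> U. f y + g y = h y)"
        by (rule exI[of _ "V \<inter> W"], rule exI[of _ "\<lambda>y. f' y + g' y"])
          (use VW V(4) W(4) reg_add[OF VW(1) r] in auto)
      show "\<exists>V h. openin (fs_top X) V \<and> x \<in> V \<and> h \<in> fs_reg X V \<and> (\<forall>y\<in>V \<inter> U. f y * g y = h y)"
        by (rule exI[of _ "V \<inter> W"], rule exI[of _ "\<lambda>y. f' y * g' y"])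
          (use VW V(4) W(4) reg_mult[OF VW(1) r] in auto)
    qed
    then show "(\<lambda>y. f y + g y) \<in> fs_reg (sub_fspace X Z) U" "(\<lambda>y. f y * g y) \<in> fs_reg (sub_fspace X Z) U"
      by blast+
  qed
qed

section \<open>Charts of the Grassmannian\<close>

lemma mult_entry:
  assumes "A \<in> carrier_mat n m" "B \<in> carrier_mat m k" "i < n" "j < k"
  shows "(A * B) $$ (i, j) = (\<Sum>l<m. A $$ (i, l) * B $$ (l, j))"
  using assms by (simp add: scalar_prod_def atLeast0LessThan)

lemma carrier_SL_iff: "A \<in> carrier (SL n) \<longleftrightarrow> A \<in> carrier_mat n n \<and> det A = 1"
  by (simp add: SL_def)

lemma SL_mult [simp]: "A \<otimes>\<^bsub>SL n\<^esub> B = A * B"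
  and SL_one [simp]: "\<one>\<^bsub>SL n\<^esub> = 1\<^sub>m n"
  by (simp_all add: SL_def)

lemma group_SL: "group (SL n)"
proof (rule groupI)
  fix A assume A: "A \<in> carrier (SL n)"
  then have A': "A \<in> carrier_mat n n" "det A = 1" by (simp_all add: carrier_SL_iff)
  have "1 \<cdot>\<^sub>m 1\<^sub>m n = (1\<^sub>m n :: complex mat)" by (rule eq_matI) auto
  then have inv: "adj_mat A * A = 1\<^sub>m n" using adj_mat(3)[OF A'(1)] A'(2) by simp
  have "det (adj_mat A) * det A = 1"
    using det_mult[OF adj_mat(1)[OF A'(1)] A'(1)] inv by simp
  then show "\<exists>B\<in>carrier (SL n). B \<otimes>\<^bsub>SL n\<^esub> A = \<one>\<^bsub>SL n\<^esub>"
    using A'(2) inv adj_mat(1)[OF A'(1)] by (auto simp: carrier_SL_iff)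
qed (auto simp: carrier_SL_iff det_mult assoc_mult_mat)

interpretation SL: group "SL n" for n
  by (rule group_SL)

lemma SL_carrier_mat: "A \<in> carrier (SL n) \<Longrightarrow> A \<in> carrier_mat n n"
  by (simp add: carrier_SL_iff)

lemma SL_inv_mult: "A \<in> carrier (SL n) \<Longrightarrow> inv\<^bsub>SL n\<^esub> A * A = 1\<^sub>m n"
  and SL_mult_inv: "A \<in> carrier (SL n) \<Longrightarrow> A * inv\<^bsub>SL n\<^esub> A = 1\<^sub>m n"
  using SL.l_inv[of A n] SL.r_inv[of A n] by simp_all

lemma SL_mult_closed: "A \<in> carrier (SL n) \<Longrightarrow> B \<in> carrier (SL n) \<Longrightarrow> A * B \<in> carrier (SL n)"
  using SL.m_closed[of A n B] by simp

lemma SL_assoc: "A \<in> carrier (SL n) \<Longrightarrow> B \<in> carrier (SL n) \<Longrightarrow> C \<in> carrier (SL n) \<Longrightarrow>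
    A * B * C = A * (B * C)"
  using SL.m_assoc[of A n B C] by simp

lemma SL_mult_one: "A \<in> carrier (SL n) \<Longrightarrow> A * 1\<^sub>m n = A"
  and SL_one_mult: "A \<in> carrier (SL n) \<Longrightarrow> 1\<^sub>m n * A = A"
  using SL.r_one[of A n] SL.l_one[of A n] by simp_all

lemma SL_cancel_left: "A \<in> carrier (SL n) \<Longrightarrow> B \<in> carrier (SL n) \<Longrightarrow> inv\<^bsub>SL n\<^esub> A * (A * B) = B"
  by (subst SL_assoc[symmetric]) (simp_all add: SL_inv_mult SL_one_mult)

lemma SL_cancel_right: "A \<in> carrier (SL n) \<Longrightarrow> B \<in> carrier (SL n) \<Longrightarrow> A * (inv\<^bsub>SL n\<^esub> A * B) = B"
  by (subst SL_assoc[symmetric]) (simp_all add: SL_mult_inv SL_one_mult)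

definition topleft :: "nat \<Rightarrow> 'f mat \<Rightarrow> 'f mat" where
  "topleft k A = mat k k (\<lambda>(i, j). A $$ (i, j))"

lemma topleft_carrier [simp]: "topleft k A \<in> carrier_mat k k"
  by (simp add: topleft_def)

lemma adj_mat_sums:
  fixes A :: "'f :: field mat"
  assumes A: "A \<in> carrier_mat k k" and lm: "l < k" "m < k"
  shows "(\<Sum>j<k. A $$ (l, j) * adj_mat A $$ (j, m)) = (if l = m then det A else 0)"
    "(\<Sum>j<k. adj_mat A $$ (l, j) * A $$ (j, m)) = (if l = m then det A else 0)"
  unfolding mult_entry[OF A adj_mat(1)[OF A] lm, symmetric] mult_entry[OF adj_mat(1)[OF A] A lm, symmetric]
    adj_mat(2,3)[OF A] using lm by simp_all

lemma det_unitriangular: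
  fixes A :: "'f :: idom mat"
  assumes A: "A \<in> carrier_mat n n" "upper_triangular A" and diag: "\<And>i. i < n \<Longrightarrow> A $$ (i, i) = 1"
  shows "det A = 1"
  using diag A(1) by (simp add: det_upper_triangular[OF A(2,1)] prod_list_diag_prod)

text \<open>Multiplying by the adjugate turns the relation into
  \<open>b m * det A = 0\<close>.\<close>

lemma left_kernel_trivial:
  fixes A :: "'f :: field mat"
  assumes A: "A \<in> carrier_mat k k" "det A \<noteq> 0"
    and b: "\<And>j. j < k \<Longrightarrow> (\<Sum>l<k. b l * A $$ (l, j)) = 0" and m: "m < k"
  shows "b m = 0"
proof -
  have "0 = (\<Sum>j<k. (\<Sum>l<k. b l * A $$ (l, j)) * adj_mat A $$ (j, m))" using b by simp
  also have "\<dots> = (\<Sum>l<k. b l * (\<Sum>j<k. A $$ (l, j) * adj_mat A $$ (j, m)))"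
    unfolding sum_distrib_right sum_distrib_left by (subst sum.swap) (simp add: mult.assoc)
  also have "\<dots> = b m * det A" using m by (simp add: adj_mat_sums(1)[OF A(1)] if_distrib cong: if_cong)
  finally show ?thesis using A(2) by simp
qed

lemma Parabolic_iff:
  "A \<in> Parabolic n k \<longleftrightarrow> A \<in> carrier (SL n) \<and> (\<forall>i j. k \<le> i \<and> i < n \<and> j < k \<longrightarrow> A $$ (i, j) = 0)"
  by (simp add: Parabolic_def)

text \<open>The matrix is block upper triangular of determinant 1, so both diagonal blocks are
  invertible.\<close>

lemma Parabolic_topleft:
  assumes "A \<in> Parabolic n k" "k \<le> n"
  shows "det (topleft k A) \<noteq> 0"
proof -
  have A: "A \<in> carrier_mat n n" "det A = 1" "\<And>i j. k \<le> i \<Longrightarrow> i < n \<Longrightarrow> j < k \<Longrightarrow> A $$ (i, j) = 0"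
    using assms(1) by (auto simp: Parabolic_iff carrier_SL_iff)
  define B where "B = mat k (n - k) (\<lambda>(i, j). A $$ (i, j + k))"
  define D where "D = mat (n - k) (n - k) (\<lambda>(i, j). A $$ (i + k, j + k))"
  have "A = four_block_mat (topleft k A) B (0\<^sub>m (n - k) k) D"
    using A assms(2) by (intro eq_matI) (auto simp: topleft_def B_def D_def)
  then have "det A = det (topleft k A) * det D"
    using det_four_block_mat_lower_left_zero[of "topleft k A" k B "n - k" "0\<^sub>m (n - k) k" D]
    by (simp add: B_def D_def)
  then show ?thesis using A(2) by auto
qed

lemma Parabolic_mult:
  assumes A: "A \<in> Parabolic n k" and B: "B \<in> Parabolic n k"
  shows "A * B \<in> Parabolic n k"
  unfolding Parabolic_iff
proof (intro conjI allI impI)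
  have c: "A \<in> carrier (SL n)" "B \<in> carrier (SL n)" using A B by (auto simp: Parabolic_iff)
  then show "A * B \<in> carrier (SL n)" by (rule SL_mult_closed)
  fix i j assume ij: "k \<le> i \<and> i < n \<and> j < k"
  have "A $$ (i, l) * B $$ (l, j) = 0" if "l < n" for l
    using A B ij that by (cases "l < k") (auto simp: Parabolic_iff)
  then have "(\<Sum>l<n. A $$ (i, l) * B $$ (l, j)) = 0" by (intro sum.neutral) simp
  moreover have "j < n" using ij by simp
  ultimately show "(A * B) $$ (i, j) = 0"
    using ij mult_entry[OF c[THEN SL_carrier_mat]] by simp
qed

text \<open>The lower left block of the inverse, multiplied by the invertible top left block of
  \<open>A\<close>, is the lower left block of the identity, that is 0.\<close>

lemma Parabolic_inv:
  assumes A: "A \<in> Parabolic n k" and k: "k \<le> n"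
  shows "inv\<^bsub>SL n\<^esub> A \<in> Parabolic n k"
  unfolding Parabolic_iff
proof (intro conjI allI impI)
  have c: "A \<in> carrier (SL n)" using A by (auto simp: Parabolic_iff)
  then show inv: "inv\<^bsub>SL n\<^esub> A \<in> carrier (SL n)" by (rule SL.inv_closed)
  fix i m assume im: "k \<le> i \<and> i < n \<and> m < k"
  show "(inv\<^bsub>SL n\<^esub> A) $$ (i, m) = 0"
  proof (rule left_kernel_trivial[OF topleft_carrier Parabolic_topleft[OF A k]])
    fix j assume j: "j < k"
    have "0 = (inv\<^bsub>SL n\<^esub> A * A) $$ (i, j)" using SL_inv_mult[OF c] im j k by simp
    also have "\<dots> = (\<Sum>l<n. (inv\<^bsub>SL n\<^esub> A) $$ (i, l) * A $$ (l, j))"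
      using im j k by (intro mult_entry[OF SL_carrier_mat[OF inv] SL_carrier_mat[OF c]]) auto
    also have "\<dots> = (\<Sum>l<k. (inv\<^bsub>SL n\<^esub> A) $$ (i, l) * A $$ (l, j))"
      using A j k by (intro sum.mono_neutral_right) (auto simp: Parabolic_iff)
    finally show "(\<Sum>l<k. (inv\<^bsub>SL n\<^esub> A) $$ (i, l) * topleft k A $$ (l, j)) = 0"
      using j by (simp add: topleft_def)
  qed (use im in auto)
qed

lemma subgroup_Parabolic: "k \<le> n \<Longrightarrow> subgroup (Parabolic n k) (SL n)"
proof (rule SL.subgroupI)
  show "Parabolic n k \<subseteq> carrier (SL n)" by (auto simp: Parabolic_iff)
  show "Parabolic n k \<noteq> {}"
    by (rule ex_in_conv[THEN iffD1], rule exI[of _ "1\<^sub>m n"]) (auto simp: Parabolic_iff carrier_SL_iff)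
qed (auto intro: Parabolic_inv Parabolic_mult)

text \<open>As the intersection of all standard parabolic subgroups, the Borel subgroup inherits
  closure under products and inverses.\<close>

lemma Borel_eq: "Borel n = {A \<in> carrier (SL n). \<forall>k\<le>n. A \<in> Parabolic n k}"
proof (intro Set.equalityI subsetI)
  fix A assume "A \<in> {A \<in> carrier (SL n). \<forall>k\<le>n. A \<in> Parabolic n k}"
  then have A: "A \<in> carrier (SL n)" "\<And>k. k \<le> n \<Longrightarrow> A \<in> Parabolic n k" by auto
  have "A $$ (i, j) = 0" if "j < i" "i < n" for i j
    using A(2)[of i] that by (auto simp: Parabolic_iff)
  then show "A \<in> Borel n" using A(1) by (auto simp: Borel_def carrier_SL_iff)
qed (auto simp: Borel_def Parabolic_iff carrier_SL_iff)

lemma Borel_mult: "A \<in> Borel n \<Longrightarrow> B \<in> Borel n \<Longrightarrow> A * B \<in> Borel n"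
  by (auto simp: Borel_eq SL_mult_closed Parabolic_mult)

lemma Borel_inv: "A \<in> Borel n \<Longrightarrow> inv\<^bsub>SL n\<^esub> A \<in> Borel n"
  by (auto simp: Borel_eq Parabolic_inv)

lemma Borel_SL: "A \<in> Borel n \<Longrightarrow> A \<in> carrier (SL n)"
  by (simp add: Borel_def)

lemma Borel_entry: "A \<in> Borel n \<Longrightarrow> j < i \<Longrightarrow> i < n \<Longrightarrow> A $$ (i, j) = 0"
  by (auto simp: Borel_def carrier_SL_iff)

section \<open>Polynomial functions on matrices\<close>

lemma poly_fun_sum:
  assumes "\<And>k. k \<in> K \<Longrightarrow> f k \<in> poly_fun n"
  shows "(\<lambda>A. \<Sum>k\<in>K. f k A) \<in> poly_fun n"
  using assms by (induction K rule: infinite_finite_induct) (auto intro: poly_fun.intros)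

lemma poly_fun_prod:
  assumes "\<And>k. k \<in> K \<Longrightarrow> f k \<in> poly_fun n"
  shows "(\<lambda>A. \<Prod>k\<in>K. f k A) \<in> poly_fun n"
  using assms by (induction K rule: infinite_finite_induct) (auto intro: poly_fun.intros)

lemma poly_fun_det:
  assumes "\<And>i j. i < k \<Longrightarrow> j < k \<Longrightarrow> M i j \<in> poly_fun n"
  shows "(\<lambda>A. det (mat k k (\<lambda>(i, j). M i j A))) \<in> poly_fun n"
proof -
  have "det (mat k k (\<lambda>(i, j). M i j A)) =
     (\<Sum>p\<in>{p. p permutes {0..<k}}. signof p * (\<Prod>i\<in>{0..<k}. M i (p i) A))" for A
  proof -
    have "mat k k (\<lambda>(i, j). M i j A) $$ (i, p i) = M i (p i) A"
      if "p permutes {0..<k}" "i \<in> {0..<k}" for p i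
      using permutes_in_image[OF that(1), of i] that(2) by simp
    then have "(\<Prod>i\<in>{0..<k}. mat k k (\<lambda>(i, j). M i j A) $$ (i, p i)) = (\<Prod>i\<in>{0..<k}. M i (p i) A)"
      if "p permutes {0..<k}" for p using that by (intro prod.cong) auto
    then show ?thesis by (subst det_def'[of _ k]) (auto intro!: sum.cong)
  qed
  moreover have "(\<lambda>A. \<Sum>p\<in>{p. p permutes {0..<k}}. signof p * (\<Prod>i\<in>{0..<k}. M i (p i) A)) \<in> poly_fun n"
    using assms permutes_in_image[of _ "{0..<k}"]
    by (intro poly_fun_sum poly_fun.mult poly_fun.const poly_fun_prod) auto
  ultimately show ?thesis by simp
qed

text \<open>Charts around other points are translates of the big cell, so polynomials have to be
  translated as well. Agreement is claimed on matrices of the right size, where the formula for the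
  entries of \<open>h * A\<close> is valid.\<close>

lemma poly_fun_left_mult:
  assumes "f \<in> poly_fun n" "h \<in> carrier_mat n n"
  shows "\<exists>f'\<in>poly_fun n. \<forall>A\<in>carrier_mat n n. f' A = f (h * A)"
  using assms(1)
proof (induction rule: poly_fun.induct)
  case (const c)
  then show ?case by (intro bexI[of _ "\<lambda>_. c"] poly_fun.const) simp
next
  case (entry i j)
  then have "(\<lambda>A. \<Sum>l<n. h $$ (i, l) * A $$ (l, j)) \<in> poly_fun n"
    by (intro poly_fun_sum poly_fun.mult poly_fun.const poly_fun.entry) auto
  then show ?case using entry assms(2)
    by (intro bexI[of _ "\<lambda>A. \<Sum>l<n. h $$ (i, l) * A $$ (l, j)"]) (auto simp del: index_mult_mat simp: mult_entry)
next
  case (add f g)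
  then obtain f' g' where "f' \<in> poly_fun n" "\<forall>A\<in>carrier_mat n n. f' A = f (h * A)"
    "g' \<in> poly_fun n" "\<forall>A\<in>carrier_mat n n. g' A = g (h * A)" by blast
  then show ?case by (intro bexI[of _ "\<lambda>A. f' A + g' A"] poly_fun.add) auto
next
  case (mult f g)
  then obtain f' g' where "f' \<in> poly_fun n" "\<forall>A\<in>carrier_mat n n. f' A = f (h * A)"
    "g' \<in> poly_fun n" "\<forall>A\<in>carrier_mat n n. g' A = g (h * A)" by blast
  then show ?case by (intro bexI[of _ "\<lambda>A. f' A * g' A"] poly_fun.mult) auto
qed

lemma poly_fun_compose:
  assumes "f \<in> poly_fun n" "\<And>i j. i < n \<Longrightarrow> j < n \<Longrightarrow> (\<lambda>z. M z $$ (i, j)) \<in> mpoly_fun I"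
  shows "(\<lambda>z. f (M z)) \<in> mpoly_fun I"
  using assms by (induction rule: poly_fun.induct) (auto intro: mpoly_fun.intros)

lemma poly_fun_tendsto:
  assumes "f \<in> poly_fun n" "\<And>i j. i < n \<Longrightarrow> j < n \<Longrightarrow> ((\<lambda>t. M t $$ (i, j)) \<longlongrightarrow> A $$ (i, j)) F"
  shows "((\<lambda>t. f (M t)) \<longlongrightarrow> f A) F"
  using assms by (induction rule: poly_fun.induct) (auto intro: tendsto_intros)

lemma (in function_space) reg_mpoly_fun:
  assumes "openin (fs_top X) U" "p \<in> mpoly_fun I" "\<And>i. i \<in> I \<Longrightarrow> y i \<in> fs_reg X U"
  shows "(\<lambda>v. p (\<lambda>i. y i v)) \<in> fs_reg X U"
  using assms(2,3)
  by (induction rule: mpoly_fun.induct) (auto intro: reg_const reg_add reg_mult assms(1))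

lemma zariski_nhd:
  assumes "openin (zariski_SL n) U" "A \<in> U"
  obtains p where "p \<in> poly_fun n" "p A \<noteq> 0" "\<And>B. B \<in> carrier (SL n) \<Longrightarrow> p B \<noteq> 0 \<Longrightarrow> B \<in> U"
proof -
  from assms(1) obtain F where F: "F \<subseteq> poly_fun n" "U = {A \<in> carrier (SL n). \<exists>f\<in>F. f A \<noteq> 0}"
    unfolding openin_zariski_SL by (elim exE conjE)
  from assms(2) F(2) obtain f where "f \<in> F" "f A \<noteq> 0" by auto
  then show ?thesis using that[of f] F by auto
qed

section \<open>The big cell and its translates\<close>

locale grassmannian =
  fixes n d :: nat
  assumes d_pos: "1 \<le> d" and d_less: "d < n"
begin

abbreviation SLn :: "complex mat set" where "SLn \<equiv> carrier (SL n)"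

abbreviation minv :: "complex mat \<Rightarrow> complex mat" where "minv g \<equiv> inv\<^bsub>SL n\<^esub> g"

abbreviation proj :: "complex mat \<Rightarrow> complex mat set" where
  "proj g \<equiv> g <#\<^bsub>SL n\<^esub> Parabolic n d"

abbreviation Gr :: "complex mat set fspace" where "Gr \<equiv> Grassmannian n d"

sublocale Gr: function_space Gr
  unfolding Grassmannian_def by (intro function_space_quotient function_space_SL)

lemma subgroup_P: "subgroup (Parabolic n d) (SL n)"
  using subgroup_Parabolic d_less by simp

lemma P_SL: "p \<in> Parabolic n d \<Longrightarrow> p \<in> SLn"
  by (simp add: Parabolic_iff)

lemma mem_proj: "h \<in> proj g \<longleftrightarrow> (\<exists>p\<in>Parabolic n d. h = g * p)"
  by (auto simp: l_coset_def)

lemma proj_self: "g \<in> SLn \<Longrightarrow> g \<in> proj g"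
  using subgroup.one_closed[OF subgroup_P] unfolding mem_proj
  by (intro bexI[of _ "1\<^sub>m n"]) (auto simp: carrier_SL_iff)

lemma proj_mult_P: "g \<in> SLn \<Longrightarrow> p \<in> Parabolic n d \<Longrightarrow> proj (g * p) = proj g"
  using SL.l_repr_independence[of "g * p" n g, OF _ _ subgroup_P] by (simp add: mem_proj) blast

lemma proj_eqE:
  assumes "g \<in> SLn" "proj g = proj h"
  obtains p where "p \<in> Parabolic n d" "g = h * p"
  using proj_self[OF assms(1)] assms(2) mem_proj by auto

lemma proj_left_mult:
  assumes "b \<in> SLn" "g \<in> SLn"
  shows "b <#\<^bsub>SL n\<^esub> proj g = proj (b * g)"
  using SL.lcos_m_assoc[OF subgroup.subset[OF subgroup_P] assms] by simp

lemma topspace_Gr: "topspace (fs_top Gr) = proj ` SLn"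
proof
  show "topspace (fs_top Gr) \<subseteq> proj ` SLn"
    using openin_topspace[of "fs_top Gr"]
    unfolding Grassmannian_def openin_quotient_fspace topspace_SL_variety by (rule conjunct1)
  have "{x \<in> SLn. proj x \<in> proj ` SLn} = SLn" by auto
  then have "openin (fs_top Gr) (proj ` SLn)"
    using openin_topspace[of "zariski_SL n"]
    unfolding Grassmannian_def openin_quotient_fspace topspace_SL_variety
    by (simp add: SL_variety_def topspace_zariski_SL)
  then show "proj ` SLn \<subseteq> topspace (fs_top Gr)" by (rule openin_subset)
qed

lemma openin_Gr: "openin (fs_top Gr) V \<longleftrightarrow> V \<subseteq> proj ` SLn \<and>
    openin (zariski_SL n) {g \<in> SLn. proj g \<in> V}"
  unfolding Grassmannian_def openin_quotient_fspace topspace_SL_variety by (simp add: SL_variety_def)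

lemma reg_Gr: "f \<in> fs_reg Gr V \<longleftrightarrow>
    (\<lambda>g. f (proj g)) \<in> fs_reg (SL_variety n) {g \<in> SLn. proj g \<in> V}"
  unfolding Grassmannian_def quotient_fspace_def by (simp add: o_def topspace_SL_variety)

abbreviation idx :: "(nat \<times> nat) set" where "idx \<equiv> {d..<n} \<times> {..<d}"

text \<open>The unipotent matrices that parametrize the big cell.\<close>

definition \<sigma> :: "(nat \<times> nat \<Rightarrow> complex) \<Rightarrow> complex mat" where
  "\<sigma> a = mat n n (\<lambda>(i, j). if i = j then 1 else if (i, j) \<in> idx then a (i, j) else 0)"

lemma \<sigma>_carrier: "\<sigma> a \<in> carrier_mat n n"
  by (simp add: \<sigma>_def)

lemma \<sigma>_entry: "i < n \<Longrightarrow> j < n \<Longrightarrow>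
    \<sigma> a $$ (i, j) = (if i = j then 1 else if (i, j) \<in> idx then a (i, j) else 0)"
  by (simp add: \<sigma>_def)

lemma \<sigma>_SL: "\<sigma> a \<in> SLn"
proof -
  have "det (\<sigma> a) = prod_list (diag_mat (\<sigma> a))"
    by (rule det_lower_triangular[OF _ \<sigma>_carrier]) (auto simp: \<sigma>_def)
  also have "diag_mat (\<sigma> a) = replicate n 1"
    by (rule nth_equalityI) (auto simp: diag_mat_def \<sigma>_def)
  finally show ?thesis using \<sigma>_carrier by (simp add: carrier_SL_iff)
qed

lemma \<sigma>_mult_entry:
  assumes "g \<in> carrier_mat n n" "i < n" "j < n"
  shows "(\<sigma> a * g) $$ (i, j) = g $$ (i, j) + (if d \<le> i then \<Sum>k<d. a (i, k) * g $$ (k, j) else 0)"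
proof -
  have "(\<sigma> a * g) $$ (i, j) = (\<Sum>k<n. \<sigma> a $$ (i, k) * g $$ (k, j))"
    using assms \<sigma>_carrier by (intro mult_entry) auto
  also have "\<dots> = (\<Sum>k<n. (if k = i then g $$ (k, j) else 0) +
      (if k \<in> {k\<in>{..<d}. d \<le> i} then a (i, k) * g $$ (k, j) else 0))"
    using assms by (intro sum.cong) (auto simp: \<sigma>_def)
  also have "\<dots> = g $$ (i, j) + (\<Sum>k\<in>{k\<in>{..<d}. d \<le> i}. a (i, k) * g $$ (k, j))"
    using assms d_less unfolding sum.distrib
    by (subst sum.inter_restrict[symmetric]) (auto intro!: sum.cong)
  also have "{k\<in>{..<d}. d \<le> i} = (if d \<le> i then {..<d} else {})" by auto
  finally show ?thesis by simp
qed

text \<open>\<open>\<sigma>\<close> turns addition into multiplication: inverses are negatives, and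
  moving the centre of a chart is a shift of coordinates.\<close>

lemma \<sigma>_mult: "\<sigma> a * \<sigma> b = \<sigma> (\<lambda>k. a k + b k)"
proof (rule eq_matI)
  fix i j assume "i < dim_row (\<sigma> (\<lambda>k. a k + b k))" "j < dim_col (\<sigma> (\<lambda>k. a k + b k))"
  then have ij: "i < n" "j < n" by (simp_all add: \<sigma>_def)
  have *: "(\<Sum>k<d. a (i, k) * \<sigma> b $$ (k, j)) = (if j < d then a (i, j) else 0)"
  proof -
    have "(\<Sum>k<d. a (i, k) * \<sigma> b $$ (k, j)) = (\<Sum>k<d. if k = j then a (i, k) else 0)"
      using ij d_less by (intro sum.cong) (auto simp: \<sigma>_def)
    then show ?thesis by simp
  qed
  show "(\<sigma> a * \<sigma> b) $$ (i, j) = \<sigma> (\<lambda>k. a k + b k) $$ (i, j)"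
    unfolding \<sigma>_mult_entry[OF \<sigma>_carrier ij] * using ij by (auto simp: \<sigma>_entry)
qed (simp_all add: \<sigma>_def)

lemma \<sigma>_0: "\<sigma> (\<lambda>_. 0) = 1\<^sub>m n"
  by (rule eq_matI) (auto simp: \<sigma>_def)

lemma \<sigma>_cong: "(\<And>i. i \<in> idx \<Longrightarrow> a i = b i) \<Longrightarrow> \<sigma> a = \<sigma> b"
  by (rule eq_matI) (auto simp: \<sigma>_def)

text \<open>The leading Pluecker coordinate; it is nonzero exactly over the big cell.\<close>

definition \<Delta> :: "complex mat \<Rightarrow> complex" where "\<Delta> g = det (topleft d g)"

text \<open>Divided by \<open>\<Delta>\<close> this is the product of the lower left block with the
  inverse of the top left block, by Cramer's rule. The quotient is unchanged by \<open>P\<close> and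
  gives the chart coordinates.\<close>

definition num :: "nat \<times> nat \<Rightarrow> complex mat \<Rightarrow> complex" where
  "num = (\<lambda>(i, j) g. \<Sum>k<d. g $$ (i, k) * adj_mat (topleft d g) $$ (k, j))"

lemma \<Delta>_poly: "\<Delta> \<in> poly_fun n"
  unfolding \<Delta>_def[abs_def] topleft_def
  by (rule poly_fun_det) (use d_less in \<open>auto intro: poly_fun.entry\<close>)

lemma num_poly: "i \<in> idx \<Longrightarrow> num i \<in> poly_fun n"
proof -
  assume i: "i \<in> idx"
  have "(\<lambda>g. cofactor (topleft d g) j k) \<in> poly_fun n" if "k < d" "j < d" for j k
  proof -
    have "(\<lambda>g. cofactor (topleft d g) j k) = (\<lambda>g. (-1) ^ (j + k) * det (mat (d - 1) (d - 1)
       (\<lambda>(i', j'). g $$ (if i' < j then i' else Suc i', if j' < k then j' else Suc j'))))"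
      unfolding cofactor_def mat_delete_def topleft_def
      by (intro ext arg_cong2[of _ _ _ _ "(*)"] arg_cong[of _ _ det] refl eq_matI) auto
    also have "\<dots> \<in> poly_fun n"
      by (intro poly_fun.mult poly_fun.const poly_fun_det poly_fun.entry) (use d_less in auto)
    finally show ?thesis .
  qed
  moreover have "adj_mat (topleft d g) $$ (k, j) = cofactor (topleft d g) j k" if "k < d" "j < d" for g :: "complex mat" and j k
    using that by (simp add: adj_mat_def topleft_def)
  ultimately have "(\<lambda>g. adj_mat (topleft d g) $$ (k, j)) \<in> poly_fun n" if "k < d" "j < d" for j k
    using that by simp
  then show ?thesis using i d_less
    unfolding num_def by (auto intro!: poly_fun_sum poly_fun.mult poly_fun.entry)
qed

lemma \<Delta>_\<sigma>_mult:
  assumes "p \<in> Parabolic n d"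
  shows "\<Delta> (\<sigma> a * p) = \<Delta> p" "\<Delta> (\<sigma> a * p) \<noteq> 0"
proof -
  have p: "p \<in> carrier_mat n n" using P_SL[OF assms] SL_carrier_mat by blast
  have "topleft d (\<sigma> a * p) = topleft d p"
    by (rule eq_matI) (use d_less in \<open>auto simp: topleft_def \<sigma>_mult_entry[OF p]
      simp del: index_mult_mat(1)\<close>)
  then show "\<Delta> (\<sigma> a * p) = \<Delta> p" by (simp add: \<Delta>_def)
  then show "\<Delta> (\<sigma> a * p) \<noteq> 0" using Parabolic_topleft[OF assms] d_less by (simp add: \<Delta>_def)
qed

lemma num_\<sigma>_mult:
  assumes "p \<in> Parabolic n d" "ij \<in> idx"
  shows "num ij (\<sigma> a * p) = a ij * \<Delta> (\<sigma> a * p)"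
proof -
  obtain i j where ij: "ij = (i, j)" "d \<le> i" "i < n" "j < d" using assms(2) by auto
  have p: "p \<in> carrier_mat n n" using P_SL[OF assms(1)] SL_carrier_mat by blast
  have tl: "topleft d (\<sigma> a * p) = topleft d p"
    by (rule eq_matI) (use d_less in \<open>auto simp: topleft_def \<sigma>_mult_entry[OF p]
      simp del: index_mult_mat(1)\<close>)
  let ?A = "topleft d p"
  have "num ij (\<sigma> a * p) = (\<Sum>k<d. (\<Sum>l<d. a (i, l) * ?A $$ (l, k)) * adj_mat ?A $$ (k, j))"
    unfolding num_def ij tl prod.case
  proof (rule sum.cong[OF refl])
    fix k assume k: "k \<in> {..<d}"
    then have "p $$ (i, k) = 0" using assms(1) ij by (auto simp: Parabolic_iff)
    then have "(\<sigma> a * p) $$ (i, k) = (\<Sum>l<d. a (i, l) * ?A $$ (l, k))"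
      using k ij d_less by (simp add: \<sigma>_mult_entry[OF p] topleft_def del: index_mult_mat(1))
    then show "(\<sigma> a * p) $$ (i, k) * adj_mat ?A $$ (k, j)
        = (\<Sum>l<d. a (i, l) * ?A $$ (l, k)) * adj_mat ?A $$ (k, j)" by (simp only:)
  qed
  also have "\<dots> = (\<Sum>l<d. a (i, l) * (\<Sum>k<d. ?A $$ (l, k) * adj_mat ?A $$ (k, j)))"
    unfolding sum_distrib_right sum_distrib_left by (subst sum.swap) (simp add: mult.assoc)
  also have "\<dots> = (\<Sum>l<d. a (i, l) * (if l = j then \<Delta> p else 0))"
    using ij adj_mat_sums(1)[OF topleft_carrier[of d p]] by (intro sum.cong) (auto simp: \<Delta>_def)
  also have "\<dots> = a ij * \<Delta> p" using ij by (simp add: if_distrib cong: if_cong)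
  finally show ?thesis using \<Delta>_\<sigma>_mult(1)[OF assms(1)] by simp
qed

text \<open>Subtracting from the lower rows the combinations of the top rows with coefficients
  \<open>num / \<Delta>\<close> clears the lower left block of \<open>g\<close>; what remains lies
  in \<open>P\<close>.\<close>

lemma big_cell:
  assumes g: "g \<in> SLn" "\<Delta> g \<noteq> 0"
  shows "\<exists>p\<in>Parabolic n d. g = \<sigma> (\<lambda>ij. num ij g / \<Delta> g) * p"
proof -
  define a where "a ij = num ij g / \<Delta> g" for ij
  have gc: "g \<in> carrier_mat n n" using g by (simp add: carrier_SL_iff)
  let ?A = "topleft d g"
  define p where "p = \<sigma> (\<lambda>ij. - a ij) * g"
  have "p $$ (i, j) = 0" if ij: "d \<le> i" "i < n" "j < d" for i j
  proof -
    have "(\<Sum>k<d. num (i, k) g * g $$ (k, j)) =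
        (\<Sum>k<d. (\<Sum>l<d. g $$ (i, l) * adj_mat ?A $$ (l, k)) * ?A $$ (k, j))"
      using ij by (simp add: num_def topleft_def)
    also have "\<dots> = (\<Sum>l<d. g $$ (i, l) * (\<Sum>k<d. adj_mat ?A $$ (l, k) * ?A $$ (k, j)))"
      unfolding sum_distrib_right sum_distrib_left by (subst sum.swap) (simp add: mult.assoc)
    also have "\<dots> = (\<Sum>l<d. g $$ (i, l) * (if l = j then \<Delta> g else 0))"
      using ij adj_mat_sums(2)[OF topleft_carrier[of d g]] by (intro sum.cong) (auto simp: \<Delta>_def)
    also have "\<dots> = g $$ (i, j) * \<Delta> g" using ij by (simp add: if_distrib cong: if_cong)
    finally have "(\<Sum>k<d. - a (i, k) * g $$ (k, j)) = - g $$ (i, j)"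
      using g(2) by (simp add: a_def sum_negf divide_inverse mult.commute mult.left_commute
          flip: sum_distrib_left)
    then show ?thesis using ij d_less by (simp add: p_def \<sigma>_mult_entry[OF gc] del: index_mult_mat(1))
  qed
  then have "p \<in> Parabolic n d" using SL_mult_closed[OF \<sigma>_SL g(1)] by (auto simp: Parabolic_iff p_def)
  moreover have "g = \<sigma> a * p"
    unfolding p_def by (subst SL_assoc[OF \<sigma>_SL \<sigma>_SL g(1), symmetric])
      (simp add: \<sigma>_mult \<sigma>_0 SL_one_mult[OF g(1)])
  ultimately show ?thesis unfolding a_def[abs_def] by blast
qed

text \<open>The big cell translated by the inverse of \<open>h\<close>; taking for \<open>h\<close>
  the inverse of \<open>g\<close> centres the chart at the coset of \<open>g\<close>.\<close>

definition chart_dom :: "complex mat \<Rightarrow> complex mat set set" where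
  "chart_dom h = {proj g | g. g \<in> SLn \<and> \<Delta> (h * g) \<noteq> 0}"

definition coord :: "complex mat \<Rightarrow> nat \<times> nat \<Rightarrow> complex mat set \<Rightarrow> complex" where
  "coord h ij C = (let g = (SOME g. g \<in> SLn \<and> proj g = C) in num ij (h * g) / \<Delta> (h * g))"

text \<open>If \<open>h * g = \<sigma> a * q\<close> with \<open>q\<close> in \<open>P\<close>,
  another representative \<open>g * p\<close> gives \<open>\<sigma> a * (q * p)\<close> with the
  same \<open>a\<close>. Hence the choice made by \<open>SOME\<close> in \<open>coord\<close> does
  not matter.\<close>

lemma chart_invariant:
  assumes h: "h \<in> SLn" and g: "g \<in> SLn" "g' \<in> SLn"
    "proj g = proj g'" "\<Delta> (h * g) \<noteq> 0"
  shows "\<Delta> (h * g') \<noteq> 0"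
    "ij \<in> idx \<Longrightarrow> num ij (h * g') / \<Delta> (h * g') = num ij (h * g) / \<Delta> (h * g)"
proof -
  obtain p where p: "p \<in> Parabolic n d" "g' = g * p" using proj_eqE[OF g(2) g(3)[symmetric]] by blast
  define a where "a = (\<lambda>ij. num ij (h * g) / \<Delta> (h * g))"
  obtain q where q: "q \<in> Parabolic n d" "h * g = \<sigma> a * q"
    using big_cell[OF SL_mult_closed[OF h g(1)] g(4)] by (auto simp: a_def)
  have qp: "q * p \<in> Parabolic n d" using Parabolic_mult p q by blast
  have eq: "h * g' = \<sigma> a * (q * p)"
    using SL_assoc[OF h g(1) P_SL[OF p(1)]] SL_assoc[OF \<sigma>_SL P_SL[OF q(1)] P_SL[OF p(1)]] p q by simp
  show "\<Delta> (h * g') \<noteq> 0" unfolding eq by (rule \<Delta>_\<sigma>_mult(2)[OF qp])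
  then show "num ij (h * g') / \<Delta> (h * g') = num ij (h * g) / \<Delta> (h * g)" if "ij \<in> idx"
    unfolding eq num_\<sigma>_mult[OF qp that] by (simp add: a_def)
qed

lemma mem_chart_dom:
  assumes "h \<in> SLn" "g \<in> SLn"
  shows "proj g \<in> chart_dom h \<longleftrightarrow> \<Delta> (h * g) \<noteq> 0"
  using chart_invariant(1)[OF assms(1) _ assms(2)] assms(2) by (auto simp: chart_dom_def)

lemma coord_proj:
  assumes "h \<in> SLn" "g \<in> SLn" "\<Delta> (h * g) \<noteq> 0" "ij \<in> idx"
  shows "coord h ij (proj g) = num ij (h * g) / \<Delta> (h * g)"
proof -
  define g' where "g' = (SOME g'. g' \<in> SLn \<and> proj g' = proj g)"
  have "g' \<in> SLn \<and> proj g' = proj g"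
    unfolding g'_def by (rule someI[of _ g]) (simp add: assms(2))
  then show ?thesis
    using chart_invariant(2)[OF assms(1,2) _ _ assms(3,4), of g']
    by (simp add: coord_def Let_def flip: g'_def)
qed

lemma openin_chart_dom:
  assumes h: "h \<in> SLn"
  shows "openin (fs_top Gr) (chart_dom h)"
proof -
  obtain D where D: "D \<in> poly_fun n" "\<forall>A\<in>carrier_mat n n. D A = \<Delta> (h * A)"
    using poly_fun_left_mult[OF \<Delta>_poly SL_carrier_mat[OF h]] by blast
  have "{g \<in> SLn. proj g \<in> chart_dom h} = {g \<in> SLn. D g \<noteq> 0}"
    using mem_chart_dom[OF h] D(2) by (auto simp: carrier_SL_iff)
  then show ?thesis using openin_zariski_nonzero[OF D(1)] by (auto simp: openin_Gr chart_dom_def)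
qed

lemma coord_reg:
  assumes h: "h \<in> SLn" and ij: "ij \<in> idx"
  shows "coord h ij \<in> fs_reg Gr (chart_dom h)"
proof -
  obtain D where D: "D \<in> poly_fun n" "\<forall>A\<in>carrier_mat n n. D A = \<Delta> (h * A)"
    using poly_fun_left_mult[OF \<Delta>_poly SL_carrier_mat[OF h]] by blast
  obtain N where N: "N \<in> poly_fun n" "\<forall>A\<in>carrier_mat n n. N A = num ij (h * A)"
    using poly_fun_left_mult[OF num_poly[OF ij] SL_carrier_mat[OF h]] by blast
  let ?V = "{g \<in> SLn. proj g \<in> chart_dom h}"
  have "openin (zariski_SL n) ?V" using openin_chart_dom[OF h] by (simp add: openin_Gr)
  moreover have "\<forall>y\<in>?V. D y \<noteq> 0 \<and> coord h ij (proj y) = N y / D y"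
    using coord_proj[OF h _ _ ij] mem_chart_dom[OF h] D(2) N(2) by (auto simp: carrier_SL_iff)
  ultimately show ?thesis unfolding reg_Gr fs_reg_SL
    by (intro ballI exI[of _ ?V] conjI bexI[of _ N] bexI[of _ D] N(1) D(1)) auto
qed

lemma chart_\<sigma>:
  assumes g: "g \<in> SLn"
  shows "proj (g * \<sigma> a) \<in> chart_dom (minv g)"
    "ij \<in> idx \<Longrightarrow> coord (minv g) ij (proj (g * \<sigma> a)) = a ij"
proof -
  have h: "minv g \<in> SLn" using g by simp
  have one: "1\<^sub>m n \<in> Parabolic n d" using subgroup.one_closed[OF subgroup_P] by simp
  have eq: "minv g * (g * \<sigma> a) = \<sigma> a * 1\<^sub>m n"
    unfolding SL_cancel_left[OF g \<sigma>_SL] SL_mult_one[OF \<sigma>_SL] ..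
  have nz: "\<Delta> (minv g * (g * \<sigma> a)) \<noteq> 0" unfolding eq by (rule \<Delta>_\<sigma>_mult(2)[OF one])
  have gs: "g * \<sigma> a \<in> SLn" by (rule SL_mult_closed[OF g \<sigma>_SL])
  show "proj (g * \<sigma> a) \<in> chart_dom (minv g)" using mem_chart_dom[OF h gs] nz by simp
  show "coord (minv g) ij (proj (g * \<sigma> a)) = a ij" if "ij \<in> idx"
    using coord_proj[OF h gs nz that] nz unfolding eq num_\<sigma>_mult[OF one that] by simp
qed

lemma chart_surj:
  assumes g: "g \<in> SLn" and v: "v \<in> chart_dom (minv g)"
  shows "v = proj (g * \<sigma> (\<lambda>ij. coord (minv g) ij v))"
proof -
  let ?h = "minv g"
  have h: "?h \<in> SLn" using g by simp
  obtain x where x: "x \<in> SLn" "v = proj x" "\<Delta> (?h * x) \<noteq> 0" using v by (auto simp: chart_dom_def)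
  obtain p where p: "p \<in> Parabolic n d" "?h * x = \<sigma> (\<lambda>ij. num ij (?h * x) / \<Delta> (?h * x)) * p"
    using big_cell[OF SL_mult_closed[OF h x(1)] x(3)] by blast
  have "\<sigma> (\<lambda>ij. num ij (?h * x) / \<Delta> (?h * x)) = \<sigma> (\<lambda>ij. coord ?h ij v)"
    using coord_proj[OF h x(1,3)] x(2) by (intro \<sigma>_cong) simp
  then have "?h * x = \<sigma> (\<lambda>ij. coord ?h ij v) * p" using p(2) by simp
  then have "g * (?h * x) = (g * \<sigma> (\<lambda>ij. coord ?h ij v)) * p"
    unfolding SL_assoc[OF g \<sigma>_SL P_SL[OF p(1)]] by simp
  then have "x = (g * \<sigma> (\<lambda>ij. coord ?h ij v)) * p" using SL_cancel_right[OF g x(1)] by simp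
  with proj_mult_P[OF SL_mult_closed[OF g \<sigma>_SL] p(1)] x(2) show ?thesis by (simp only:)
qed

lemma poly_fun_\<sigma>:
  assumes "f \<in> poly_fun n" "g \<in> SLn"
  shows "(\<lambda>a. f (g * \<sigma> a)) \<in> mpoly_fun idx"
proof (rule poly_fun_compose[OF assms(1)])
  fix i j assume ij: "i < n" "j < n"
  have "(\<lambda>a. (g * \<sigma> a) $$ (i, j)) = (\<lambda>a. \<Sum>k<n. g $$ (i, k) * \<sigma> a $$ (k, j))"
    using ij by (intro ext mult_entry[OF SL_carrier_mat[OF assms(2)] \<sigma>_carrier])
  also have "\<dots> \<in> mpoly_fun idx"
  proof (intro mpoly_fun_sum mpoly_fun.mult mpoly_fun.const)
    fix k assume "k \<in> {..<n}"
    then have "k < n" by simp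
    note entry = \<sigma>_entry[OF this ij(2)]
    consider "k = j" | "k \<noteq> j" "(k, j) \<in> idx" | "k \<noteq> j" "(k, j) \<notin> idx" by blast
    then show "(\<lambda>a. \<sigma> a $$ (k, j)) \<in> mpoly_fun idx"
      unfolding entry by cases (simp_all only: if_True if_False refl mpoly_fun.const mpoly_fun.var)
  qed
  finally show "(\<lambda>a. (g * \<sigma> a) $$ (i, j)) \<in> mpoly_fun idx" .
qed

lemma sub_Gr_topspace: "Z \<subseteq> topspace (fs_top Gr) \<Longrightarrow> topspace (fs_top (sub_fspace Gr Z)) = Z"
  by (auto simp: sub_fspace_def)

lemma openin_sub_Gr: "openin (fs_top (sub_fspace Gr Z)) U \<longleftrightarrow> (\<exists>T. openin (fs_top Gr) T \<and> U = T \<inter> Z)"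
  by (simp add: sub_fspace_def openin_subtopology)

lemma chart_continuous:
  assumes g: "g \<in> SLn" and V: "openin (fs_top (sub_fspace Gr Z)) V" "proj g \<in> V"
  shows "\<exists>F\<in>mpoly_fun idx. F (\<lambda>_. 0) \<noteq> 0 \<and> (\<forall>a. F a \<noteq> 0 \<longrightarrow> proj (g * \<sigma> a) \<in> Z \<longrightarrow> proj (g * \<sigma> a) \<in> V)"
proof -
  obtain T where T: "openin (fs_top Gr) T" "V = T \<inter> Z" using V(1) by (auto simp: openin_sub_Gr)
  have "openin (zariski_SL n) {g \<in> SLn. proj g \<in> T}" using T(1) by (simp add: openin_Gr)
  moreover have "g \<in> {g \<in> SLn. proj g \<in> T}" using g V(2) T(2) by simp
  ultimately obtain f where f: "f \<in> poly_fun n" "f g \<noteq> 0"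
    "\<And>B. B \<in> SLn \<Longrightarrow> f B \<noteq> 0 \<Longrightarrow> B \<in> {g \<in> SLn. proj g \<in> T}"
    using zariski_nhd by blast
  show ?thesis
  proof (intro bexI[OF _ poly_fun_\<sigma>[OF f(1) g]] conjI allI impI)
    show "f (g * \<sigma> (\<lambda>_. 0)) \<noteq> 0" using f(2) SL_carrier_mat[OF g] by (simp add: \<sigma>_0)
    fix a assume "f (g * \<sigma> a) \<noteq> 0" "proj (g * \<sigma> a) \<in> Z"
    then show "proj (g * \<sigma> a) \<in> V" using f(3)[OF SL_mult_closed[OF g \<sigma>_SL]] T(2) by auto
  qed
qed

text \<open>Regularity on the quotient is witnessed by a fraction on a Zariski neighbourhood of
  \<open>g\<close> in SL. Evaluated at the representatives \<open>g * \<sigma> a\<close> it becomes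
  a fraction in the chart coordinates.\<close>

lemma chart_fraction:
  assumes g: "g \<in> SLn" and f: "f \<in> reg_at (sub_fspace Gr Z) (proj g)"
  shows "\<exists>V p q. openin (fs_top (sub_fspace Gr Z)) V \<and> proj g \<in> V \<and> p \<in> mpoly_fun idx \<and> q \<in> mpoly_fun idx \<and>
    (\<forall>a. proj (g * \<sigma> a) \<in> V \<longrightarrow> q a \<noteq> 0 \<and> f (proj (g * \<sigma> a)) = p a / q a)"
proof -
  let ?X = "sub_fspace Gr Z" and ?h = "minv g"
  have h: "?h \<in> SLn" using g by simp
  obtain U where U: "openin (fs_top ?X) U" "proj g \<in> U" "f \<in> fs_reg ?X U" using f by (auto simp: reg_at_def)
  then obtain W f' where W: "openin (fs_top Gr) W" "proj g \<in> W" "f' \<in> fs_reg Gr W" "\<forall>y\<in>W \<inter> U. f y = f' y"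
    by (auto simp: sub_fspace_def)
  have "g \<in> {g \<in> SLn. proj g \<in> W}" using g W(2) by simp
  from W(3)[unfolded reg_Gr fs_reg_SL, THEN bspec, OF this] obtain N p q where N: "openin (zariski_SL n) N" "g \<in> N" "p \<in> poly_fun n" "q \<in> poly_fun n"
    "\<forall>y\<in>N. q y \<noteq> 0 \<and> f' (proj y) = p y / q y" by blast
  obtain e where e: "e \<in> poly_fun n" "e g \<noteq> 0" "\<And>B. B \<in> SLn \<Longrightarrow> e B \<noteq> 0 \<Longrightarrow> B \<in> N"
    using zariski_nhd[OF N(1,2)] by blast
  define E where "E a = e (g * \<sigma> a)" for a
  have E: "E \<in> mpoly_fun idx" unfolding E_def[abs_def] by (rule poly_fun_\<sigma>[OF e(1) g])
  \<comment> \<open>\<open>N\<close> need not be a union of cosets. \<open>D\<close> collects the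
    chart points whose distinguished representative lies where \<open>e\<close> is nonzero, hence in
    \<open>N\<close>, and is open because \<open>E\<close> of the coordinates is a regular
    function.\<close>
  define D where "D = {v \<in> chart_dom ?h. E (\<lambda>ij. coord ?h ij v) \<noteq> 0}"
  have D: "openin (fs_top Gr) D" unfolding D_def
    by (intro Gr.openin_nonzero Gr.reg_mpoly_fun[OF _ E] openin_chart_dom[OF h] coord_reg[OF h])
  have memD: "proj (g * \<sigma> a) \<in> D \<longleftrightarrow> E a \<noteq> 0" for a
  proof -
    have "E (\<lambda>ij. coord ?h ij (proj (g * \<sigma> a))) = E a"
      by (rule mpoly_fun_cong[OF E chart_\<sigma>(2)[OF g]])
    then show ?thesis using chart_\<sigma>(1)[OF g] by (simp add: D_def)
  qed
  have g0: "g * \<sigma> (\<lambda>_. 0) = g" using SL_carrier_mat[OF g] by (simp add: \<sigma>_0)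
  have "proj g \<in> D" using memD[of "\<lambda>_. 0"] e(2) by (simp add: g0 E_def)
  obtain T where T: "openin (fs_top Gr) T" "U = T \<inter> Z" using U(1) by (auto simp: openin_sub_Gr)
  define V where "V = (T \<inter> W \<inter> D) \<inter> Z"
  have "openin (fs_top ?X) V" unfolding openin_sub_Gr V_def
    using T(1) W(1) D by (intro exI[of _ "T \<inter> W \<inter> D"] conjI openin_Int refl)
  moreover have "q (g * \<sigma> a) \<noteq> 0 \<and> f (proj (g * \<sigma> a)) = p (g * \<sigma> a) / q (g * \<sigma> a)"
    if a: "proj (g * \<sigma> a) \<in> V" for a
  proof -
    have "g * \<sigma> a \<in> N" using e(3)[OF SL_mult_closed[OF g \<sigma>_SL]] memD[of a] a by (simp add: V_def E_def)
    moreover have "f (proj (g * \<sigma> a)) = f' (proj (g * \<sigma> a))" using W(4) a T(2) by (auto simp: V_def)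
    ultimately show ?thesis using N(5) by auto
  qed
  moreover have "proj g \<in> V" using \<open>proj g \<in> D\<close> U(2) T(2) W(2) by (simp add: V_def)
  ultimately show ?thesis using poly_fun_\<sigma>[OF N(3) g] poly_fun_\<sigma>[OF N(4) g]
    by (intro exI[of _ V] exI[of _ "\<lambda>a. p (g * \<sigma> a)"] exI[of _ "\<lambda>a. q (g * \<sigma> a)"]) simp
qed

end

section \<open>Schubert varieties\<close>

text \<open>Rescaling a single column normalizes the determinant to 1; the column is chosen so that
  the shape of the matrix at hand, or its first d columns, is preserved.\<close>

definition scale_col :: "nat \<Rightarrow> nat \<Rightarrow> 'f \<Rightarrow> 'f mat \<Rightarrow> 'f :: comm_ring_1 mat" where
  "scale_col n k c A = mat n n (\<lambda>(i, j). A $$ (i, j) * (if j = k then c else 1))"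

lemma det_scale_col:
  assumes "A \<in> carrier_mat n n" "k < n"
  shows "det (scale_col n k c A) = c * det A"
proof -
  define D where "D = mat n n (\<lambda>(i, j). if i = j then if j = k then c else 1 else 0)"
  have D: "D \<in> carrier_mat n n" by (simp add: D_def)
  have "scale_col n k c A = A * D"
  proof (rule eq_matI)
    fix i j assume "i < dim_row (A * D)" "j < dim_col (A * D)"
    then have ij: "i < n" "j < n" using assms D by auto
    have "(A * D) $$ (i, j) = (\<Sum>l<n. if l = j then A $$ (i, j) * (if j = k then c else 1) else 0)"
      unfolding mult_entry[OF assms(1) D ij] using ij by (intro sum.cong) (auto simp: D_def)
    then show "scale_col n k c A $$ (i, j) = (A * D) $$ (i, j)" using ij by (simp add: scale_col_def)
  qed (use assms D in \<open>auto simp: scale_col_def\<close>)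
  moreover have "det D = c"
  proof -
    have "det D = prod_list (diag_mat D)"
      by (rule det_upper_triangular[OF _ D]) (auto simp: D_def)
    also have "\<dots> = (\<Prod>i\<in>{0..<n}. if i = k then c else 1)"
      by (simp add: prod_list_diag_prod D_def)
    also have "\<dots> = c" using assms(2) by simp
    finally show ?thesis .
  qed
  ultimately show ?thesis using det_mult[OF assms(1) D] by (simp add: mult.commute)
qed

lemma normalize_SL:
  assumes "A \<in> carrier_mat n n" "k < n" "det A \<noteq> (0::complex)"
  shows "scale_col n k (1 / det A) A \<in> carrier (SL n)"
  using det_scale_col[OF assms(1,2)] assms(3) by (simp add: carrier_SL_iff) (simp add: scale_col_def)

lemma tendsto_det:
  fixes A :: "'a \<Rightarrow> complex mat"
  assumes "\<And>s. A s \<in> carrier_mat n n" "B \<in> carrier_mat n n"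
    "\<And>i j. i < n \<Longrightarrow> j < n \<Longrightarrow> ((\<lambda>s. A s $$ (i, j)) \<longlongrightarrow> B $$ (i, j)) F"
  shows "((\<lambda>s. det (A s)) \<longlongrightarrow> det B) F"
proof -
  have "p i < n" if "p permutes {0..<n}" "i \<in> {0..<n}" for p i
    using permutes_in_image[OF that(1), of i] that(2) by simp
  then show ?thesis unfolding det_def'[OF assms(1)] det_def'[OF assms(2)]
    by (intro tendsto_sum tendsto_mult tendsto_const tendsto_prod assms(3)) auto
qed

lemma det_upper_triangular_nonzero:
  assumes "b \<in> carrier_mat n n" "upper_triangular b" "\<And>i. i < n \<Longrightarrow> b $$ (i, i) \<noteq> (0::complex)"
  shows "det b \<noteq> 0"
  using assms by (auto simp: det_upper_triangular[OF assms(2,1)] prod_list_diag_prod)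

section \<open>Limits of curves, translations and the Borel action\<close>

context grassmannian
begin

text \<open>Polynomials are continuous in the classical topology, so a polynomial that is nonzero at
  the limit is nonzero along the curve near it. Classical limits of points of \<open>S\<close>
  therefore lie in the Zariski closure.\<close>

lemma closure_curve:
  assumes lim: "\<And>i j. i < n \<Longrightarrow> j < n \<Longrightarrow> ((\<lambda>s::complex. \<gamma> s $$ (i, j)) \<longlongrightarrow> h $$ (i, j)) (at 0)"
    and h: "h \<in> SLn"
    and ev: "eventually (\<lambda>s. \<gamma> s \<in> SLn \<and> proj (\<gamma> s) \<in> S) (at 0)"
  shows "proj h \<in> fs_top Gr closure_of S"
  unfolding in_closure_of
proof (intro conjI allI impI)
  show "proj h \<in> topspace (fs_top Gr)" using h by (simp add: topspace_Gr)
  fix T assume T: "proj h \<in> T \<and> openin (fs_top Gr) T"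
  then have "openin (zariski_SL n) {g \<in> SLn. proj g \<in> T}"
    "h \<in> {g \<in> SLn. proj g \<in> T}" using h by (auto simp: openin_Gr)
  then obtain f where f: "f \<in> poly_fun n" "f h \<noteq> 0"
    "\<And>B. B \<in> SLn \<Longrightarrow> f B \<noteq> 0 \<Longrightarrow> B \<in> {g \<in> SLn. proj g \<in> T}"
    using zariski_nhd by blast
  have "((\<lambda>s. f (\<gamma> s)) \<longlongrightarrow> f h) (at 0)" by (rule poly_fun_tendsto[OF f(1) lim])
  then have "eventually (\<lambda>s. f (\<gamma> s) \<noteq> 0) (at 0)" using f(2) by (rule tendsto_imp_eventually_ne)
  with ev have "eventually (\<lambda>s. proj (\<gamma> s) \<in> S \<and> proj (\<gamma> s) \<in> T) (at 0)"
    by eventually_elim (use f(3) in auto)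
  then show "\<exists>y. y \<in> S \<and> y \<in> T" using eventually_happens'[OF at_neq_bot] by blast
qed

lemma openin_translate:
  assumes b: "b \<in> SLn" and T: "openin (fs_top Gr) T"
  shows "openin (fs_top Gr) {C \<in> topspace (fs_top Gr). b <#\<^bsub>SL n\<^esub> C \<in> T}"
  unfolding openin_Gr
proof
  show "{C \<in> topspace (fs_top Gr). b <#\<^bsub>SL n\<^esub> C \<in> T} \<subseteq> proj ` SLn" by (auto simp: topspace_Gr)
  have eq: "{g \<in> SLn. proj g \<in> {C \<in> topspace (fs_top Gr). b <#\<^bsub>SL n\<^esub> C \<in> T}}
      = {g \<in> SLn. proj (b * g) \<in> T}"
    using b by (auto simp: topspace_Gr proj_left_mult)
  show "openin (zariski_SL n) {g \<in> SLn. proj g \<in> {C \<in> topspace (fs_top Gr). b <#\<^bsub>SL n\<^esub> C \<in> T}}"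
    unfolding eq
  proof (subst openin_subopen, clarify)
    fix g assume g: "g \<in> SLn" "proj (b * g) \<in> T"
    have "openin (zariski_SL n) {g \<in> SLn. proj g \<in> T}"
      "b * g \<in> {g \<in> SLn. proj g \<in> T}" using T g b SL_mult_closed by (auto simp: openin_Gr)
    then obtain f where f: "f \<in> poly_fun n" "f (b * g) \<noteq> 0"
      "\<And>B. B \<in> SLn \<Longrightarrow> f B \<noteq> 0 \<Longrightarrow> B \<in> {g \<in> SLn. proj g \<in> T}"
      using zariski_nhd by blast
    obtain f' where f': "f' \<in> poly_fun n" "\<forall>A\<in>carrier_mat n n. f' A = f (b * A)"
      using poly_fun_left_mult[OF f(1) SL_carrier_mat[OF b]] by blast
    show "\<exists>U. openin (zariski_SL n) U \<and> g \<in> U \<and> U \<subseteq> {g \<in> SLn. proj (b * g) \<in> T}"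
    proof (intro exI[of _ "{A \<in> SLn. f' A \<noteq> 0}"] conjI openin_zariski_nonzero[OF f'(1)])
      show "g \<in> {A \<in> SLn. f' A \<noteq> 0}" using f' f g SL_carrier_mat by auto
      show "{A \<in> SLn. f' A \<noteq> 0} \<subseteq> {g \<in> SLn. proj (b * g) \<in> T}"
      proof clarify
        fix A assume A: "A \<in> SLn" "f' A \<noteq> 0"
        then have "f (b * A) \<noteq> 0" using f'(2) SL_carrier_mat by auto
        then show "proj (b * A) \<in> T" using f(3)[OF SL_mult_closed[OF b A(1)]] by simp
      qed
    qed
  qed
qed

text \<open>Generic upper triangular row operations: make the first \<open>d\<close> rows independent one at a time,
  adding a lower row outside the span of the previous ones where necessary.\<close>

lemma Borel_into_big_cell:
  assumes g: "g \<in> SLn"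
  shows "\<exists>b\<in>Borel n. \<Delta> (b * g) \<noteq> 0"
proof -
  define indep where "indep k G \<longleftrightarrow>
    (\<forall>c. (\<forall>j<d. (\<Sum>i<k. c i * G $$ (i, j)) = 0) \<longrightarrow> (\<forall>i<k. c i = 0))" for k and G :: "complex mat"
  define inspan where "inspan k G r \<longleftrightarrow> (\<exists>c. \<forall>j<d. G $$ (r, j) = (\<Sum>i<k. c i * G $$ (i, j)))"
    for k r and G :: "complex mat"
  have "\<exists>b\<in>Borel n. indep k (b * g)" if "k \<le> d" for k
    using that
  proof (induction k)
    case 0
    have "1\<^sub>m n \<in> Borel n" by (simp add: Borel_def carrier_SL_iff)
    then show ?case by (auto simp: indep_def)
  next
    case (Suc k)
    then obtain b where b: "b \<in> Borel n" "indep k (b * g)" by auto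
    define G where "G = b * g"
    have G: "G \<in> SLn" unfolding G_def by (rule SL_mult_closed[OF Borel_SL[OF b(1)] g])
    have inv: "minv G \<in> SLn" using G by simp
    have ext: "indep (Suc k) G'"
      if nspan: "\<not> inspan k G' k" and same: "\<And>i j. i < k \<Longrightarrow> j < d \<Longrightarrow> G' $$ (i, j) = G $$ (i, j)" for G'
      unfolding indep_def
    proof (intro allI impI)
      fix c i assume c: "\<forall>j<d. (\<Sum>i<Suc k. c i * G' $$ (i, j)) = 0" and i: "i < Suc k"
      have "c k = 0"
      proof (rule ccontr)
        assume ck: "c k \<noteq> 0"
        have "G' $$ (k, j) = (\<Sum>i<k. (- c i / c k) * G' $$ (i, j))" if "j < d" for j
        proof -
          have "c k * G' $$ (k, j) = - (\<Sum>i<k. c i * G' $$ (i, j))"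
            using c[rule_format, OF that] by (simp add: add_eq_0_iff2)
          then have "G' $$ (k, j) = - (\<Sum>i<k. c i * G' $$ (i, j)) / c k" using ck by (simp add: field_simps)
          then show ?thesis by (simp add: sum_divide_distrib sum_negf)
        qed
        then have "inspan k G' k" unfolding inspan_def by (intro exI[of _ "\<lambda>i. - c i / c k"]) blast
        then show False using nspan by contradiction
      qed
      then have "\<forall>j<d. (\<Sum>i<k. c i * G $$ (i, j)) = 0" using c same by simp
      then have "\<forall>i<k. c i = 0" using b(2) unfolding indep_def G_def by blast
      then show "c i = 0" using i \<open>c k = 0\<close> by (auto simp: less_Suc_eq)
    qed
    \<comment> \<open>Otherwise every row, cut to the first d columns, lies in the span of the first
      k, and k < d. A nonzero \<open>y\<close> that solves those k equations is then a linear
      relation between the first d columns of the invertible matrix \<open>G\<close>.\<close>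
    have "\<exists>r\<in>{k..<n}. \<not> inspan k G r"
    proof (rule ccontr)
      assume "\<not> ?thesis"
      then have span: "inspan k G r" if "k \<le> r" "r < n" for r using that by auto
      obtain y where y: "\<exists>j\<in>{..<d}. y j \<noteq> 0" "\<forall>i\<in>{..<k}. (\<Sum>j<d. G $$ (i, j) * y j) = 0"
        using homogeneous_system_nontrivial[of "{..<k}" "{..<d}" "\<lambda>i j. G $$ (i, j)"] Suc.prems by auto
      have zero: "(\<Sum>j<d. G $$ (i, j) * y j) = 0" if i: "i < n" for i
      proof (cases "i < k")
        case False
        then obtain c where "\<forall>j<d. G $$ (i, j) = (\<Sum>l<k. c l * G $$ (l, j))"
          using span[of i] i by (auto simp: inspan_def)
        then have "(\<Sum>j<d. G $$ (i, j) * y j) = (\<Sum>j<d. \<Sum>l<k. c l * (G $$ (l, j) * y j))"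
          by (simp add: sum_distrib_right mult.assoc)
        also have "\<dots> = (\<Sum>l<k. c l * (\<Sum>j<d. G $$ (l, j) * y j))"
          by (subst sum.swap) (simp add: sum_distrib_left)
        also have "\<dots> = 0" using y(2) by simp
        finally show ?thesis .
      qed (use y in auto)
      have "y l = 0" if l: "l < d" for l
      proof -
        have entry: "(\<Sum>i<n. minv G $$ (l, i) * G $$ (i, j)) = (if j = l then 1 else 0)" if "j < d" for j
        proof -
          have "(\<Sum>i<n. minv G $$ (l, i) * G $$ (i, j)) = (minv G * G) $$ (l, j)"
            using that l d_less
            by (intro mult_entry[OF SL_carrier_mat[OF inv] SL_carrier_mat[OF G], symmetric]) auto
          then show ?thesis using that l d_less by (simp add: SL_inv_mult[OF G])
        qed
        have "0 = (\<Sum>i<n. minv G $$ (l, i) * (\<Sum>j<d. G $$ (i, j) * y j))" using zero by simp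
        also have "\<dots> = (\<Sum>j<d. (\<Sum>i<n. minv G $$ (l, i) * G $$ (i, j)) * y j)"
          unfolding sum_distrib_right sum_distrib_left by (subst sum.swap) (simp add: mult.assoc)
        also have "\<dots> = (\<Sum>j<d. if j = l then y j else 0)" using entry by (intro sum.cong) auto
        also have "\<dots> = y l" using l by simp
        finally show ?thesis by simp
      qed
      then show False using y(1) by auto
    qed
    then obtain r where r: "k \<le> r" "r < n" "\<not> inspan k G r" by auto
    show ?case
    proof (cases "inspan k G k")
      case False
      then have "indep (Suc k) G" by (rule ext) simp
      then show ?thesis using b(1) unfolding G_def by blast
    next
      case True
      then have kr: "k < r" using r by (cases "k = r") auto
      \<comment> \<open>Adds row \<open>r\<close> to row \<open>k\<close>, which lies in the span of
        the rows above it while row \<open>r\<close> does not; \<open>k < r\<close> makes this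
        matrix upper triangular.\<close>
      define E :: "complex mat" where "E = mat n n (\<lambda>(i, j). if i = j \<or> (i = k \<and> j = r) then 1 else 0)"
      have E: "E \<in> carrier_mat n n" "upper_triangular E" using kr by (auto simp: E_def)
      have "det E = 1" by (rule det_unitriangular[OF E]) (simp add: E_def)
      then have EB: "E \<in> Borel n" using E by (simp add: Borel_def carrier_SL_iff)
      have entry: "(E * G) $$ (i, j) = G $$ (i, j) + (if i = k then G $$ (r, j) else 0)" if "i < n" "j < n" for i j
      proof -
        have "(E * G) $$ (i, j) = (\<Sum>l<n. (if l = i then G $$ (l, j) else 0) + (if l = r then if i = k then G $$ (l, j) else 0 else 0))"
          unfolding mult_entry[OF E(1) SL_carrier_mat[OF G] that]
          using that kr r by (intro sum.cong) (auto simp: E_def)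
        then show ?thesis using that r by (simp add: sum.distrib)
      qed
      have "indep (Suc k) (E * G)"
      proof (rule ext)
        show "(E * G) $$ (i, j) = G $$ (i, j)" if "i < k" "j < d" for i j
          using entry[of i j] that Suc.prems d_less by simp
        note same = this
        show "\<not> inspan k (E * G) k"
        proof
          assume "inspan k (E * G) k"
          then obtain c where c: "\<forall>j<d. (E * G) $$ (k, j) = (\<Sum>i<k. c i * (E * G) $$ (i, j))" by (auto simp: inspan_def)
          obtain e where e: "\<forall>j<d. G $$ (k, j) = (\<Sum>i<k. e i * G $$ (i, j))" using True by (auto simp: inspan_def)
          have "G $$ (r, j) = (\<Sum>i<k. (c i - e i) * G $$ (i, j))" if "j < d" for j
          proof -
            have "G $$ (k, j) + G $$ (r, j) = (\<Sum>i<k. c i * G $$ (i, j))"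
              using entry[of k j] c that same Suc.prems d_less by (simp del: index_mult_mat)
            then show ?thesis using e that by (simp add: left_diff_distrib sum_subtractf algebra_simps)
          qed
          then show False using r(3) by (auto simp: inspan_def)
        qed
      qed
      moreover have "E * G = (E * b) * g"
        unfolding G_def using SL_assoc[OF Borel_SL[OF EB] Borel_SL[OF b(1)] g] by simp
      ultimately show ?thesis using Borel_mult[OF EB b(1)] by (intro bexI[of _ "E * b"]) auto
    qed
  qed
  then obtain b where b: "b \<in> Borel n" "indep d (b * g)" by blast
  let ?A = "topleft d (b * g)"
  have "det ?A \<noteq> 0"
  proof
    assume "det ?A = 0"
    then have "det (transpose_mat ?A) = 0" by (simp add: det_transpose[of _ d])
    then obtain u where u: "u \<in> carrier_vec d" "u \<noteq> 0\<^sub>v d" "transpose_mat ?A *\<^sub>v u = 0\<^sub>v d"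
      using det_0_iff_vec_prod_zero_field[of "transpose_mat ?A" d] by auto
    have "(\<Sum>i<d. u $ i * (b * g) $$ (i, j)) = 0" if j: "j < d" for j
    proof -
      have "0 = (transpose_mat ?A *\<^sub>v u) $ j" using u(3) j by simp
      also have "\<dots> = (\<Sum>i<d. ?A $$ (i, j) * u $ i)"
        using j u(1) by (simp add: topleft_def scalar_prod_def atLeast0LessThan)
      also have "\<dots> = (\<Sum>i<d. u $ i * (b * g) $$ (i, j))"
        using j by (intro sum.cong) (simp_all add: topleft_def mult.commute)
      finally show ?thesis by simp
    qed
    then have "\<forall>i<d. u $ i = 0" using b(2) unfolding indep_def by blast
    then have "u = 0\<^sub>v d" using u(1) by (intro eq_vecI) auto
    then show False using u(2) by contradiction
  qed
  then show ?thesis using b(1) by (auto simp: \<Delta>_def)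
qed

end

section \<open>The block attached to w\<close>

locale schubert = grassmannian +
  fixes w :: "nat \<Rightarrow> nat"
  assumes w: "w \<in> min_coset_reps n d"
begin

text \<open>With indices starting at 0, \<open>v\<close> is \<open>w\<close>.  The partition has \<open>d - m\<close> nonzero parts, and its largest
  part is \<open>t + 1 - d\<close>, for \<open>m\<close> and \<open>t\<close> as below.\<close>

definition v :: "nat \<Rightarrow> nat" where "v k = w (Suc k) - 1"

lemma w_permutes: "w permutes {1..n}"
  using w by (simp add: min_coset_reps_def)

lemma w_v: "k < n \<Longrightarrow> w (Suc k) = Suc (v k)"
  using permutes_in_image[OF w_permutes, of "Suc k"] by (simp add: v_def)

lemma v_less: "k < n \<Longrightarrow> v k < n"
  using permutes_in_image[OF w_permutes, of "Suc k"] by (simp add: v_def) linarith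

lemma v_inj: "k < n \<Longrightarrow> l < n \<Longrightarrow> v k = v l \<Longrightarrow> k = l"
  using w_v[of k] w_v[of l] permutes_inj[OF w_permutes] by (metis Suc_inject injD)

lemma v_mono: "k < l \<Longrightarrow> l < d \<Longrightarrow> v k < v l"
proof -
  assume kl: "k < l" "l < d"
  have "strict_mono_on {1..d} w" using w by (simp add: min_coset_reps_def)
  then have "w (Suc k) < w (Suc l)" using kl by (auto simp: strict_mono_on_def)
  then show ?thesis using w_v[of k] w_v[of l] kl d_less by simp
qed

lemma v_ge: "k < d \<Longrightarrow> k \<le> v k"
proof (induction k)
  case (Suc k)
  then show ?case using v_mono[of k "Suc k"] by simp
qed simp

definition m :: nat where "m = (LEAST k. k = d \<or> v k \<noteq> k)"

lemma m_le: "m \<le> d"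
  unfolding m_def by (rule Least_le) simp

lemma v_fixed: "k < m \<Longrightarrow> v k = k"
  using not_less_Least[of k "\<lambda>k. k = d \<or> v k \<noteq> k"] by (simp add: m_def)

text \<open>\<open>v\<close> increases strictly below \<open>d\<close>, so from the first moved
  index on all indices are moved up.\<close>

lemma v_moved: "m \<le> k \<Longrightarrow> k < d \<Longrightarrow> Suc k \<le> v k"
proof (induction k rule: dec_induct)
  case base
  have "m = d \<or> v m \<noteq> m" unfolding m_def by (rule LeastI[of _ d]) simp
  then show ?case using base v_ge[of m] by simp
next
  case (step k)
  then show ?case using v_mono[of k "Suc k"] by simp
qed

text \<open>The values below \<open>m\<close> are already taken by the fixed indices.\<close>

lemma v_ge_m: "m \<le> k \<Longrightarrow> k < n \<Longrightarrow> m \<le> v k"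
  using v_fixed[of "v k"] v_inj[of k "v k"] v_less[of k] by (metis not_le)

definition t :: nat where "t = v (d - 1)"

lemma t_less: "t < n" and t_ge: "d \<le> Suc t"
  using v_less[of "d - 1"] v_ge[of "d - 1"] d_pos d_less by (auto simp: t_def)

lemma v_le_t:
  assumes "k < d"
  shows "v k \<le> t"
proof (cases "k = d - 1")
  case False
  then have "k < d - 1" using assms by simp
  then show ?thesis using v_mono[of k "d - 1"] d_pos by (simp add: t_def)
qed (simp add: t_def)

abbreviation blk :: "(nat \<times> nat) set" where "blk \<equiv> {d..t} \<times> {m..<d}"

lemma blk_idx: "blk \<subseteq> idx"
  using t_less by auto

section \<open>Points and equations of the Schubert variety\<close>

definition cell :: "complex mat set set" where "cell = Schubert_cell n d w"

definition Z :: "complex mat set set" where "Z = fs_top Gr closure_of cell"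

abbreviation X :: "complex mat set fspace" where "X \<equiv> sub_fspace Gr Z"

lemma Schubert_variety_eq: "Schubert_variety n d w = X"
  by (simp add: Schubert_variety_def Z_def cell_def)

lemma Z_subset: "Z \<subseteq> topspace (fs_top Gr)"
  unfolding Z_def by (rule closure_of_subset_topspace)

lemma topspace_X: "topspace (fs_top X) = Z"
  by (rule sub_Gr_topspace[OF Z_subset])

lemma Z_meets_cell:
  assumes "C \<in> Z" "openin (fs_top Gr) T" "C \<in> T"
  obtains y where "y \<in> cell" "y \<in> T"
  using assms(1)[unfolded Z_def in_closure_of, THEN conjunct2, rule_format, of T] assms(2,3) by auto

lemma monomial_reps_iff: "M \<in> monomial_reps n w \<longleftrightarrow>
    M \<in> SLn \<and> (\<forall>i<n. \<forall>j<n. M $$ (i, j) \<noteq> 0 \<longleftrightarrow> i = v j)"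
  using w_v by (auto simp: monomial_reps_def)

lemma cell_eq: "cell = {proj (b * M) | b M. b \<in> Borel n \<and> M \<in> monomial_reps n w}"
  by (simp add: cell_def Schubert_cell_def)

lemma ex_monomial_rep: "\<exists>M. M \<in> monomial_reps n w"
proof -
  define M where "M = mat n n (\<lambda>(i, j). if i = v j then 1 else 0 :: complex)"
  have M: "M \<in> carrier_mat n n" "transpose_mat M \<in> carrier_mat n n" by (simp_all add: M_def)
  have "transpose_mat M * M = 1\<^sub>m n"
  proof (rule eq_matI)
    fix i j assume "i < dim_row (1\<^sub>m n :: complex mat)" "j < dim_col (1\<^sub>m n :: complex mat)"
    then have ij: "i < n" "j < n" by auto
    have "(transpose_mat M * M) $$ (i, j) = (\<Sum>l<n. if l = v i then if v i = v j then 1 else 0 else 0)"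
      unfolding mult_entry[OF M(2,1) ij] using ij by (intro sum.cong) (auto simp: M_def)
    then show "(transpose_mat M * M) $$ (i, j) = 1\<^sub>m n $$ (i, j)" using ij v_less[of i] v_inj[of i j] by auto
  qed (use M in auto)
  then have "det (transpose_mat M) * det M = 1" using det_mult[OF M(2,1)] by simp
  then have "det M \<noteq> 0" by auto
  then have "scale_col n 0 (1 / det M) M \<in> monomial_reps n w"
    using normalize_SL[OF M(1), of 0] d_less by (auto simp: monomial_reps_iff scale_col_def M_def)
  then show ?thesis by blast
qed

lemma monomial_rep_mult:
  assumes "M \<in> monomial_reps n w" "b \<in> carrier_mat n n" "i < n" "k < n"
  shows "(b * M) $$ (i, k) = b $$ (i, v k) * M $$ (v k, k)"
proof -
  have M: "M \<in> carrier_mat n n" "\<forall>i<n. \<forall>j<n. M $$ (i, j) \<noteq> 0 \<longleftrightarrow> i = v j"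
    using assms(1) by (auto simp: monomial_reps_iff carrier_SL_iff)
  have "(b * M) $$ (i, k) = (\<Sum>l<n. if l = v k then b $$ (i, v k) * M $$ (v k, k) else 0)"
    unfolding mult_entry[OF assms(2) M(1) assms(3,4)] using M(2) assms(4) by (intro sum.cong) auto
  then show ?thesis using v_less[OF assms(4)] by simp
qed

text \<open>A coset depends only on the span of the first d columns. So it is enough to find these
  columns, in the order \<open>\<kappa>\<close>, among the columns of an invertible upper triangular
  \<open>b\<close> at the positions \<open>v 0\<close>, ..., \<open>v (d - 1)\<close>.\<close>

lemma cellI:
  assumes h: "h \<in> SLn" and b: "b \<in> carrier_mat n n" "upper_triangular b"
    "\<And>i. i < n \<Longrightarrow> b $$ (i, i) \<noteq> 0" and \<kappa>: "\<And>k. k < d \<Longrightarrow> \<kappa> k < d"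
    and cols: "\<And>i k. i < n \<Longrightarrow> k < d \<Longrightarrow> h $$ (i, k) = b $$ (i, v (\<kappa> k))"
  shows "proj h \<in> cell"
proof -
  have n: "0 < n" using d_less by simp
  define b' where "b' = scale_col n 0 (1 / det b) b"
  have det: "det b \<noteq> 0" by (rule det_upper_triangular_nonzero[OF b])
  have b': "b' \<in> SLn" unfolding b'_def by (rule normalize_SL[OF b(1) n det])
  moreover have "upper_triangular b'"
  proof (rule upper_triangularI)
    fix j i assume "j < i" "i < dim_row b'"
    then show "b' $$ (i, j) = 0" using upper_triangularD[OF b(2), of j i] b(1) by (simp add: b'_def scale_col_def)
  qed
  ultimately have B: "b' \<in> Borel n" by (simp add: Borel_def)
  obtain M where M: "M \<in> monomial_reps n w" using ex_monomial_rep by blast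
  have M_SL: "M \<in> SLn" using M by (simp add: monomial_reps_iff)
  define g where "g = b' * M"
  have g: "g \<in> SLn" unfolding g_def by (rule SL_mult_closed[OF b' M_SL])
  have gi: "minv g \<in> SLn" using g by simp
  \<comment> \<open>The factor between column \<open>k\<close> of \<open>g\<close> and column
    \<open>v k\<close> of \<open>b\<close>. The determinant was normalized in column 0 of
    \<open>b'\<close>, hence the case \<open>v k = 0\<close>.\<close>
  define \<mu> where "\<mu> k = (if v k = 0 then 1 / det b else 1) * M $$ (v k, k)" for k
  have \<mu>: "\<mu> k \<noteq> 0" if "k < n" for k
    using M that v_less[OF that] det by (auto simp: \<mu>_def monomial_reps_iff)
  have entry: "g $$ (i, k) = \<mu> k * b $$ (i, v k)" if "i < n" "k < n" for i k
    unfolding g_def monomial_rep_mult[OF M SL_carrier_mat[OF b'] that]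
    using that v_less[OF that(2)] by (simp add: b'_def scale_col_def \<mu>_def)
  define x where "x = minv g * h"
  have "x $$ (i, k) = 0" if ik: "d \<le> i" "i < n" "k < d" for i k
  proof -
    have kn: "k < n" "\<kappa> k < n" using ik \<kappa>[of k] d_less by auto
    have "x $$ (i, k) = (\<Sum>j<n. minv g $$ (i, j) * h $$ (j, k))"
      unfolding x_def by (rule mult_entry[OF SL_carrier_mat[OF gi] SL_carrier_mat[OF h] ik(2) kn(1)])
    also have "\<dots> = (\<Sum>j<n. (minv g $$ (i, j) * g $$ (j, \<kappa> k)) / \<mu> (\<kappa> k))"
      using cols[OF _ ik(3)] entry[OF _ kn(2)] \<mu>[OF kn(2)] by (intro sum.cong) auto
    also have "\<dots> = (minv g * g) $$ (i, \<kappa> k) / \<mu> (\<kappa> k)"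
      unfolding mult_entry[OF SL_carrier_mat[OF gi] SL_carrier_mat[OF g] ik(2) kn(2)]
      by (simp add: sum_divide_distrib)
    also have "\<dots> = 0" using SL_inv_mult[OF g] ik kn \<kappa>[of k] by simp
    finally show ?thesis .
  qed
  then have "x \<in> Parabolic n d" using SL_mult_closed[OF gi h] by (auto simp: Parabolic_iff x_def)
  moreover have "h = g * x" unfolding x_def by (rule SL_cancel_right[OF g h, symmetric])
  ultimately have "proj h = proj g" using proj_mult_P[OF g] by simp
  then show ?thesis unfolding cell_eq using B M by (auto simp: g_def)
qed

text \<open>If the entries at \<open>(v (\<kappa> k), k)\<close> are nonzero, the columns fit into
  an upper triangular matrix as \<open>cellI\<close> wants. They may vanish, so \<open>s\<close> is
  added to them; for \<open>s\<close> close to but different from 0 this gives points of the cell,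
  and these converge to \<open>h\<close>.\<close>

lemma mem_Z_columns:
  assumes h: "h \<in> SLn" and \<kappa>: "bij_betw \<kappa> {..<d} {..<d}"
    and supp: "\<And>i k. i < n \<Longrightarrow> k < d \<Longrightarrow> v (\<kappa> k) < i \<Longrightarrow> h $$ (i, k) = 0"
  shows "proj h \<in> Z"
proof -
  have hc: "h \<in> carrier_mat n n" "det h = 1" using h by (auto simp: carrier_SL_iff)
  have \<kappa>d: "\<kappa> k < d" if "k < d" for k using bij_betwE[OF \<kappa>] that by auto
  have v\<kappa>_inj: "k = l" if "k < d" "l < d" "v (\<kappa> k) = v (\<kappa> l)" for k l
    using v_inj[of "\<kappa> k" "\<kappa> l"] that \<kappa>d[of k] \<kappa>d[of l] d_less bij_betw_imp_inj_on[OF \<kappa>]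
    by (auto simp: inj_on_def)
  define H where "H s = mat n n (\<lambda>(i, k). h $$ (i, k) + (if k < d \<and> i = v (\<kappa> k) then s else 0))" for s
  \<comment> \<open>The determinant is normalized in the last column, which is not among the first
    d.\<close>
  define \<gamma> where "\<gamma> s = scale_col n (n - 1) (1 / det (H s)) (H s)" for s
  have H: "H s \<in> carrier_mat n n" for s by (simp add: H_def)
  have limH: "((\<lambda>s. H s $$ (i, j)) \<longlongrightarrow> h $$ (i, j)) (at 0)" if "i < n" "j < n" for i j
  proof (cases "j < d \<and> i = v (\<kappa> j)")
    case True
    have "((\<lambda>s. h $$ (i, j) + s) \<longlongrightarrow> h $$ (i, j) + 0) (at 0)" by (intro tendsto_intros)
    then show ?thesis using that True by (simp add: H_def)
  next
    case False
    then have "(\<lambda>s. H s $$ (i, j)) = (\<lambda>s. h $$ (i, j))" using that by (auto simp: H_def)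
    then show ?thesis by simp
  qed
  have limdet: "((\<lambda>s. det (H s)) \<longlongrightarrow> 1) (at 0)"
    using tendsto_det[of H n h, OF H hc(1) limH] hc(2) by simp
  have ev_det: "eventually (\<lambda>s. det (H s) \<noteq> 0) (at 0)"
    by (rule tendsto_imp_eventually_ne[OF limdet]) simp
  have "eventually (\<lambda>s. \<forall>k\<in>{..<d}. s \<noteq> - h $$ (v (\<kappa> k), k)) (at 0)"
    by (intro eventually_ball_finite ballI eventually_neq_at_within) simp
  with ev_det have "eventually (\<lambda>s. \<gamma> s \<in> SLn \<and> proj (\<gamma> s) \<in> cell) (at 0)"
  proof eventually_elim
    case (elim s)
    have SL: "\<gamma> s \<in> SLn" unfolding \<gamma>_def
      using elim(1) d_less by (intro normalize_SL H) auto
    define c' where "c' c = inv_into {..<d} (\<lambda>k. v (\<kappa> k)) c" for c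
    have c': "c' (v (\<kappa> k)) = k" if "k < d" for k
      unfolding c'_def using that v\<kappa>_inj by (intro inv_into_f_f inj_onI) auto
    \<comment> \<open>The columns of \<open>H s\<close> go to the positions
      \<open>v (\<kappa> k)\<close>, and unit vectors fill the other positions.\<close>
    define b where "b = mat n n (\<lambda>(i, c). if c \<in> (\<lambda>k. v (\<kappa> k)) ` {..<d} then H s $$ (i, c' c)
      else if i = c then 1 else 0)"
    have b: "b \<in> carrier_mat n n" by (simp add: b_def)
    have entry: "b $$ (i, v (\<kappa> k)) = H s $$ (i, k)" if "i < n" "k < d" for i k
      using that c'[OF that(2)] v_less[of "\<kappa> k"] \<kappa>d[of k] d_less by (auto simp: b_def)
    have "proj (\<gamma> s) \<in> cell"
    proof (rule cellI[OF SL b])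
      show "upper_triangular b"
      proof (rule upper_triangularI)
        fix j i assume ji: "j < i" "i < dim_row b"
        then have "i < n" "j < n" using b by auto
        show "b $$ (i, j) = 0"
        proof (cases "j \<in> (\<lambda>k. v (\<kappa> k)) ` {..<d}")
          case True
          then obtain k where k: "k < d" "j = v (\<kappa> k)" by auto
          then show ?thesis using entry[OF \<open>i < n\<close> k(1)] supp[OF \<open>i < n\<close> k(1)] ji d_less \<open>i < n\<close> by (simp add: H_def)
        qed (use ji \<open>i < n\<close> \<open>j < n\<close> in \<open>simp add: b_def\<close>)
      qed
      fix i assume i: "i < n"
      show "b $$ (i, i) \<noteq> 0"
      proof (cases "i \<in> (\<lambda>k. v (\<kappa> k)) ` {..<d}")
        case True
        then obtain k where k: "k < d" "i = v (\<kappa> k)" by auto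
        have "h $$ (i, k) + s \<noteq> 0" using elim(2) k by (auto simp: add_eq_0_iff)
        then show ?thesis using entry[OF i k(1)] k d_less i by (simp add: H_def)
      qed (use i in \<open>simp add: b_def\<close>)
    next
      fix i k assume ik: "i < n" "k < d"
      then show "\<gamma> s $$ (i, k) = b $$ (i, v (\<kappa> k))"
        using entry[OF ik] d_less by (simp add: \<gamma>_def scale_col_def)
    qed (rule \<kappa>d)
    then show ?case using SL by simp
  qed
  moreover have "((\<lambda>s. \<gamma> s $$ (i, j)) \<longlongrightarrow> h $$ (i, j)) (at 0)" if ij: "i < n" "j < n" for i j
  proof (cases "j = n - 1")
    case True
    have "((\<lambda>s. H s $$ (i, j) * (1 / det (H s))) \<longlongrightarrow> h $$ (i, j) * (1 / 1)) (at 0)"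
      by (intro tendsto_intros limH limdet ij) simp
    then show ?thesis using ij True by (simp add: \<gamma>_def scale_col_def)
  next
    case False
    then show ?thesis using limH[OF ij] ij by (simp add: \<gamma>_def scale_col_def)
  qed
  ultimately show ?thesis unfolding Z_def by (intro closure_curve[OF _ h])
qed

lemma base_mem_Z: "proj (1\<^sub>m n) \<in> Z"
proof (rule mem_Z_columns[of _ id])
  fix i k assume "i < n" "k < d" "v (id k) < i"
  then show "1\<^sub>m n $$ (i, k) = (0::complex)" using v_ge[of k] d_less by auto
qed (auto simp: carrier_SL_iff)

text \<open>Only column \<open>j\<close> reaches below the diagonal, and at most to row
  \<open>t\<close>, so it is given the last position d - 1, where \<open>v\<close> takes its largest
  value \<open>t\<close>. The columns after it move back one position, which is allowed since
  \<open>v (k - 1)\<close> is at least \<open>k\<close> for moved indices.\<close>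

lemma mem_Z_column:
  assumes h: "h \<in> SLn" and j: "m \<le> j" "j < d"
    and supp: "\<And>i k. k < i \<Longrightarrow> i < n \<Longrightarrow> k < d \<Longrightarrow> k \<noteq> j \<Longrightarrow> h $$ (i, k) = 0"
      "\<And>i. t < i \<Longrightarrow> i < n \<Longrightarrow> h $$ (i, j) = 0"
  shows "proj h \<in> Z"
proof (rule mem_Z_columns[OF h])
  let ?\<kappa> = "\<lambda>k. if k < j then k else if k = j then d - 1 else k - 1"
  show "bij_betw ?\<kappa> {..<d} {..<d}"
    by (rule bij_betw_byWitness[where f' = "\<lambda>k. if k < j then k else if k = d - 1 then j else Suc k"])
      (use j in auto)
  fix i k assume ik: "i < n" "k < d" "v (?\<kappa> k) < i"
  show "h $$ (i, k) = 0"
  proof (cases "k = j")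
    case True
    then show ?thesis using ik supp(2)[of i] by (auto simp: t_def)
  next
    case False
    have "k \<le> v (?\<kappa> k)"
      using False ik(2) j v_ge[of k] v_moved[of "k - 1"] by auto
    then show ?thesis using False ik supp(1)[of k i] by simp
  qed
qed

text \<open>Translation by \<open>b\<close> is continuous and maps the cell into itself.\<close>

lemma Z_Borel:
  assumes b: "b \<in> Borel n" and C: "C \<in> Z"
  shows "b <#\<^bsub>SL n\<^esub> C \<in> Z"
  unfolding Z_def in_closure_of
proof (intro conjI allI impI)
  have b': "b \<in> SLn" by (rule Borel_SL[OF b])
  obtain g where g: "g \<in> SLn" "C = proj g" using C Z_subset by (auto simp: topspace_Gr)
  then show "b <#\<^bsub>SL n\<^esub> C \<in> topspace (fs_top Gr)"
    using b' SL_mult_closed by (auto simp: topspace_Gr proj_left_mult)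
  fix T assume T: "b <#\<^bsub>SL n\<^esub> C \<in> T \<and> openin (fs_top Gr) T"
  let ?T = "{C \<in> topspace (fs_top Gr). b <#\<^bsub>SL n\<^esub> C \<in> T}"
  have "openin (fs_top Gr) ?T" using openin_translate[OF b'] T by blast
  moreover have "C \<in> ?T" using T C Z_subset by auto
  ultimately obtain y where y: "y \<in> cell" "y \<in> ?T" by (rule Z_meets_cell[OF C])
  obtain b1 M where bM: "b1 \<in> Borel n" "M \<in> monomial_reps n w" "y = proj (b1 * M)" using y(1) by (auto simp: cell_eq)
  have M: "M \<in> SLn" using bM(2) by (simp add: monomial_reps_iff)
  have "b <#\<^bsub>SL n\<^esub> y = proj ((b * b1) * M)"
    unfolding bM(3) using proj_left_mult[OF b' SL_mult_closed[OF Borel_SL[OF bM(1)] M]]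
      SL_assoc[OF b' Borel_SL[OF bM(1)] M] by simp
  then have "b <#\<^bsub>SL n\<^esub> y \<in> cell" using Borel_mult[OF b bM(1)] bM(2) by (auto simp: cell_eq)
  then show "\<exists>y. y \<in> cell \<and> y \<in> T" using y(2) by blast
qed

text \<open>Outside the block a coordinate vanishes for one of two reasons. Either its row lies
  below \<open>t\<close>, where the first d columns of \<open>b * M\<close> are zero, or its column
  comes before \<open>m\<close>. In the second case the subspace contains the first m basis vectors,
  which is used in the form of zeros of the inverse matrix.\<close>

lemma coord_cell_eq_0:
  assumes x: "x \<in> cell" "x \<in> chart_dom (1\<^sub>m n)" and ij: "ij \<in> idx" "ij \<notin> blk"
  shows "coord (1\<^sub>m n) ij x = 0"
proof -
  have one: "1\<^sub>m n \<in> SLn" by (simp add: carrier_SL_iff)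
  have inv1: "minv (1\<^sub>m n) = 1\<^sub>m n" using SL.inv_one[of n] by simp
  obtain b M where bM: "b \<in> Borel n" "M \<in> monomial_reps n w" "x = proj (b * M)" using x(1) by (auto simp: cell_eq)
  have b: "b \<in> SLn" by (rule Borel_SL[OF bM(1)])
  have M: "M \<in> SLn" "\<forall>i<n. \<forall>j<n. M $$ (i, j) \<noteq> 0 \<longleftrightarrow> i = v j" using bM(2) by (auto simp: monomial_reps_iff)
  define g where "g = b * M"
  have g: "g \<in> SLn" unfolding g_def by (rule SL_mult_closed[OF b M(1)])
  define a where "a ij = coord (1\<^sub>m n) ij x" for ij
  have "x = proj (\<sigma> a)"
    using chart_surj[OF one] x(2) unfolding inv1 SL_one_mult[OF \<sigma>_SL] a_def[abs_def] by blast
  then obtain p where p: "p \<in> Parabolic n d" "\<sigma> a = g * p"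
    using proj_eqE[OF \<sigma>_SL] bM(3) by (metis g_def)
  obtain i j where ij': "ij = (i, j)" "d \<le> i" "i < n" "j < d" using ij(1) by auto
  have jn: "j < n" using ij' d_less by simp
  have "i > t \<or> j < m" using ij(2) ij' by auto
  then have "a (i, j) = 0"
  proof
    assume "t < i"
    have "\<sigma> a $$ (i, j) = (\<Sum>k<n. g $$ (i, k) * p $$ (k, j))"
      unfolding p(2) by (rule mult_entry[OF SL_carrier_mat[OF g] SL_carrier_mat[OF P_SL[OF p(1)]] ij'(3) jn])
    also have "\<dots> = 0"
    proof (intro sum.neutral ballI)
      fix k assume k: "k \<in> {..<n}"
      show "g $$ (i, k) * p $$ (k, j) = 0"
      proof (cases "k < d")
        case True
        then have "b $$ (i, v k) = 0" using v_le_t[of k] \<open>t < i\<close> ij' Borel_entry[OF bM(1), of "v k" i] by simp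
        then show ?thesis using monomial_rep_mult[OF bM(2) SL_carrier_mat[OF b] ij'(3)] k by (simp add: g_def)
      next
        case False
        then show ?thesis using p(1) k ij' by (auto simp: Parabolic_iff)
      qed
    qed
    finally show ?thesis using ij' jn by (simp add: \<sigma>_entry)
  next
    assume jm: "j < m"
    have bi: "minv b \<in> SLn" and gi: "minv g \<in> SLn"
      and pi: "minv p \<in> Parabolic n d" using b g Parabolic_inv[OF p(1)] d_less by auto
    have "M * minv g = minv b"
    proof -
      have "M = minv b * g" unfolding g_def by (rule SL_cancel_left[OF b M(1), symmetric])
      then have "M * minv g = minv b * (g * minv g)"
        using SL_assoc[OF bi g gi] by simp
      then show ?thesis by (simp add: SL_mult_inv[OF g] SL_mult_one[OF bi])
    qed
    then have M_gi: "(\<Sum>l<n. M $$ (r, l) * minv g $$ (l, j)) = minv b $$ (r, j)" if "r < n" for r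
      using mult_entry[OF SL_carrier_mat[OF M(1)] SL_carrier_mat[OF gi] that jn] by simp
    \<comment> \<open>In row \<open>v k\<close> of \<open>M * minv g = minv b\<close> only the term
      with index \<open>k\<close> survives, and the entry of the triangular \<open>minv b\<close> at
      \<open>(v k, j)\<close> is 0 because j < m <= v k.\<close>
    have gi_0: "minv g $$ (k, j) = 0" if k: "d \<le> k" "k < n" for k
    proof -
      have vk: "v k < n" "j < v k" using v_less[OF k(2)] v_ge_m[of k] k m_le jm by auto
      have "(\<Sum>l<n. M $$ (v k, l) * minv g $$ (l, j))
          = (\<Sum>l<n. if l = k then M $$ (v k, k) * minv g $$ (k, j) else 0)"
        using M(2) vk(1) v_inj[OF k(2)] by (intro sum.cong) auto
      then have "M $$ (v k, k) * minv g $$ (k, j) = minv b $$ (v k, j)"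
        using M_gi[OF vk(1)] k by simp
      also have "\<dots> = 0" using Borel_entry[OF Borel_inv[OF bM(1)] vk(2,1)] .
      finally show ?thesis using M(2) vk(1) k(2) by auto
    qed
    have "\<sigma> (\<lambda>k. - a k) = minv p * minv g"
    proof -
      have "minv (\<sigma> a) = minv p * minv g"
        using SL.inv_mult_group[OF g P_SL[OF p(1)]] p(2) by simp
      moreover have "\<sigma> (\<lambda>k. - a k) = minv (\<sigma> a)"
        by (rule SL.inv_equality[symmetric]) (simp_all add: \<sigma>_mult \<sigma>_0 \<sigma>_SL)
      ultimately show ?thesis by simp
    qed
    then have "\<sigma> (\<lambda>k. - a k) $$ (i, j) = (\<Sum>k<n. minv p $$ (i, k) * minv g $$ (k, j))"
      using mult_entry[OF SL_carrier_mat[OF P_SL[OF pi]] SL_carrier_mat[OF gi] ij'(3) jn] by simp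
    also have "\<dots> = 0"
    proof (intro sum.neutral ballI)
      fix k assume k: "k \<in> {..<n}"
      show "minv p $$ (i, k) * minv g $$ (k, j) = 0"
      proof (cases "k < d")
        case True
        then show ?thesis using pi ij' by (auto simp: Parabolic_iff)
      qed (use gi_0 k in auto)
    qed
    finally show ?thesis using ij' jn by (simp add: \<sigma>_entry)
  qed
  then show ?thesis by (simp add: a_def ij')
qed

text \<open>Vanishing of a coordinate is closed in the chart: the open set where it is nonzero would
  meet the cell.\<close>

lemma coord_Z_eq_0:
  assumes x: "x \<in> Z" "x \<in> chart_dom (1\<^sub>m n)" and ij: "ij \<in> idx" "ij \<notin> blk"
  shows "coord (1\<^sub>m n) ij x = 0"
proof (rule ccontr)
  assume nz: "coord (1\<^sub>m n) ij x \<noteq> 0"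
  have one: "1\<^sub>m n \<in> SLn" by (simp add: carrier_SL_iff)
  let ?U = "{y \<in> chart_dom (1\<^sub>m n). coord (1\<^sub>m n) ij y \<noteq> 0}"
  have "openin (fs_top Gr) ?U" by (rule Gr.openin_nonzero[OF openin_chart_dom[OF one] coord_reg[OF one ij(1)]])
  moreover have "x \<in> ?U" using x(2) nz by simp
  ultimately obtain y where "y \<in> cell" "y \<in> ?U" by (rule Z_meets_cell[OF x(1)])
  then show False using coord_cell_eq_0[OF _ _ ij] by auto
qed

end

section \<open>Toric and smooth Schubert varieties\<close>

context schubert
begin

lemma one_SL: "1\<^sub>m n \<in> SLn"
  by (simp add: carrier_SL_iff)

lemma inv_one: "minv (1\<^sub>m n) = 1\<^sub>m n"
  using SL.inv_one[of n] by simp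

lemma one_mult_\<sigma>: "1\<^sub>m n * \<sigma> a = \<sigma> a"
  by (rule SL_one_mult[OF \<sigma>_SL])

lemmas big_cell_chart = chart_\<sigma>[OF one_SL, unfolded inv_one one_mult_\<sigma>]
lemmas big_cell_surj = chart_surj[OF one_SL, unfolded inv_one one_mult_\<sigma>]

lemma function_space_X: "function_space X"
  by (rule function_space_sub) (rule Gr.function_space_axioms)

lemma local_function_ring_X:
  assumes "normal_variety X" "x \<in> Z"
  shows "local_function_ring X x"
proof -
  have "integrally_closed_domain (local_ring X x)"
    using assms topspace_X by (simp add: normal_variety_def)
  then interpret domain "local_ring X x" by (simp add: integrally_closed_domain_def)
  show ?thesis
    using assms(2) topspace_X function_space_X is_cring
    by (simp add: local_function_ring_def local_function_ring_axioms_def)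
qed

lemma chart_parametrized:
  assumes "local_function_ring X (proj g)" "g \<in> SLn"
    and A: "\<And>ij. ij \<in> idx \<Longrightarrow> (\<lambda>z. A z ij) \<in> mpoly_fun I"
  shows "local_function_ring.parametrized X (proj g) I (\<lambda>z. proj (g * \<sigma> (A z)))"
proof -
  interpret local_function_ring X "proj g" by (rule assms(1))
  show ?thesis unfolding parametrized_def
  proof
    fix f assume "f \<in> reg"
    from chart_fraction[OF assms(2) this] obtain V p q where V: "openin (fs_top X) V" "proj g \<in> V"
      "p \<in> mpoly_fun idx" "q \<in> mpoly_fun idx"
      "\<forall>a. proj (g * \<sigma> a) \<in> V \<longrightarrow> q a \<noteq> 0 \<and> f (proj (g * \<sigma> a)) = p a / q a" by blast
    show "\<exists>V p q. openin (fs_top X) V \<and> proj g \<in> V \<and> p \<in> mpoly_fun I \<and> q \<in> mpoly_fun I \<and>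
      (\<forall>z. proj (g * \<sigma> (A z)) \<in> V \<longrightarrow> q z \<noteq> 0 \<and> f (proj (g * \<sigma> (A z))) = p z / q z)"
      using V(1,2,5) mpoly_fun_compose[OF V(3) A] mpoly_fun_compose[OF V(4) A]
      by (intro exI[of _ V] exI[of _ "\<lambda>z. p (A z)"] exI[of _ "\<lambda>z. q (A z)"]) simp
  qed
qed

lemma reg_at_X:
  assumes "openin (fs_top Gr) U" "f \<in> fs_reg Gr U" "x \<in> U" "x \<in> Z"
  shows "f \<in> reg_at X x"
proof -
  have "openin (fs_top X) (U \<inter> Z)" using assms(1) by (auto simp: openin_sub_Gr)
  moreover have "f \<in> fs_reg X (U \<inter> Z)" using assms(1,2) by (auto simp: sub_fspace_def)
  ultimately show ?thesis using assms(3,4) by (auto simp: reg_at_def)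
qed

section \<open>Coordinate axes at the base point\<close>

definition axis :: "nat \<times> nat \<Rightarrow> complex \<Rightarrow> nat \<times> nat \<Rightarrow> complex" where
  "axis l s = (\<lambda>k. if k = l then s else 0)"

text \<open>The matrix has at most one nonzero entry below the diagonal, in a moved column and in a
  row not below \<open>t\<close>.\<close>

lemma axis_mem_Z:
  assumes "l \<in> blk"
  shows "proj (\<sigma> (axis l s)) \<in> Z"
proof -
  obtain i j where l: "l = (i, j)" "d \<le> i" "i \<le> t" "m \<le> j" "j < d" using assms by auto
  show ?thesis
    by (rule mem_Z_column[OF \<sigma>_SL l(4,5)]) (use l d_less in \<open>auto simp: \<sigma>_entry axis_def\<close>)
qed

lemma card_blk_le_generators:
  assumes lfr: "local_function_ring X (proj (1\<^sub>m n))"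
    and S: "finite S" "S \<subseteq> carrier (local_ring X (proj (1\<^sub>m n)))"
      "Idl\<^bsub>local_ring X (proj (1\<^sub>m n))\<^esub> S = local_max_ideal X (proj (1\<^sub>m n))"
  shows "card blk \<le> card S"
proof -
  interpret local_function_ring X "proj (1\<^sub>m n)" by (rule lfr)
  let ?\<gamma> = "\<lambda>l s. proj (\<sigma> (axis l s))"
  have base: "?\<gamma> l 0 = proj (1\<^sub>m n)" for l
    by (simp add: axis_def \<sigma>_0)
  have line: "\<exists>P. \<forall>s. p (axis l s) = poly P s" if "p \<in> mpoly_fun idx" for p l
    using mpoly_fun_line[OF that, of "\<lambda>_. 0" "axis l 1"] by (simp add: axis_def if_distrib cong: if_cong)
  have cont: "eventually (\<lambda>s. ?\<gamma> l s \<in> V) (nhds 0)"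
    if l: "l \<in> blk" and V: "openin (fs_top X) V" "proj (1\<^sub>m n) \<in> V" for l V
  proof -
    obtain F where F: "F \<in> mpoly_fun idx" "F (\<lambda>_. 0) \<noteq> 0"
      "\<forall>a. F a \<noteq> 0 \<longrightarrow> proj (\<sigma> a) \<in> Z \<longrightarrow> proj (\<sigma> a) \<in> V"
      using chart_continuous[OF one_SL V] unfolding one_mult_\<sigma> by blast
    obtain P where P: "\<forall>s. F (axis l s) = poly P s" using line[OF F(1)] by blast
    have "poly P 0 \<noteq> 0" using F(2) P[rule_format, of 0] by (simp add: axis_def)
    moreover have "(poly P \<longlongrightarrow> poly P 0) (nhds 0)"
      using isCont_def[of 0 "poly P"] by (simp add: tendsto_at_iff_tendsto_nhds)
    ultimately have "eventually (\<lambda>s. poly P s \<noteq> 0) (nhds 0)"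
      by (intro tendsto_imp_eventually_ne)
    then show ?thesis
      by eventually_elim (use F(3) P axis_mem_Z[OF l] in auto)
  qed
  have coord_axis: "coord (1\<^sub>m n) l (?\<gamma> k s) = (if k = l then s else 0)" if "l \<in> blk" for k l s
    using big_cell_chart(2)[of l "axis k s"] that blk_idx by (auto simp: axis_def)
  show ?thesis
  proof (rule card_generators_ge[where \<gamma> = ?\<gamma> and a = "coord (1\<^sub>m n)", OF _ base _ cont _ _ _ S])
    fix l assume l: "l \<in> blk"
    show "coord (1\<^sub>m n) l \<in> reg"
      using l blk_idx coord_reg[OF one_SL] openin_chart_dom[OF one_SL] big_cell_chart(1)[of "\<lambda>_. 0"] base_mem_Z
      by (intro reg_at_X[of "chart_dom (1\<^sub>m n)"]) (auto simp: \<sigma>_0)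
    show "coord (1\<^sub>m n) l (proj (1\<^sub>m n)) = 0"
      using coord_axis[OF l, of l 0] base by simp
    show "((\<lambda>s. coord (1\<^sub>m n) l (?\<gamma> k s)) has_field_derivative (if k = l then 1 else 0)) (at 0)" for k
      unfolding coord_axis[OF l] by (auto intro!: derivative_eq_intros)
    fix f assume "f \<in> reg"
    \<comment> \<open>Along an axis \<open>f\<close> is a quotient of polynomials in
      \<open>s\<close> whose denominator is nonzero at 0, hence differentiable.\<close>
    from chart_fraction[OF one_SL this] obtain V p q where V: "openin (fs_top X) V" "proj (1\<^sub>m n) \<in> V"
      "p \<in> mpoly_fun idx" "q \<in> mpoly_fun idx"
      "\<forall>a. proj (\<sigma> a) \<in> V \<longrightarrow> q a \<noteq> 0 \<and> f (proj (\<sigma> a)) = p a / q a"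
      unfolding one_mult_\<sigma> by blast
    obtain P Q where PQ: "\<forall>s. p (axis l s) = poly P s" "\<forall>s. q (axis l s) = poly Q s"
      using line[OF V(3)] line[OF V(4)] by blast
    have "?\<gamma> l 0 \<in> V" using V(2) base by simp
    then have "poly Q 0 \<noteq> 0" using V(5) PQ(2) by metis
    then have "((\<lambda>s. poly P s / poly Q s) has_field_derivative
        (poly (pderiv P) 0 * poly Q 0 - poly P 0 * poly (pderiv Q) 0) / (poly Q 0 * poly Q 0)) (at 0)"
      by (intro DERIV_divide poly_DERIV)
    moreover have ev: "eventually (\<lambda>s. poly P s / poly Q s = f (?\<gamma> l s)) (nhds 0)"
      using cont[OF l V(1,2)] by eventually_elim (use V(5) PQ in auto)
    ultimately show "\<exists>D. ((\<lambda>s. f (?\<gamma> l s)) has_field_derivative D) (at 0)"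
      using DERIV_cong_ev[OF refl ev refl] by blast
  qed simp
qed

section \<open>The torus action in the big cell\<close>

lemma Torus_entries:
  assumes "\<tau> \<in> Torus n"
  shows "\<tau> \<in> SLn" "i < n \<Longrightarrow> j < n \<Longrightarrow> i \<noteq> j \<Longrightarrow> \<tau> $$ (i, j) = 0" "i < n \<Longrightarrow> \<tau> $$ (i, i) \<noteq> 0"
proof -
  show c: "\<tau> \<in> SLn" using assms by (simp add: Torus_def)
  show off: "\<tau> $$ (i, j) = 0" if "i < n" "j < n" "i \<noteq> j" for i j
    using assms that by (auto simp: Torus_def diagonal_mat_def carrier_SL_iff)
  have "upper_triangular \<tau>" using off c by (auto simp: carrier_SL_iff)
  then have "1 = (\<Prod>i\<in>{0..<n}. \<tau> $$ (i, i))"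
    using det_upper_triangular[of \<tau> n] c by (simp add: carrier_SL_iff prod_list_diag_prod)
  then show "\<tau> $$ (i, i) \<noteq> 0" if "i < n" using that
    by (metis atLeastLessThan_iff finite_atLeastLessThan prod_zero_iff zero_le zero_neq_one)
qed

lemma Torus_mult_entry:
  assumes "\<tau> \<in> Torus n" "A \<in> carrier_mat n n" "i < n" "j < n"
  shows "(\<tau> * A) $$ (i, j) = \<tau> $$ (i, i) * A $$ (i, j)" "(A * \<tau>) $$ (i, j) = A $$ (i, j) * \<tau> $$ (j, j)"
proof -
  note T = Torus_entries[OF assms(1)]
  have "(\<tau> * A) $$ (i, j) = (\<Sum>l<n. if l = i then \<tau> $$ (i, i) * A $$ (i, j) else 0)"
    unfolding mult_entry[OF SL_carrier_mat[OF T(1)] assms(2-4)]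
    using T(2)[OF assms(3)] by (intro sum.cong) auto
  then show "(\<tau> * A) $$ (i, j) = \<tau> $$ (i, i) * A $$ (i, j)" using assms(3) by simp
  have "(A * \<tau>) $$ (i, j) = (\<Sum>l<n. if l = j then A $$ (i, j) * \<tau> $$ (j, j) else 0)"
    unfolding mult_entry[OF assms(2) SL_carrier_mat[OF T(1)] assms(3,4)]
    using T(2)[OF _ assms(4)] by (intro sum.cong) auto
  then show "(A * \<tau>) $$ (i, j) = A $$ (i, j) * \<tau> $$ (j, j)" using assms(4) by simp
qed

text \<open>Moving the torus element to the right past \<open>\<sigma> c\<close> rescales the
  entries, and there it is absorbed by \<open>P\<close>.\<close>

lemma Torus_proj_\<sigma>:
  assumes \<tau>: "\<tau> \<in> Torus n"
  shows "proj (\<tau> * \<sigma> c) = proj (\<sigma> (\<lambda>(i, j). \<tau> $$ (i, i) * c (i, j) / \<tau> $$ (j, j)))"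
proof -
  note T = Torus_entries[OF \<tau>]
  let ?c = "\<lambda>(i, j). \<tau> $$ (i, i) * c (i, j) / \<tau> $$ (j, j)"
  have "\<tau> * \<sigma> c = \<sigma> ?c * \<tau>"
  proof (rule eq_matI)
    fix i j assume "i < dim_row (\<sigma> ?c * \<tau>)" "j < dim_col (\<sigma> ?c * \<tau>)"
    then have ij: "i < n" "j < n" using SL_carrier_mat[OF T(1)] \<sigma>_carrier[of ?c] by auto
    show "(\<tau> * \<sigma> c) $$ (i, j) = (\<sigma> ?c * \<tau>) $$ (i, j)"
      unfolding Torus_mult_entry[OF \<tau> \<sigma>_carrier ij] using ij T(3)[OF ij(2)] by (auto simp: \<sigma>_entry)
  qed (use SL_carrier_mat[OF T(1)] \<sigma>_carrier[of ?c] \<sigma>_carrier[of c] in auto)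
  moreover have "\<tau> \<in> Parabolic n d" using T by (auto simp: Parabolic_iff)
  ultimately show ?thesis using proj_mult_P[OF \<sigma>_SL] by simp
qed

lemma Torus_quotient:
  assumes "\<tau> \<in> Torus n" "\<tau>' \<in> Torus n"
  obtains \<rho> where "\<rho> \<in> Torus n" "\<rho> * \<tau>' = \<tau>"
proof -
  note T = Torus_entries[OF assms(1)] and T' = Torus_entries[OF assms(2)]
  define \<rho> where "\<rho> = mat n n (\<lambda>(i, j). if i = j then \<tau> $$ (i, i) / \<tau>' $$ (i, i) else 0)"
  have \<rho>: "\<rho> \<in> carrier_mat n n" by (simp add: \<rho>_def)
  have eq: "\<rho> * \<tau>' = \<tau>"
  proof (rule eq_matI)
    fix i j assume "i < dim_row \<tau>" "j < dim_col \<tau>"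
    then have ij: "i < n" "j < n" using SL_carrier_mat[OF T(1)] by auto
    show "(\<rho> * \<tau>') $$ (i, j) = \<tau> $$ (i, j)"
      unfolding Torus_mult_entry(2)[OF assms(2) \<rho> ij] using ij T(2)[OF ij] T'(3)[OF ij(2)] by (auto simp: \<rho>_def)
  qed (use SL_carrier_mat[OF T(1)] SL_carrier_mat[OF T'(1)] \<rho> in auto)
  then have "det \<rho> = 1" using det_mult[OF \<rho> SL_carrier_mat[OF T'(1)]] T(1) T'(1) by (simp add: carrier_SL_iff)
  then have "\<rho> \<in> Torus n" using \<rho> by (simp add: Torus_def carrier_SL_iff diagonal_mat_def \<rho>_def)
  then show ?thesis using eq that by blast
qed

lemma big_cell_open: "openin (fs_top X) (chart_dom (1\<^sub>m n) \<inter> Z)"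
  using openin_chart_dom[OF one_SL] by (auto simp: openin_sub_Gr)

lemma base_big_cell: "proj (1\<^sub>m n) \<in> chart_dom (1\<^sub>m n) \<inter> Z"
  using big_cell_chart(1)[of "\<lambda>_. 0"] base_mem_Z by (simp add: \<sigma>_0)

text \<open>A dense orbit is the image of a monomial map, and the monomials \<open>c i j * \<tau> i / \<tau> j\<close> depend on
  one parameter per row and column of the block, up to a common factor.\<close>

lemma krull_dim_toric:
  assumes lfr: "local_function_ring X (proj (1\<^sub>m n))" and "m < d"
    and C: "C \<in> Z" "fs_top X closure_of torus_orbit n C = Z"
  shows "krull_dim (local_ring X (proj (1\<^sub>m n))) \<le> enat (card ({d..t} \<union> {m..<d - 1}))"
proof -
  interpret local_function_ring X "proj (1\<^sub>m n)" by (rule lfr)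
  let ?U = "chart_dom (1\<^sub>m n) \<inter> Z"
  obtain g where g: "g \<in> SLn" "C = proj g" using C(1) Z_subset by (auto simp: topspace_Gr)
  have meets: "\<exists>\<tau>\<in>Torus n. proj (\<tau> * g) \<in> W" if W: "openin (fs_top X) W" "W \<noteq> {}" for W
  proof -
    obtain y where "y \<in> W" using W(2) by blast
    moreover have "W \<subseteq> Z" using openin_subset[OF W(1)] topspace_X by simp
    ultimately have "y \<in> fs_top X closure_of torus_orbit n C" using C(2) by blast
    then obtain y' where "y' \<in> torus_orbit n C" "y' \<in> W" using \<open>y \<in> W\<close> W(1) by (auto simp: in_closure_of)
    then show ?thesis using g Torus_entries(1) by (auto simp: torus_orbit_def proj_left_mult)
  qed
  \<comment> \<open>The dense orbit meets the open big cell; this point replaces \<open>C\<close> as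
    the reference point of the orbit, with coordinates \<open>c\<close> supported on the
    block.\<close>
  obtain \<tau>0 where \<tau>0: "\<tau>0 \<in> Torus n" "proj (\<tau>0 * g) \<in> ?U"
    using meets[OF big_cell_open] base_big_cell by blast
  define c where "c ij = coord (1\<^sub>m n) ij (proj (\<tau>0 * g))" for ij
  have c: "proj (\<tau>0 * g) = proj (\<sigma> c)" using big_cell_surj[of "proj (\<tau>0 * g)"] \<tau>0(2) by (simp add: c_def[abs_def])
  have c0: "c ij = 0" if "ij \<in> idx" "ij \<notin> blk" for ij
    unfolding c_def using coord_Z_eq_0[OF _ _ that] \<tau>0(2) by blast
  define I where "I = {d..t} \<union> {m..<d - 1}"
  \<comment> \<open>Dividing by the torus entry of column d - 1 fixes the common factor:
    \<open>z i\<close> stands for \<rho> i / \<rho> (d - 1) in a row, \<open>z j\<close> for \<rho>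
    (d - 1) / \<rho> j in a column, and column d - 1 gets no parameter.\<close>
  define A where "A z = (\<lambda>(i, j). if (i, j) \<in> blk then c (i, j) * z i * (if j = d - 1 then 1 else z j) else 0)"
    for z :: "nat \<Rightarrow> complex"
  have Apoly: "(\<lambda>z. A z ij) \<in> mpoly_fun I" for ij
  proof -
    obtain i j where ij: "ij = (i, j)" by (cases ij)
    have "(\<lambda>z. c (i, j) * z i) \<in> mpoly_fun I" "(\<lambda>z. c (i, j) * z i * z j) \<in> mpoly_fun I"
      if "(i, j) \<in> blk" "j \<noteq> d - 1"
      using that by (auto intro!: mpoly_fun.mult mpoly_fun.const mpoly_fun.var simp: I_def)
    moreover have "(\<lambda>z. c (i, j) * z i) \<in> mpoly_fun I" if "(i, j) \<in> blk"
      using that by (auto intro!: mpoly_fun.mult mpoly_fun.const mpoly_fun.var simp: I_def)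
    ultimately show ?thesis
      unfolding A_def ij prod.case
      by (cases "(i, j) \<in> blk"; cases "j = d - 1") (simp_all only: if_True if_False mult_1_right mpoly_fun.const refl not_False_eq_True)
  qed
  have "krull_dim R \<le> enat (card I)"
  proof (rule krull_dim_le)
    show "finite I" by (simp add: I_def)
    show "parametrized I (\<lambda>z. proj (1\<^sub>m n * \<sigma> (A z)))"
      by (rule chart_parametrized[OF lfr one_SL Apoly])
    show "openin (fs_top X) ?U" by (rule big_cell_open)
    show "proj (1\<^sub>m n) \<in> ?U" by (rule base_big_cell)
    fix W assume "openin (fs_top X) W" "W \<subseteq> ?U" "W \<noteq> {}"
    then obtain \<tau> where \<tau>: "\<tau> \<in> Torus n" "proj (\<tau> * g) \<in> W" using meets by blast
    obtain \<rho> where \<rho>: "\<rho> \<in> Torus n" "\<rho> * \<tau>0 = \<tau>" by (rule Torus_quotient[OF \<tau>(1) \<tau>0(1)])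
    note R = Torus_entries[OF \<rho>(1)]
    have "proj (\<tau> * g) = \<rho> <#\<^bsub>SL n\<^esub> proj (\<tau>0 * g)"
      using proj_left_mult[OF R(1) SL_mult_closed[OF Torus_entries(1)[OF \<tau>0(1)] g(1)]]
        SL_assoc[OF R(1) Torus_entries(1)[OF \<tau>0(1)] g(1)] \<rho>(2) by simp
    also have "\<dots> = proj (\<rho> * \<sigma> c)" unfolding c by (rule proj_left_mult[OF R(1) \<sigma>_SL])
    also have "\<dots> = proj (\<sigma> (\<lambda>(i, j). \<rho> $$ (i, i) * c (i, j) / \<rho> $$ (j, j)))" by (rule Torus_proj_\<sigma>[OF \<rho>(1)])
    also have "\<sigma> (\<lambda>(i, j). \<rho> $$ (i, i) * c (i, j) / \<rho> $$ (j, j))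
        = \<sigma> (A (\<lambda>i. if d \<le> i then \<rho> $$ (i, i) / \<rho> $$ (d - 1, d - 1) else \<rho> $$ (d - 1, d - 1) / \<rho> $$ (i, i)))"
    proof (rule \<sigma>_cong)
      fix ij assume "ij \<in> idx"
      then obtain i j where ij: "ij = (i, j)" "d \<le> i" "i < n" "j < d" by auto
      have j: "j < d - 1 \<or> j = d - 1" "d - 1 < n" "j < n" using ij d_less by auto
      show "(\<lambda>(i, j). \<rho> $$ (i, i) * c (i, j) / \<rho> $$ (j, j)) ij = A (\<lambda>i. if d \<le> i then \<rho> $$ (i, i) / \<rho> $$ (d - 1, d - 1)
          else \<rho> $$ (d - 1, d - 1) / \<rho> $$ (i, i)) ij"
      proof (cases "(i, j) \<in> blk")
        case True
        then show ?thesis using j(1) R(3)[OF j(2)] R(3)[OF j(3)] ij by (auto simp: A_def)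
      next
        case False
        then have "c (i, j) = 0" using ij by (intro c0) auto
        then show ?thesis using False by (simp add: A_def ij(1))
      qed
    qed
    finally show "\<exists>z. proj (1\<^sub>m n * \<sigma> (A z)) \<in> W" using \<tau>(2) unfolding one_mult_\<sigma> by (intro exI) (simp only:)
  qed
  then show ?thesis by (simp only: I_def)
qed

theorem smooth_imp_row_or_column:
  assumes toric: "toric_Schubert n d w" and smooth: "smooth_variety X"
  shows "d - 1 \<le> m \<or> t \<le> d"
proof (rule ccontr)
  assume "\<not> ?thesis"
  then have mt: "m < d - 1" "d < t" by auto
  let ?x = "proj (1\<^sub>m n)"
  have normal: "normal_variety X" using toric by (simp add: toric_Schubert_def Schubert_variety_eq)
  have lfr: "local_function_ring X ?x" by (rule local_function_ring_X[OF normal base_mem_Z])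
  obtain C where C: "C \<in> Z" "fs_top X closure_of torus_orbit n C = Z"
    using toric by (auto simp: toric_Schubert_def Schubert_variety_eq topspace_X)
  have "smooth_at X ?x" using smooth base_mem_Z topspace_X by (simp add: smooth_variety_def)
  then obtain S where S: "finite S" "S \<subseteq> carrier (local_ring X ?x)" "Idl\<^bsub>local_ring X ?x\<^esub> S = local_max_ideal X ?x"
    "enat (card S) = krull_dim (local_ring X ?x)" unfolding smooth_at_def by blast
  have "enat (card S) \<le> enat (card ({d..t} \<union> {m..<d - 1}))"
    using krull_dim_toric[OF lfr _ C] mt S(4) by simp
  then have "card blk \<le> card ({d..t} \<union> {m..<d - 1})"
    using card_blk_le_generators[OF lfr S(1-3)] by simp
  also have "\<dots> \<le> card {d..t} + card {m..<d - 1}" by (rule card_Un_le)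
  finally have le: "(Suc t - d) * (d - m) \<le> (Suc t - d) + (d - 1 - m)" by (simp add: card_cartesian_product)
  \<comment> \<open>\<open>a\<close> and \<open>b\<close> are one less than the side lengths of the
    block, and the inequality reduces to a * b = 0.\<close>
  define a b where "a = t - d" and "b = d - 1 - m"
  have ab: "Suc t - d = Suc a" "d - m = Suc b" "1 \<le> a" "1 \<le> b" using mt by (auto simp: a_def b_def)
  have "Suc a * Suc b \<le> Suc a + b" using le ab by (simp add: b_def)
  then have "a * b = 0" by simp
  then show False using ab by simp
qed

section \<open>Blocks with a single row or column\<close>

text \<open>A block with one column is a case of \<open>mem_Z_column\<close>. If the block has one
  row, a column operation from \<open>P\<close> clears all but one of its entries without changing
  the coset.\<close>

lemma block_mem_Z:
  assumes shape: "d - 1 \<le> m \<or> t \<le> d" and a: "\<And>ij. ij \<in> idx \<Longrightarrow> ij \<notin> blk \<Longrightarrow> a ij = 0"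
  shows "proj (\<sigma> a) \<in> Z"
proof (cases "\<forall>ij\<in>idx. a ij = 0")
  case True
  then have "\<sigma> a = \<sigma> (\<lambda>_. 0)" by (intro \<sigma>_cong) blast
  then have "\<sigma> a = 1\<^sub>m n" by (simp add: \<sigma>_0)
  then show ?thesis using base_mem_Z by simp
next
  case False
  then obtain i0 j0 where ij0: "(i0, j0) \<in> blk" "a (i0, j0) \<noteq> 0" using a by fast
  show ?thesis
  proof (cases "d - 1 \<le> m")
    case True
    show ?thesis
    proof (rule mem_Z_column[OF \<sigma>_SL, of "d - 1"])
      fix i k assume "k < i" "i < n" "k < d" "k \<noteq> d - 1"
      moreover from this have "\<not> m \<le> k" using True by linarith
      ultimately show "\<sigma> a $$ (i, k) = 0" using a[of "(i, k)"] by (auto simp: \<sigma>_entry)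
    next
      fix i assume "t < i" "i < n"
      then show "\<sigma> a $$ (i, d - 1) = 0" using a[of "(i, d - 1)"] d_less t_ge by (auto simp: \<sigma>_entry)
    qed (use True ij0 d_pos in auto)
  next
    case False
    then have td: "t = d" using shape ij0 by auto
    \<comment> \<open>\<open>p\<close> is the column of the first nonzero entry, so that the others
      are cleared to its right and \<open>u\<close> is upper triangular.\<close>
    define p where "p = (LEAST j. m \<le> j \<and> j < d \<and> a (d, j) \<noteq> 0)"
    have "m \<le> j0 \<and> j0 < d \<and> a (d, j0) \<noteq> 0" using ij0 td by auto
    then have p: "m \<le> p" "p < d" "a (d, p) \<noteq> 0"
      unfolding p_def by (metis (mono_tags, lifting) LeastI)+
    have less_p: "a (d, j) = 0" if "m \<le> j" "j < p" for j
      using not_less_Least[OF that(2)[unfolded p_def]] that p(2) by auto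
    have dn: "d < n" by (rule d_less)
    have a0: "a (i, j) = 0" if "d \<le> i" "i < n" "j < d" "i \<noteq> d \<or> j < p" for i j
      using a[of "(i, j)"] less_p[of j] that td by (cases "(i, j) \<in> blk") auto
    \<comment> \<open>Subtracts a multiple of column \<open>p\<close> from each later column below
      \<open>d\<close>; the new entries in row \<open>p\<close> are above the diagonal.\<close>
    define u where "u = mat n n (\<lambda>(i, k). if i = k then 1
      else if i = p \<and> p < k \<and> k < d then - a (d, k) / a (d, p) else 0)"
    have u: "u \<in> carrier_mat n n" "upper_triangular u" by (simp add: u_def) (rule upper_triangularI, auto simp: u_def)
    have "det u = 1" by (rule det_unitriangular[OF u]) (simp add: u_def)
    then have uB: "u \<in> Borel n" using u by (simp add: Borel_def carrier_SL_iff)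
    then have uP: "u \<in> Parabolic n d" using d_less by (auto simp: Borel_eq)
    have entry: "(\<sigma> a * u) $$ (i, k) = \<sigma> a $$ (i, k) +
        (if p < k \<and> k < d then - a (d, k) / a (d, p) * \<sigma> a $$ (i, p) else 0)" if "i < n" "k < n" for i k
    proof -
      have "(\<sigma> a * u) $$ (i, k) = (\<Sum>l<n. (if l = k then \<sigma> a $$ (i, k) else 0) +
          (if l = p then if p < k \<and> k < d then - a (d, k) / a (d, p) * \<sigma> a $$ (i, p) else 0 else 0))"
        unfolding mult_entry[OF \<sigma>_carrier u(1) that] using that by (intro sum.cong) (auto simp: u_def)
      then show ?thesis using that p(2) dn by (simp add: sum.distrib)
    qed
    have "proj (\<sigma> a * u) \<in> Z"
    proof (rule mem_Z_column[OF SL_mult_closed[OF \<sigma>_SL Borel_SL[OF uB]] p(1,2)])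
      fix i k assume ik: "k < i" "i < n" "k < d" "k \<noteq> p"
      then have kn: "k < n" using dn by simp
      show "(\<sigma> a * u) $$ (i, k) = 0"
      proof (cases "p < k")
        case True
        then show ?thesis unfolding entry[OF ik(2) kn] using ik p dn a0[of i k] a0[of i p]
          by (cases "i = d") (auto simp: \<sigma>_entry)
      next
        case False
        then show ?thesis unfolding entry[OF ik(2) kn] using ik dn a0[of i k] by (auto simp: \<sigma>_entry)
      qed
    next
      fix i assume i: "t < i" "i < n"
      then show "(\<sigma> a * u) $$ (i, p) = 0"
        unfolding entry[OF i(2) less_trans[OF p(2) dn]] using p dn td a0[of i p] by (auto simp: \<sigma>_entry)
    qed
    then show ?thesis using proj_mult_P[OF \<sigma>_SL uP] by simp
  qed
qed

text \<open>The chart is centred at \<open>x\<close> itself. An element \<open>b\<close> of the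
  Borel subgroup identifies it, up to a shift by \<open>a0\<close>, with the big cell, where X is
  the whole coordinate space of the block.\<close>

theorem row_or_column_imp_smooth:
  assumes shape: "d - 1 \<le> m \<or> t \<le> d" and normal: "normal_variety X"
  shows "smooth_variety X"
  unfolding smooth_variety_def topspace_X
proof
  fix x assume x: "x \<in> Z"
  then obtain g where g: "g \<in> SLn" "x = proj g" using Z_subset by (auto simp: topspace_Gr)
  obtain b where b: "b \<in> Borel n" "\<Delta> (b * g) \<noteq> 0" using Borel_into_big_cell[OF g(1)] by blast
  have b': "b \<in> SLn" by (rule Borel_SL[OF b(1)])
  have bi: "minv b \<in> SLn" using b' by simp
  have bg: "b * g \<in> SLn" by (rule SL_mult_closed[OF b' g(1)])
  have bx: "proj (b * g) \<in> Z" using Z_Borel[OF b(1) x] g proj_left_mult[OF b'] by simp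
  have bx': "proj (b * g) \<in> chart_dom (1\<^sub>m n)"
    using mem_chart_dom[OF one_SL bg] b(2) SL_one_mult[OF bg] by simp
  define a0 where "a0 ij = coord (1\<^sub>m n) ij (proj (b * g))" for ij
  have a0: "proj (b * g) = proj (\<sigma> a0)" using big_cell_surj[OF bx'] by (simp add: a0_def[abs_def])
  have a0_0: "a0 ij = 0" if "ij \<in> idx" "ij \<notin> blk" for ij
    unfolding a0_def by (rule coord_Z_eq_0[OF bx bx' that])
  \<comment> \<open>Another representative of the coset \<open>x\<close>, chosen so that chart
    coordinates \<open>c\<close> at \<open>x\<close> become \<open>a0 + c\<close> after applying
    \<open>b\<close>.\<close>
  define g0 where "g0 = minv b * \<sigma> a0"
  have g0: "g0 \<in> SLn" unfolding g0_def by (rule SL_mult_closed[OF bi \<sigma>_SL])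
  have g0_\<sigma>: "g0 * \<sigma> c = minv b * \<sigma> (\<lambda>k. a0 k + c k)" for c
    unfolding g0_def SL_assoc[OF bi \<sigma>_SL \<sigma>_SL] \<sigma>_mult ..
  have b_g0: "b <#\<^bsub>SL n\<^esub> proj (g0 * \<sigma> c) = proj (\<sigma> (\<lambda>k. a0 k + c k))" for c
    using proj_left_mult[OF b' SL_mult_closed[OF g0 \<sigma>_SL]] SL_cancel_right[OF b' \<sigma>_SL]
    by (simp add: g0_\<sigma>)
  have x_eq: "x = proj g0"
  proof -
    have "proj g0 = minv b <#\<^bsub>SL n\<^esub> proj (\<sigma> a0)" unfolding g0_def by (rule proj_left_mult[OF bi \<sigma>_SL, symmetric])
    also have "\<dots> = proj (minv b * (b * g))" unfolding a0[symmetric] by (rule proj_left_mult[OF bi bg])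
    finally show ?thesis using SL_cancel_left[OF b' g(1)] g(2) by simp
  qed
  have lfr: "local_function_ring X (proj g0)"
    using local_function_ring_X[OF normal x] x_eq by simp
  interpret local_function_ring X "proj g0" by (rule lfr)
  let ?h = "minv g0"
  have h: "?h \<in> SLn" using g0 by simp
  define A where "A z = (\<lambda>ij. if ij \<in> blk then z ij else 0)" for z :: "nat \<times> nat \<Rightarrow> complex"
  have Apoly: "(\<lambda>z. A z ij) \<in> mpoly_fun blk" for ij
    by (cases "ij \<in> blk") (simp_all only: A_def if_True if_False mpoly_fun.var mpoly_fun.const)
  have \<psi>Z: "proj (g0 * \<sigma> (A z)) \<in> Z" for z
  proof -
    have "proj (\<sigma> (\<lambda>k. a0 k + A z k)) \<in> Z"
      by (rule block_mem_Z[OF shape]) (simp add: A_def a0_0)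
    then have "minv b <#\<^bsub>SL n\<^esub> proj (\<sigma> (\<lambda>k. a0 k + A z k)) \<in> Z" by (rule Z_Borel[OF Borel_inv[OF b(1)]])
    then show ?thesis unfolding g0_\<sigma> proj_left_mult[OF bi \<sigma>_SL] .
  qed
  have g0_1: "g0 * \<sigma> (\<lambda>_. 0) = g0" using SL_mult_one[OF g0] by (simp add: \<sigma>_0)
  let ?U = "chart_dom ?h \<inter> Z"
  have x_U: "proj g0 \<in> ?U" using chart_\<sigma>(1)[OF g0, of "\<lambda>_. 0"] x x_eq by (simp add: g0_1)
  have "smooth_at X (proj g0)"
  proof (rule smooth_at_chart[where I = blk and \<psi> = "\<lambda>z. proj (g0 * \<sigma> (A z))" and y = "coord ?h" and U = ?U])
    show "parametrized blk (\<lambda>z. proj (g0 * \<sigma> (A z)))" by (rule chart_parametrized[OF lfr g0 Apoly])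
    show "coord ?h ij \<in> reg" if "ij \<in> blk" for ij
      by (rule reg_at_X[OF openin_chart_dom[OF h] coord_reg[OF h]]) (use that blk_idx x_U in auto)
    show "openin (fs_top X) ?U" using openin_chart_dom[OF h] by (auto simp: openin_sub_Gr)
    show "proj g0 \<in> ?U" by (rule x_U)
    show "coord ?h ij (proj (g0 * \<sigma> (A z))) = z ij" if "ij \<in> blk" for z ij
      using chart_\<sigma>(2)[OF g0, of ij "A z"] that blk_idx by (auto simp: A_def)
    show "proj (g0 * \<sigma> (A (\<lambda>_. 0))) = proj g0" by (simp add: A_def g0_1)
  next
    fix y assume y: "y \<in> ?U"
    define c where "c ij = coord ?h ij y" for ij
    have yc: "y = proj (g0 * \<sigma> c)" using chart_surj[OF g0, of y] y by (simp add: c_def[abs_def])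
    \<comment> \<open>Both \<open>a0 + c\<close>, the coordinates of the point moved by
      \<open>b\<close>, and \<open>a0\<close> itself vanish outside the block.\<close>
    have "c ij = 0" if ij: "ij \<in> idx" "ij \<notin> blk" for ij
    proof -
      have "proj (\<sigma> (\<lambda>k. a0 k + c k)) \<in> Z" using Z_Borel[OF b(1), of y] y b_g0[of c] yc by simp
      then have "coord (1\<^sub>m n) ij (proj (\<sigma> (\<lambda>k. a0 k + c k))) = 0"
        by (rule coord_Z_eq_0[OF _ big_cell_chart(1) ij])
      then show ?thesis using big_cell_chart(2)[OF ij(1)] a0_0[OF ij] by simp
    qed
    then have "\<sigma> (A (\<lambda>i. if i \<in> blk then coord ?h i y else 0)) = \<sigma> c"
      by (intro \<sigma>_cong) (auto simp: A_def c_def)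
    then show "y = proj (g0 * \<sigma> (A (\<lambda>i. if i \<in> blk then coord ?h i y else 0)))" using yc by simp
  next
    fix V assume V: "openin (fs_top X) V" "proj g0 \<in> V"
    obtain F where F: "F \<in> mpoly_fun idx" "F (\<lambda>_. 0) \<noteq> 0"
      "\<forall>a. F a \<noteq> 0 \<longrightarrow> proj (g0 * \<sigma> a) \<in> Z \<longrightarrow> proj (g0 * \<sigma> a) \<in> V"
      using chart_continuous[OF g0 V] by blast
    show "\<exists>F\<in>mpoly_fun blk. F (\<lambda>_. 0) \<noteq> 0 \<and> (\<forall>z. F z \<noteq> 0 \<longrightarrow> proj (g0 * \<sigma> (A z)) \<in> V)"
    proof (intro bexI[OF _ mpoly_fun_compose[OF F(1) Apoly]] conjI allI impI)
      have "A (\<lambda>_. 0) = (\<lambda>_. 0)" by (auto simp: A_def)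
      then show "F (A (\<lambda>_. 0)) \<noteq> 0" using F(2) by simp
      fix z assume "F (A z) \<noteq> 0"
      then show "proj (g0 * \<sigma> (A z)) \<in> V" using F(3) \<psi>Z by blast
    qed
  qed simp
  then show "smooth_at X x" by (simp add: x_eq)
qed

end

section \<open>Reduced words and partitions\<close>

lemma word_prod_Nil [simp]: "word_prod [] = id"
  and word_prod_Cons: "word_prod (i # is) = Transposition.transpose i (i + 1) \<circ> word_prod is"
  by (simp_all add: word_prod_def)

lemma word_prod_permutes: "set is \<subseteq> {1..n - 1} \<Longrightarrow> word_prod is permutes {1..n}"
proof (induction "is")
  case Nil
  show ?case unfolding word_prod_Nil by (rule permutes_id)
next
  case (Cons i "is")
  have "Transposition.transpose i (i + 1) permutes {1..n}"
    using Cons.prems by (intro permutes_swap_id) auto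
  then show ?case unfolding word_prod_Cons using Cons by (intro permutes_compose) auto
qed

text \<open>Each letter moves a value by at most 1. This is the lower bound for word lengths that
  makes the two kinds of words reduced.\<close>

lemma word_prod_displacement:
  "word_prod is k \<le> k + length is" "k \<le> word_prod is k + length is"
proof (induction "is")
  case (Cons i "is")
  have "Transposition.transpose i (i + 1) l \<le> l + 1" "l \<le> Transposition.transpose i (i + 1) l + 1" for l
    by (auto simp: Transposition.transpose_def)
  from this[of "word_prod is k"] Cons
  show "word_prod (i # is) k \<le> k + length (i # is)" "k \<le> word_prod (i # is) k + length (i # is)"
    by (simp_all add: word_prod_Cons)
qed auto

text \<open>\<open>rev [d..<d + x]\<close> spells the word of form (a). Its product fixes all but
  the last of 1, ..., d, which is why the partition has a single part.\<close>

lemma word_prod_row: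
  "word_prod (rev [d..<d + x]) = (\<lambda>k. if k = d then d + x else if d < k \<and> k \<le> d + x then k - 1 else k)"
proof (induction x)
  case (Suc x)
  have "rev [d..<d + Suc x] = (d + x) # rev [d..<d + x]" by simp
  then show ?case unfolding word_prod_Cons Suc
    by (auto simp: word_prod_Cons Suc Transposition.transpose_def fun_eq_iff)
qed auto

text \<open>\<open>[d - y..<d + 1]\<close> spells the word of form (b). Its product raises each of
  the last y + 1 of 1, ..., d by one, which gives a column of y + 1 ones.\<close>

lemma word_prod_column:
  "y < d \<Longrightarrow> word_prod [d - y..<d + 1] =
    (\<lambda>k. if k = d + 1 then d - y else if d - y \<le> k \<and> k \<le> d then k + 1 else k)"
proof (induction y)
  case 0
  then show ?case by (auto simp: word_prod_Cons Transposition.transpose_def fun_eq_iff)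
next
  case (Suc y)
  then have eq: "[d - Suc y..<d + 1] = (d - Suc y) # [d - y..<d + 1]"
    by (subst upt_conv_Cons) (auto simp: Suc_diff_Suc)
  show ?case unfolding eq word_prod_Cons Suc.IH[OF Suc_lessD[OF Suc.prems]]
    using Suc.prems by (auto simp: Transposition.transpose_def fun_eq_iff)
qed

text \<open>Both functions list the same set in increasing order. At the first index where they
  differ, the smaller value would have to appear in the other list before that index, where the
  lists agree, contrary to strict monotonicity.\<close>

lemma strict_mono_on_eq_if_same_image:
  fixes f g :: "nat \<Rightarrow> nat"
  assumes f: "strict_mono_on I f" and g: "strict_mono_on I g" and im: "f ` I = g ` I" and k: "k \<in> I"
  shows "f k = g k"
  using k
proof (induction k rule: less_induct)
  case (less k)
  have aux: "\<not> p k < q k" if p: "strict_mono_on I p" and q: "strict_mono_on I q"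
    and sub: "p ` I \<subseteq> q ` I" and IH: "\<And>l. l < k \<Longrightarrow> l \<in> I \<Longrightarrow> p l = q l" for p q :: "nat \<Rightarrow> nat"
  proof
    assume lt: "p k < q k"
    obtain l where l: "l \<in> I" "p k = q l" using sub less.prems by blast
    have "l < k"
    proof (rule ccontr)
      assume "\<not> l < k"
      then have "q k \<le> q l" using q l(1) less.prems by (metis le_eq_less_or_eq not_less strict_mono_onD)
      then show False using lt l by simp
    qed
    then have "p l = q l" using l(1) by (rule IH)
    moreover have "p l < p k" using p l(1) less.prems \<open>l < k\<close> by (auto simp: strict_mono_on_def)
    ultimately show False using l(2) by simp
  qed
  have "\<not> f k < g k" by (rule aux[OF f g]) (use im less.IH in auto)
  moreover have "\<not> g k < f k" by (rule aux[OF g f]) (use im less.IH in auto)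
  ultimately show ?case by simp
qed

text \<open>The values on 1, ..., d determine the set of remaining values, and those are again
  listed in increasing order.\<close>

lemma min_coset_reps_eq:
  assumes u: "u \<in> min_coset_reps n d" and w: "w \<in> min_coset_reps n d"
    and eq: "\<And>k. 1 \<le> k \<Longrightarrow> k \<le> d \<Longrightarrow> u k = w k" and d: "d \<le> n"
  shows "u = w"
proof
  have pu: "u permutes {1..n}" and pw: "w permutes {1..n}" using u w by (auto simp: min_coset_reps_def)
  have split: "p ` {d+1..n} = {1..n} - p ` {1..d}" if "p permutes {1..n}" for p :: "nat \<Rightarrow> nat"
  proof -
    have "{d+1..n} = {1..n} - {1..d}" using d by auto
    then show ?thesis using image_set_diff[OF permutes_inj[OF that]] permutes_image[OF that] by simp
  qed
  have "u ` {1..d} = w ` {1..d}" using eq by (intro image_cong) auto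
  then have "u ` {d+1..n} = w ` {d+1..n}" by (simp only: split[OF pu] split[OF pw])
  then have upper: "u k = w k" if "k \<in> {d+1..n}" for k
    using strict_mono_on_eq_if_same_image[OF _ _ _ that, of u w] u w by (simp add: min_coset_reps_def)
  fix k
  consider "k \<notin> {1..n}" | "1 \<le> k" "k \<le> d" | "k \<in> {d+1..n}" by fastforce
  then show "u k = w k"
    by cases (use eq upper permutes_not_in[OF pu] permutes_not_in[OF pw] in auto)
qed

section \<open>Words and partitions in terms of m and t\<close>

context schubert
begin

lemma v_gap: "k \<le> l \<Longrightarrow> l < d \<Longrightarrow> v k + (l - k) \<le> v l"
proof (induction l rule: dec_induct)
  case (step l)
  then show ?case using v_mono[of l "Suc l"] by simp
qed simp

lemma m_cases: "m = d \<or> v m \<noteq> m"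
  unfolding m_def by (rule LeastI[of _ d]) simp

text \<open>The parts are listed from the last index to the first, so the trailing zeros that get
  stripped belong to the fixed indices below \<open>m\<close>.\<close>

lemma partition_eq: "partition_of_perm d w = rev (map (\<lambda>k. v k - k) [m..<d])"
proof -
  have "map (\<lambda>i. w (d - i + 1) - (d - i + 1)) [1..<d+1] = rev (map (\<lambda>k. v k - k) [0..<d])"
  proof (rule nth_equalityI)
    fix i assume "i < length (map (\<lambda>i. w (d - i + 1) - (d - i + 1)) [1..<d+1])"
    then have i: "i < d" by (simp del: upt_Suc)
    then have "d - (1 + i) + 1 = Suc (d - Suc i)" by simp
    with i show "map (\<lambda>i. w (d - i + 1) - (d - i + 1)) [1..<d+1] ! i = rev (map (\<lambda>k. v k - k) [0..<d]) ! i"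
      using w_v[of "d - Suc i"] d_less by (simp add: rev_nth nth_upt del: upt_Suc)
  qed (simp del: upt_Suc)
  moreover have "dropWhile (\<lambda>k. k = 0) (map (\<lambda>k. v k - k) [0..<d]) = map (\<lambda>k. v k - k) [m..<d]"
  proof -
    have "[0..<d] = [0..<m] @ [m..<d]" using upt_add_eq_append[of 0 m "d - m"] m_le by simp
    then have "dropWhile (\<lambda>k. k = 0) (map (\<lambda>k. v k - k) [0..<d]) = dropWhile (\<lambda>k. k = 0) (map (\<lambda>k. v k - k) [m..<d])"
      unfolding \<open>[0..<d] = _\<close> map_append by (subst dropWhile_append2) (auto simp: v_fixed)
    also have "\<dots> = map (\<lambda>k. v k - k) [m..<d]"
    proof (cases "m < d")
      case True
      then show ?thesis using v_moved[of m] by (simp add: upt_conv_Cons)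
    qed simp
    finally show ?thesis .
  qed
  ultimately show ?thesis unfolding partition_of_perm_def strip_while_def by simp
qed

text \<open>\<open>v k\<close> is squeezed: it is at least k + 1 since \<open>k\<close> is moved,
  and at most k + 1 since \<open>v\<close> has to increase strictly up to the value
  \<open>t = d\<close> at d - 1.\<close>

lemma v_eq_Suc:
  assumes "t = d" "m \<le> k" "k < d"
  shows "v k = Suc k"
proof -
  have "v k + (d - 1 - k) \<le> v (d - 1)" by (rule v_gap) (use assms in auto)
  then show ?thesis using v_moved[OF assms(2,3)] assms unfolding t_def by linarith
qed

text \<open>There are d - m parts and the largest, if there is one, is t + 1 - d; so the right side
  says that there is at most one part or that no part exceeds 1.\<close>

lemma partition_row_or_column:
  "partition_of_perm d w = [] \<or> column_partition (partition_of_perm d w) \<or> row_partition (partition_of_perm d w)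
    \<longleftrightarrow> d - 1 \<le> m \<or> t \<le> d"
proof
  assume "partition_of_perm d w = [] \<or> column_partition (partition_of_perm d w) \<or> row_partition (partition_of_perm d w)"
  then consider "m = d" | y where "1 \<le> y" "rev (map (\<lambda>k. v k - k) [m..<d]) = replicate y 1"
    | y where "rev (map (\<lambda>k. v k - k) [m..<d]) = [y]"
    using m_le by (auto simp: partition_eq column_partition_def row_partition_def)
  then show "d - 1 \<le> m \<or> t \<le> d"
  proof cases
    case 2
    from arg_cong[OF 2(2), of length] have y: "y = d - m" by simp
    from arg_cong[OF 2(2), of "\<lambda>p. p ! 0"] have "v (d - 1) - (d - 1) = 1"
      using y 2(1) by (simp add: rev_nth)
    then show ?thesis using d_pos unfolding t_def by linarith
  next
    case (3 y)
    from arg_cong[OF this, of length] have "d - m = 1" by simp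
    then show ?thesis by linarith
  qed simp
next
  assume "d - 1 \<le> m \<or> t \<le> d"
  then consider "m = d" | "m = d - 1" "m < d" | "m < d" "t = d"
    using m_le v_moved[of "d - 1"] d_pos by (fastforce simp: t_def)
  then show "partition_of_perm d w = [] \<or> column_partition (partition_of_perm d w) \<or> row_partition (partition_of_perm d w)"
  proof cases
    case 2
    then have "partition_of_perm d w = [v m - m]" by (simp add: partition_eq upt_conv_Cons)
    then show ?thesis using v_moved[of m] 2 by (auto simp: row_partition_def)
  next
    case 3
    have "map (\<lambda>k. v k - k) [m..<d] = map (\<lambda>_. 1) [m..<d]"
      using v_eq_Suc[OF 3(2)] by (intro map_cong) auto
    then have "partition_of_perm d w = replicate (d - m) 1" by (simp add: partition_eq map_replicate_const)
    then show ?thesis using 3(1) by (auto simp: column_partition_def)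
  qed (simp add: partition_eq)
qed

lemma eq_word_prodI:
  assumes "word_prod is \<in> min_coset_reps n d" "\<And>k. k < d \<Longrightarrow> word_prod is (Suc k) = Suc (v k)"
  shows "word_prod is = w"
proof (rule min_coset_reps_eq[OF assms(1) w])
  fix k assume k: "1 \<le> k" "k \<le> d"
  then obtain l where "k = Suc l" by (cases k) auto
  then show "word_prod is k = w k" using assms(2)[of l] w_v[of l] k d_less by simp
qed (use d_less in simp)

lemma reduced_word_row_or_column:
  "w = id \<or> (\<exists>x. 1 < x \<and> x \<le> n - d \<and> reduced_decomposition n w (rev [d..<d + x])) \<or>
     (\<exists>y. 0 \<le> y \<and> y \<le> d - 1 \<and> reduced_decomposition n w [d - y..<d + 1])
    \<longleftrightarrow> d - 1 \<le> m \<or> t \<le> d"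
  (is "?words \<longleftrightarrow> _")
proof
  assume ?words
  then consider "w = id" | x where "w = word_prod (rev [d..<d + x])"
    | y where "y \<le> d - 1" "w = word_prod [d - y..<d + 1]"
    by (auto simp: reduced_decomposition_def)
  then show "d - 1 \<le> m \<or> t \<le> d"
  proof cases
    case 1
    have "v (d - 1) = d - 1" unfolding v_def unfolding 1 by simp
    then show ?thesis unfolding t_def by simp
  next
    case (2 x)
    have "w (Suc k) = Suc k" if "k < d - 1" for k
      unfolding fun_cong[OF 2, of "Suc k"] word_prod_row using that by auto
    then have "v k = k" if "k < d - 1" for k using that by (simp add: v_def)
    then have "\<not> m < d - 1" using m_cases by auto
    then show ?thesis by simp
  next
    case (3 y)
    have "y < d" using 3(1) d_pos by simp
    have "w d = d + 1" unfolding fun_cong[OF 3(2), of d] word_prod_column[OF \<open>y < d\<close>] by simp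
    then show ?thesis using d_pos unfolding t_def v_def by simp
  qed
next
  assume shape: "d - 1 \<le> m \<or> t \<le> d"
  \<comment> \<open>The case t < d is the identity. A single letter, with t = d and m = d - 1, is
    treated as form (b) with y = 0, so form (a) starts at x = 2.\<close>
  consider "t < d" | "t = d" | "d < t" "d - 1 \<le> m" using shape by linarith
  then show ?words
  proof cases
    case 1
    have "v k = k" if "k < d" for k
    proof -
      have "v k + (d - 1 - k) \<le> v (d - 1)" by (rule v_gap) (use that in auto)
      then show ?thesis using v_ge[OF that] 1 that unfolding t_def by linarith
    qed
    moreover have "word_prod [] \<in> min_coset_reps n d"
      by (simp add: min_coset_reps_def permutes_id strict_mono_on_def)
    ultimately have "word_prod [] = w" by (intro eq_word_prodI) auto
    then show ?thesis by simp
  next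
    case 2
    have "m < d" using 2 v_fixed[of "d - 1"] d_pos m_le by (cases "m = d") (auto simp: t_def)
    \<comment> \<open>The length y + 1 of the word is the number \<open>d - m\<close> of moved
      indices.\<close>
    define y where "y = d - 1 - m"
    have y: "y < d" "d - y = Suc m" "y \<le> d - 1" using \<open>m < d\<close> by (auto simp: y_def)
    define ws where "ws = [d - y..<d + 1]"
    have set: "set ws \<subseteq> {1..n - 1}" using y d_less by (auto simp: ws_def)
    have len: "length ws = Suc y" using y(1) by (simp add: ws_def del: upt_Suc)
    have val: "word_prod ws k = (if k = d + 1 then Suc m else if Suc m \<le> k \<and> k \<le> d then k + 1 else k)" for k
      by (simp only: ws_def word_prod_column[OF y(1)]) (simp only: y(2))
    have "word_prod ws \<in> min_coset_reps n d"
      using word_prod_permutes[OF set] \<open>m < d\<close> by (auto simp: min_coset_reps_def strict_mono_on_def val)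
    moreover have "word_prod ws (Suc k) = Suc (v k)" if "k < d" for k
      using that v_fixed[of k] v_eq_Suc[OF 2, of k] by (cases "k < m") (auto simp: val)
    ultimately have word: "word_prod ws = w" by (rule eq_word_prodI)
    \<comment> \<open>The word carries d + 1 to m + 1, a distance of y + 1.\<close>
    have "length ws \<le> length js" if "word_prod js = w" for js
      using word_prod_displacement(2)[of "d + 1" js] that val[of "d + 1"] word y len by simp
    then have "reduced_decomposition n w ws" using set word by (simp add: reduced_decomposition_def)
    then show ?thesis using y(3) unfolding ws_def by blast
  next
    case 3
    define x where "x = Suc t - d"
    have x: "1 < x" "x \<le> n - d" "d + x = Suc t" using 3 t_less by (auto simp: x_def)
    define ws where "ws = rev [d..<d + x]"
    have set: "set ws \<subseteq> {1..n - 1}" using x d_pos t_less by (auto simp: ws_def)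
    have len: "length ws = x" by (simp add: ws_def)
    have val: "word_prod ws k = (if k = d then Suc t else if d < k \<and> k \<le> Suc t then k - 1 else k)" for k
      by (simp only: ws_def word_prod_row) (simp only: x(3))
    have "word_prod ws \<in> min_coset_reps n d"
      using word_prod_permutes[OF set] 3(1) by (auto simp: min_coset_reps_def strict_mono_on_def val)
    moreover have "word_prod ws (Suc k) = Suc (v k)" if "k < d" for k
      using that v_fixed[of k] 3(2) by (cases "k = d - 1") (auto simp: val t_def)
    ultimately have word: "word_prod ws = w" by (rule eq_word_prodI)
    \<comment> \<open>The word carries d to t + 1, a distance of x.\<close>
    have "length ws \<le> length js" if "word_prod js = w" for js
      using word_prod_displacement(1)[of js d] that val[of d] word x len by simp
    then have "reduced_decomposition n w ws" using set word by (simp add: reduced_decomposition_def)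
    then show ?thesis using x(1,2) unfolding ws_def by blast
  qed
qed

end

theorem lemma4p1:
  fixes n d :: nat and w :: "nat \<Rightarrow> nat"
  assumes "1 \<le> d" and "d \<le> n - 1"
    and "w \<in> min_coset_reps n d"
    and "toric_Schubert n d w"
  shows "(smooth_variety (Schubert_variety n d w) \<longleftrightarrow>
            w = id \<or>
            (\<exists>x. 1 < x \<and> x \<le> n - d \<and> reduced_decomposition n w (rev [d..<d + x])) \<or>
            (\<exists>y. 0 \<le> y \<and> y \<le> d - 1 \<and> reduced_decomposition n w [d - y..<d + 1]))
       \<and> ((w = id \<or>
            (\<exists>x. 1 < x \<and> x \<le> n - d \<and> reduced_decomposition n w (rev [d..<d + x])) \<or>
            (\<exists>y. 0 \<le> y \<and> y \<le> d - 1 \<and> reduced_decomposition n w [d - y..<d + 1])) \<longleftrightarrow>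
          partition_of_perm d w = [] \<or>
          column_partition (partition_of_perm d w) \<or>
          row_partition (partition_of_perm d w))"
proof -
  interpret schubert n d w
    by unfold_locales (use assms in auto)
  have "normal_variety X" using assms(4) by (simp add: toric_Schubert_def Schubert_variety_eq)
  then have "smooth_variety (Schubert_variety n d w) \<longleftrightarrow> d - 1 \<le> m \<or> t \<le> d"
    using smooth_imp_row_or_column[OF assms(4)] row_or_column_imp_smooth
    unfolding Schubert_variety_eq by blast
  then show ?thesis
    by (simp only: reduced_word_row_or_column partition_row_or_column simp_thms)
qed

end
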